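(* Let $\mathbb K$ be an algebraically closed field of characteristic $2$, let $\alpha\in\mathbb K$, $\alpha\neq0,1$, and let $\mathfrak g=\mathfrak{wk}(4;\alpha)=\mathfrak g(A)$ be the Weisfeiler--Kac Lie algebra with Cartan matrix $$A=\begin{pmatrix}0&\alpha&1&0\\ \alpha&0&0&0\\1&0&0&1\\0&0&1&0\end{pmatrix}$$ with the basis $x_1,\dots,x_{15},y_1,\dots,y_{15},h_1,\dots,h_4$ described in the context. Then $H^2(\mathfrak g;\mathfrak g)$ is spanned by the classes of the following cocycles $c_{-12},c_{-10},c_{-8}^1,c_{-8}^2,c_{-6}^1,c_{-6}^2,c_{-4}^1,c_{-4}^2,c_{-2},c_0$ and of the symmetric cocycles $\omega\cdot c$ of positive degree, for $c$ running over those listed of negative degree: $c_{-12}= (1+\alpha)\big(\alpha^3y_3\otimes \hat x_9\wedge \hat x_{15} +\alpha^3y_3\otimes \hat x_{11}\wedge \hat x_{14} +\alpha ^2y_3\otimes \hat x_{12}\wedge \hat x_{13} +\alpha ^3y_6\otimes \hat x_7\wedge \hat x_{15} + \alpha ^2y_6\otimes \hat x_{11}\wedge \hat x_{13} +\alpha ^3 y_7\otimes \hat x_6\wedge \hat x_{15} +\alpha ^3y_7\otimes \hat x_8\wedge \hat x_{14} +\alpha ^2y_8\otimes \hat x_7\wedge \hat x_{14} + \alpha y_8\otimes \hat x_9\wedge \hat x_{13} +\alpha ^3y_9\otimes \hat x_3\wedge \hat x_{15} +\alpha ^2 y_9\otimes \hat x_8\wedge \hat x_{13} +\alpha y_{10}\otimes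 \hat x_7\wedge \hat x_{13} +\alpha ^2y_{11}\otimes \hat x_3\wedge \hat x_{14} + \alpha y_{11}\otimes \hat x_6\wedge \hat x_{13} +\alpha y_{12}\otimes \hat x_3\wedge \hat x_{13} +\alpha y_{13}\otimes \hat x_3\wedge \hat x_{12} +\alpha y_{13}\otimes \hat x_7\wedge \hat x_{10}\big) + \alpha y_{13}\otimes \hat x_8\wedge \hat x_9 +\alpha y_{14}\otimes \hat x_3\wedge \hat x_{11} +\alpha y_{14}\otimes \hat x_7\wedge \hat x_8 + y_{15}\otimes \hat x_3\wedge \hat x_9 +y_{15}\otimes \hat x_6\wedge \hat x_7+ \alpha ^2(1+\alpha^2) y_7\otimes \hat x_{10}\wedge \hat x_{13} +\alpha y_{13}\otimes \hat x_6\wedge \hat x_{11}$; $c_{-10}= (1+\alpha)\big(\alpha ^3x_3\otimes \hat x_9\wedge \hat x_{15} +\alpha ^3x_3\otimes \hat x_{11}\wedge \hat x_{14} + \alpha ^2x_3\otimes \hat x_{12}\wedge \hat x_{13} +\alpha ^3y_1\otimes \hat x_4\wedge \hat x_{15} + \alpha ^2y_1\otimes \hat x_{11}\wedge \hat x_{12} +\alpha ^3y_4\otimes \hat x_1\wedge \hat x_{15} +\alpha ^3y_4\otimes \hat x_5\wedge \hat x_{14} +\alpha ^2 y_4\otimes \hat x_{10}\wedge \hat x_{12} +\alpha ^2 y_5\otimes \hat x_4\wedge \hat x_{14} + \alpha y_5\otimes \hat x_9\wedge \hat x_{12} +\alpha ^2y_9\otimes \hat x_5\wedge \hat x_{12}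 +\alpha ^3 y_9\otimes \hat x_{15}\wedge \hat y_3 +\alpha y_{10}\otimes \hat x_4\wedge \hat x_{12} +\alpha y_{11}\otimes \hat x_1\wedge \hat x_{12} + \alpha ^2 y_{11}\otimes \hat x_{14}\wedge \hat y_3 +\alpha y_{12}\otimes \hat x_4\wedge \hat x_{10} +\alpha y_{12}\otimes \hat x_{13}\wedge \hat y_3 +\alpha y_{13}\otimes \hat x_{12}\wedge \hat y_3 \big) +\alpha y_{12}\otimes \hat x_1\wedge \hat x_{11} +\alpha y_{12}\otimes \hat x_5\wedge \hat x_9 + \alpha y_{14}\otimes \hat x_4\wedge \hat x_5 +\alpha y_{14}\otimes \hat x_{11}\wedge \hat y_3 +y_{15}\otimes \hat x_1\wedge \hat x_4 + y_{15}\otimes \hat x_9\wedge \hat y_3$; $c_{-8}^1= (1+\alpha)\big(\alpha ^3x_4\otimes \hat x_1\wedge \hat x_{15} +\alpha ^3 x_4\otimes \hat x_5\wedge \hat x_{14} +\alpha ^2 x_4\otimes \hat x_{10}\wedge \hat x_{12} +\alpha ^3x_7\otimes \hat x_6\wedge \hat x_{15} + \alpha^3x_7\otimes \hat x_8\wedge \hat x_{14} +\alpha ^2y_1\otimes \hat x_8\wedge \hat x_{10} +\alpha ^3 y_1\otimes \hat x_{15}\wedge \hat y_4 +\alpha y_5\otimes \hat x_6\wedge \hat x_{10} + \alpha ^2y_5\otimes \hat x_{14}\wedge \hat y_4 + \alpha^2y_6\otimes \hat x_5\wedge \hat x_{10} + \alpha ^3y_6\otimes \hat x_{15}\wedge \hat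 y_7+\alpha y_8\otimes \hat x_1\wedge \hat x_{10} +\alpha ^2y_8\otimes \hat x_{14}\wedge \hat y_7 + \alpha y_{10}\otimes \hat x_{12}\wedge \hat y_4 +\alpha y_{10}\otimes \hat x_{13}\wedge \hat y_7 +\alpha y_{12}\otimes \hat x_{10}\wedge \hat y_4 + \alpha y_{13}\otimes \hat x_{10}\wedge \hat y_7\big)+ \alpha y_{10}\otimes \hat x_1\wedge \hat x_8 +\alpha y_{10}\otimes \hat x_5\wedge \hat x_6 +\alpha y_{14}\otimes \hat x_5\wedge \hat y_4 +\alpha y_{14}\otimes \hat x_8\wedge \hat y_7 + y_{15}\otimes \hat x_1\wedge \hat y_4 + y_{15}\otimes \hat x_6\wedge \hat y_7 + \alpha ^2(1+\alpha^2)x_7\otimes \hat x_{10}\wedge \hat x_{13}$; $c_{-8}^2= (1+\alpha) \big( \alpha ^3x_1\otimes \hat x_4\wedge \hat x_{15} +\alpha ^2x_1\otimes \hat x_{11}\wedge \hat x_{12} +\alpha ^3 x_6\otimes \hat x_7\wedge \hat x_{15} +\alpha ^2x_6\otimes \hat x_{11}\wedge \hat x_{13} + \alpha ^2y_2\otimes \hat x_4\wedge \hat x_{13} +\alpha^2y_2\otimes \hat x_7\wedge \hat x_{12}+\alpha ^2 y_4\otimes \hat x_2\wedge \hat x_{13} +\alpha^2 y_4\otimes \hat x_8\wedge \hat x_{11} + \alpha ^3 y_4\otimes \hat x_{15}\wedge \hat y_1 + \alpha y_5\otimes \hat x_7\wedge \hat x_{11} +\alpha ^2y_7\otimes \hat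 x_2\wedge \hat x_{12} + \alpha ^2y_7\otimes \hat x_5\wedge \hat x_{11} +\alpha ^3y_7\otimes \hat x_{15}\wedge \hat y_6 +\alpha y_8\otimes \hat x_4\wedge \hat x_{11} + \alpha y_{11}\otimes \hat x_4\wedge \hat x_8 +\alpha y_{11}\otimes \hat x_5\wedge \hat x_7 +\alpha y_{11}\otimes \hat x_{12}\wedge \hat y_1 +\alpha y_{11}\otimes \hat x_{13}\wedge \hat y_6\big) + \alpha y_{12}\otimes \hat x_2\wedge \hat x_7 +\alpha y_{12}\otimes \hat x_{11}\wedge \hat y_1 +\alpha y_{13}\otimes \hat x_2\wedge \hat x_4 +\alpha y_{13}\otimes \hat x_{11}\wedge \hat y_6 + y_{15}\otimes \hat x_4\wedge \hat y_1 + y_{15}\otimes \hat x_7\wedge \hat y_6$; $c_{-6}^1= (1+\alpha)\big(\alpha x_2\otimes \hat x_4\wedge \hat x_{13} +\alpha x_2\otimes \hat x_7\wedge \hat x_{12} +\alpha x_5\otimes \hat x_4\wedge \hat x_{14}+x_5\otimes \hat x_9\wedge \hat x_{12} +\alpha x_8\otimes \hat x_7\wedge \hat x_{14}+ x_8\otimes \hat x_9\wedge \hat x_{13} +y_1\otimes \hat x_7\wedge \hat x_9 +y_4\otimes \hat x_6\wedge \hat x_9 +\alpha y_4\otimes \hat x_{13}\wedge \hat y_2 +\alpha ^2 y_4\otimes \hat x_{14}\wedge \hat y_5 + y_6\otimes \hat x_4\wedge \hat x_9 + y_7\otimes \hat x_1\wedge \hat x_9 +\alpha y_7\otimes \hat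 x_{12}\wedge \hat y_2 +\alpha ^2 y_7\otimes \hat x_{14}\wedge \hat y_8 + y_9\otimes \hat x_1\wedge \hat x_7 + y_9\otimes \hat x_4\wedge \hat x_6 +\alpha y_9\otimes \hat x_{12}\wedge \hat y_5 +\alpha y_9\otimes \hat x_{13}\wedge \hat y_8\big) +y_{12}\otimes \hat x_7\wedge \hat y_2 + y_{12}\otimes \hat x_9\wedge \hat y_5 + y_{13}\otimes \hat x_4\wedge \hat y_2 +y_{13}\otimes \hat x_9\wedge \hat y_8 + y_{14}\otimes \hat x_4\wedge \hat y_5 + y_{14}\otimes \hat x_7\wedge \hat y_8$; $c_{-6}^2= (1+\alpha)\big(\alpha ^2x_1\otimes \hat x_8\wedge \hat x_{10} +\alpha ^3x_1\otimes \hat x_{15}\wedge \hat y_4 +\alpha ^2 x_4\otimes \hat x_2\wedge \hat x_{13} +\alpha ^2 x_4\otimes \hat x_8\wedge \hat x_{11} + \alpha ^3x_4\otimes \hat x_{15}\wedge \hat y_1 + \alpha^3 x_9\otimes \hat x_3\wedge \hat x_{15} +\alpha ^2 x_9\otimes \hat x_8\wedge \hat x_{13} +\alpha ^2 y_2\otimes \hat x_3\wedge \hat x_{10} +\alpha ^2 y_2\otimes \hat x_{13}\wedge \hat y_4 + \alpha ^2y_3\otimes \hat x_2\wedge \hat x_{10} +\alpha^2 y_3\otimes \hat x_5\wedge \hat x_8 +\alpha^3 y_3\otimes \hat x_{15}\wedge \hat y_9 +\alpha y_5\otimes \hat x_3\wedge \hat x_8 +\alpha y_8\otimes \hat x_3\wedge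 \hat x_5 + \alpha y_8\otimes \hat x_{10}\wedge \hat y_1 +\alpha y_8\otimes \hat x_{11}\wedge \hat y_4 +\alpha y_8\otimes \hat x_{13}\wedge \hat y_9 +\alpha y_{11}\otimes \hat x_8\wedge \hat y_4\big) +\alpha y_{13}\otimes \hat x_2\wedge \hat y_4 + \alpha y_{10}\otimes \hat x_2\wedge \hat x_3 +\alpha y_{10}\otimes \hat x_8\wedge \hat y_1 +\alpha y_{13}\otimes \hat x_8\wedge \hat y_9 +y_{15}\otimes \hat x_3\wedge \hat y_9 + y_{15}\otimes \hat y_1\wedge \hat y_4$; $c_{-4}^1= (1+\alpha)\big(\alpha x_2\otimes \hat x_3\wedge \hat x_{10} +\alpha x_2\otimes \hat x_{13}\wedge \hat y_4 +x_4\otimes \hat x_6\wedge \hat x_9 +\alpha x_4\otimes \hat x_{13}\wedge \hat y_2 + \alpha ^2 x_4\otimes \hat x_{14}\wedge \hat y_5 +x_5\otimes \hat x_6\wedge \hat x_{10} +\alpha x_5\otimes \hat x_{14}\wedge \hat y_4 + \alpha x_{11}\otimes \hat x_3\wedge \hat x_{14} +x_{11}\otimes \hat x_6\wedge \hat x_{13} + y_1\otimes \hat x_3\wedge \hat x_6 +y_3\otimes \hat x_1\wedge \hat x_6 +\alpha y_3\otimes \hat x_{10}\wedge \hat y_2 +\alpha ^2y_3\otimes \hat x_{14}\wedge \hat y_{11} +y_6\otimes \hat x_1\wedge \hat x_3 + y_6\otimes \hat x_9\wedge \hat y_4 +\alpha y_6\otimes \hat x_{10}\wedge \hat y_5 +\alpha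 y_6\otimes \hat x_{13}\wedge \hat y_{11} + y_9\otimes \hat x_6\wedge \hat y_4\big) +y_{10}\otimes \hat x_3\wedge \hat y_2 + y_{10}\otimes \hat x_6\wedge \hat y_5 +y_{13}\otimes \hat x_6\wedge \hat y_{11} +y_{13}\otimes \hat y_2\wedge \hat y_4 +y_{14}\otimes \hat x_3\wedge \hat y_{11} +y_{14}\otimes \hat y_4\wedge \hat y_5$; $c_{-4}^2= (1+\alpha)\big(\alpha ^2 x_3\otimes \hat x_2\wedge \hat x_{10} +\alpha ^2 x_3\otimes \hat x_5\wedge \hat x_8 +\alpha ^3 x_3\otimes \hat x_{15}\wedge \hat y_9 +\alpha ^2 x_6\otimes \hat x_5\wedge \hat x_{10} + \alpha ^3 x_6\otimes \hat x_{15}\wedge \hat y_7 + \alpha ^2x_7\otimes \hat x_2\wedge \hat x_{12} +\alpha ^2 x_7\otimes \hat x_5\wedge \hat x_{11} + \alpha ^3 x_7\otimes \hat x_{15}\wedge \hat y_6 +\alpha ^2 x_9\otimes \hat x_5\wedge \hat x_{12} + \alpha ^3 x_9\otimes \hat x_{15}\wedge \hat y_3 + \alpha ^2 y_2\otimes \hat x_{10}\wedge \hat y_3 +\alpha ^2 y_2\otimes \hat x_{12}\wedge \hat y_7 +\alpha y_5\otimes \hat x_8\wedge \hat y_3 +\alpha y_5\otimes \hat x_{10}\wedge \hat y_6 + \alpha y_5\otimes \hat x_{11}\wedge \hat y_7 +\alpha y_5\otimes \hat x_{12}\wedge \hat y_9 +\alpha y_8\otimes \hat x_5\wedge \hat y_3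 +\alpha y_{11}\otimes \hat x_5\wedge \hat y_7\big) +\alpha y_{10}\otimes \hat x_2\wedge \hat y_3 + \alpha y_{10}\otimes \hat x_5\wedge \hat y_6 +\alpha y_{12}\otimes \hat x_2\wedge \hat y_7 +\alpha y_{12}\otimes \hat x_5\wedge \hat y_9 + y_{15}\otimes \hat y_3\wedge \hat y_9 +y_{15}\otimes \hat y_6\wedge \hat y_7$; $c_{-2}= (1+\alpha)\big(\alpha x_2\otimes \hat x_{10}\wedge \hat y_3 +\alpha x_2\otimes \hat x_{12}\wedge \hat y_7 + x_3\otimes \hat x_1\wedge \hat x_6 +\alpha x_3\otimes \hat x_{10}\wedge \hat y_2 +\alpha ^2x_3\otimes \hat x_{14}\wedge \hat y_{11} + x_7\otimes \hat x_1\wedge \hat x_9 +\alpha x_7\otimes \hat x_{12}\wedge \hat y_2 +\alpha ^2 x_7\otimes \hat x_{14}\wedge \hat y_8 +x_8\otimes \hat x_1\wedge \hat x_{10} +\alpha x_8\otimes \hat x_{14}\wedge \hat y_7 + x_{11}\otimes \hat x_1\wedge \hat x_{12} +\alpha x_{11}\otimes \hat x_{14}\wedge \hat y_3 +y_1\otimes \hat x_6\wedge \hat y_3 +y_1\otimes \hat x_9\wedge \hat y_7 +\alpha y_1\otimes \hat x_{10}\wedge \hat y_8 + \alpha y_1\otimes \hat x_{12}\wedge \hat y_{11} +y_6\otimes \hat x_1\wedge \hat y_3 + y_9\otimes \hat x_1\wedge \hat y_7\big)+ y_{10}\otimes \hat x_1\wedge \hat y_8 + y_{10}\otimes \hat y_2\wedge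 \hat y_3 +y_{12}\otimes \hat x_1\wedge \hat y_{11} + y_{12}\otimes \hat y_2\wedge \hat y_7 +y_{14}\otimes \hat y_3\wedge \hat y_{11} + y_{14}\otimes \hat y_7\wedge \hat y_8$; $c_{0}= \alpha h_1\otimes \hat x_{14}\wedge \hat y_{14} +\alpha ^2h_1\otimes \hat x_{15}\wedge \hat y_{15} +h_2\otimes \hat x_5\wedge \hat y_5 +h_2\otimes \hat x_8\wedge \hat y_8 +h_2\otimes \hat x_{10}\wedge \hat y_{10} + h_2\otimes \hat x_{11}\wedge \hat y_{11} +h_2\otimes \hat x_{12}\wedge \hat y_{12} +h_2\otimes \hat x_{13}\wedge \hat y_{13} +\alpha ^2h_2\otimes \hat x_{14}\wedge \hat y_{14} +h_3\otimes \hat x_1\wedge \hat y_1+ \alpha h_3\otimes \hat x_5\wedge \hat y_5 +h_3\otimes \hat x_6\wedge \hat y_6 +\alpha h_3\otimes \hat x_8\wedge \hat y_8 +h_3\otimes \hat x_9\wedge \hat y_9 +\alpha h_3\otimes \hat x_{10}\wedge \hat y_{10} + \alpha h_3\otimes \hat x_{11}\wedge \hat y_{11} +\alpha h_3\otimes \hat x_{12}\wedge \hat y_{12} +\alpha ^2(1+\alpha) h_3\otimes \hat x_{14}\wedge \hat y_{14} +\alpha ^3(1+\alpha) h_3\otimes \hat x_{15}\wedge \hat y_{15} + \alpha h_4\otimes \hat x_{12}\wedge \hat y_{12} + \alpha h_4\otimes \hat x_{13}\wedge \hat y_{13} +\alpha h_4\otimes \hat x_{14}\wedge \hat y_{14}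 +\alpha ^2 h_4\otimes \hat x_{15}\wedge \hat y_{15} +x_1\otimes \hat h_1\wedge \hat x_1 + \alpha x_1\otimes \hat x_{10}\wedge \hat y_8 +\alpha x_1\otimes \hat x_{12}\wedge \hat y_{11} +\alpha x_1\otimes \hat x_{14}\wedge \hat y_{13} +x_2\otimes \hat h_1\wedge \hat x_2 +x_2\otimes \hat x_5\wedge \hat y_1 + x_2\otimes \hat x_8\wedge \hat y_6 +x_2\otimes \hat x_{11}\wedge \hat y_9 +\alpha^3x_2 \otimes \hat x_{15}\wedge \hat y_{14} +\alpha x_3\otimes \hat x_{13}\wedge \hat y_{12} +x_4\otimes \hat h_1\wedge \hat x_4 + \alpha x_4\otimes \hat x_{12}\wedge \hat y_{10} +x_5\otimes \hat x_{10}\wedge \hat y_6+x_5\otimes \hat x_{12}\wedge \hat y_9 +\alpha x_5\otimes \hat x_{15}\wedge \hat y_{13} +x_6\otimes \hat h_1\wedge \hat x_6 + \alpha x_6\otimes \hat x_{10}\wedge \hat y_5 +\alpha x_6\otimes \hat x_{13}\wedge \hat y_{11} +\alpha x_6\otimes \hat x_{14}\wedge \hat y_{12} +x_7\otimes \hat h_1\wedge \hat x_7 +\alpha x_7\otimes \hat x_{13}\wedge \hat y_{10}+ x_8\otimes \hat x_{10}\wedge \hat y_1 +x_8\otimes \hat x_{13}\wedge \hat y_9 +\alpha x_8\otimes \hat x_{15}\wedge \hat y_{12} +\alpha x_9\otimes \hat x_{12}\wedge \hat y_5 +\alpha x_9\otimes \hat x_{13}\wedge \hat y_8+ \alpha x_9\otimes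 \hat x_{14}\wedge \hat y_{10} +x_{10}\otimes \hat h_1\wedge \hat x_{10} +x_{10}\otimes \hat x_{14}\wedge \hat y_9 +\alpha x_{10}\otimes \hat x_{15}\wedge \hat y_{11} +x_{11}\otimes \hat h_1\wedge \hat x_{11} + x_{11}\otimes \hat x_{12}\wedge \hat y_1 + x_{11}\otimes \hat x_{13}\wedge \hat y_6 +\alpha x_{11}\otimes \hat x_{15}\wedge \hat y_{10} +x_{12}\otimes \hat x_{14}\wedge \hat y_6 + \alpha x_{12}\otimes \hat x_{15}\wedge \hat y_8 + x_{13}\otimes \hat x_{14}\wedge \hat y_1 + \alpha x_{13}\otimes \hat x_{15}\wedge \hat y_5 +x_{14}\otimes \hat h_1\wedge \hat x_{14} + y_1\otimes \hat h_1\wedge \hat y_1 +\alpha y_1\otimes \hat x_8\wedge \hat y_{10} + \alpha y_1\otimes \hat x_{11}\wedge \hat y_{12} +\alpha y_1\otimes \hat x_{13}\wedge \hat y_{14} +y_2\otimes \hat h_1\wedge \hat y_2 +y_2\otimes \hat x_1\wedge \hat y_5 +y_2\otimes \hat x_6\wedge \hat y_8 + y_2\otimes \hat x_9\wedge \hat y_{11} +\alpha^3y_2\otimes \hat x_{14}\wedge \hat y_{15} + \alpha y_3\otimes \hat x_{12}\wedge \hat y_{13} +y_4\otimes \hat h_1\wedge \hat y_4 +\alpha y_4\otimes \hat x_{10}\wedge \hat y_{12}+ y_5\otimes \hat x_6\wedge \hat y_{10} +y_5\otimes \hat x_9\wedge \hat y_{12} +\alpha y_5\otimes \hat x_{13}\wedge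 \hat y_{15} +y_6\otimes \hat h_1\wedge \hat y_6 +\alpha y_6\otimes \hat x_5\wedge \hat y_{10} + \alpha y_6\otimes \hat x_{11}\wedge \hat y_{13} +\alpha y_6\otimes \hat x_{12}\wedge \hat y_{14} +y_7\otimes \hat h_1\wedge \hat y_7 +\alpha y_7\otimes \hat x_{10}\wedge \hat y_{13} + y_8\otimes \hat x_1\wedge \hat y_{10} + y_8\otimes \hat x_9\wedge \hat y_{13} +\alpha y_8\otimes \hat x_{12}\wedge \hat y_{15} +\alpha y_9\otimes \hat x_5\wedge \hat y_{12} +\alpha y_9\otimes \hat x_8\wedge \hat y_{13} +\alpha y_9\otimes \hat x_{10}\wedge \hat y_{14} + y_{10}\otimes \hat h_1\wedge \hat y_{10} +y_{10}\otimes \hat x_9\wedge \hat y_{14} +\alpha y_{10}\otimes \hat x_{11}\wedge \hat y_{15} + y_{11}\otimes \hat h_1\wedge \hat y_{11} +y_{11}\otimes \hat x_1\wedge \hat y_{12} + y_{11}\otimes \hat x_6\wedge \hat y_{13} +\alpha y_{11}\otimes \hat x_{10}\wedge \hat y_{15} +y_{12}\otimes \hat x_6\wedge \hat y_{14} +\alpha y_{12}\otimes \hat x_8\wedge \hat y_{15}+ y_{13}\otimes \hat x_1\wedge \hat y_{14} +\alpha y_{13}\otimes \hat x_5\wedge \hat y_{15} + y_{14}\otimes \hat h_1\wedge \hat y_{14}$.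
   Context: For an invertible $n\times n$ matrix $A$ over $\mathbb K$, $\mathfrak g(A)$ is the quotient of the Lie algebra generated by $x_i,y_i,h_i$ ($1\le i\le n$) subject to $[x_i,y_j]=\delta_{ij}h_i$, $[h_i,h_j]=0$, $[h_i,x_j]=A_{ij}x_j$, $[h_i,y_j]=-A_{ij}y_j$, by the maximal ideal intersecting $\mathrm{Span}(h_1,\dots,h_n)$ trivially. (The matrix $A$ above is invertible.) Positive basis elements: generators $x_1,x_2,x_3,x_4$ and $x_5=[x_1,x_2]$, $x_6=[x_1,x_3]$, $x_7=[x_3,x_4]$, $x_8=[x_3,[x_1,x_2]]$, $x_9=[x_4,[x_1,x_3]]$, $x_{10}=[[x_1,x_2],[x_1,x_3]]$, $x_{11}=[[x_1,x_2],[x_3,x_4]]$, $x_{12}=[[x_1,x_2],[x_4,[x_1,x_3]]]$, $x_{13}=[[x_3,[x_1,x_2]],[x_4,[x_1,x_3]]]$, $x_{14}=[[x_4,[x_1,x_3]],[[x_1,x_2],[x_1,x_3]]]$, $x_{15}=[[[x_1,x_2],[x_1,x_3]],[[x_1,x_2],[x_3,x_4]]]$. The negative basis elements $y_k$ are given by the same brackets with $x$'s replaced by $y$'s. The degree is that of the principal grading: $\deg x_i=1$, $\deg y_i=-1$ for the generators; the lower index of a cocycle is its degree. $H^2(\mathfrak g;\mathfrak g)$ is Chevalley--Eilenberg cohomology (with alternating cochains) with coefficients in the adjoint module. $\hat v$ denotes the element of the dual basis corresponding to the basis element $v$, and $u\otimes\hat v\wedge\hat w$ is the cochain $(X,Y)\mapsto(\hat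 v(X)\hat w(Y)+\hat v(Y)\hat w(X))u$. $\omega$ is the automorphism of $\mathfrak g$ interchanging $x_i$ and $y_i$ for the generators and fixing all $h_i$, and $(\omega\cdot c)(X,Y)=\omega(c(\omega^{-1}X,\omega^{-1}Y))$.
   Formalization: Four printed coefficients α² inside (1+α)(…) are corrected to α²(1+α): y₃⊗x̂₁₂∧x̂₁₃ in c₋₁₂, x₃⊗x̂₁₂∧x̂₁₃ and y₄⊗x̂₁₀∧x̂₁₂ in c₋₁₀, x₄⊗x̂₁₀∧x̂₁₂ in c₋₈¹ (else not cocycles); the maximal ideal is the largest graded one. *)

theory Defs
  imports
    "HOL-Analysis.Cartesian_Space"
    "HOL-Library.Poly_Mapping"
    "HOL-Library.Function_Algebras"
    "HOL-Computational_Algebra.Polynomial"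
begin

section \<open>The free nonassociative algebra on the Chevalley generators\<close>

datatype 'n generator = GenX 'n | GenY 'n | GenH 'n

datatype 'a monomial = Gen 'a | Br "'a monomial" "'a monomial"

text \<open>The free nonassociative algebra over \<^typ>\<open>'k\<close> on \<^typ>\<open>'a\<close> is the space
  \<^typ>\<open>'a monomial \<Rightarrow>\<^sub>0 'k\<close> with the bilinear extension of \<^const>\<open>Br\<close>.\<close>

definition fscale :: "'k::field \<Rightarrow> ('b \<Rightarrow>\<^sub>0 'k) \<Rightarrow> ('b \<Rightarrow>\<^sub>0 'k)" where
  "fscale c p = Poly_Mapping.map ((*) c) p"

lemma lookup_fscale: "Poly_Mapping.lookup (fscale c p) t = c * Poly_Mapping.lookup p t"
  by (simp add: fscale_def Poly_Mapping.map.rep_eq when_def)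

interpretation free_alg: vector_space fscale
  by unfold_locales (auto intro!: Poly_Mapping.poly_mapping_eqI simp: lookup_fscale Poly_Mapping.lookup_add algebra_simps)

definition fbr :: "('a monomial \<Rightarrow>\<^sub>0 'k::field) \<Rightarrow> ('a monomial \<Rightarrow>\<^sub>0 'k) \<Rightarrow> ('a monomial \<Rightarrow>\<^sub>0 'k)" where
  "fbr p q = (\<Sum>s\<in>Poly_Mapping.keys p. \<Sum>t\<in>Poly_Mapping.keys q.
     Poly_Mapping.single (Br s t) (Poly_Mapping.lookup p s * Poly_Mapping.lookup q t))"

definition fgen :: "'a \<Rightarrow> ('a monomial \<Rightarrow>\<^sub>0 'k::field)" where
  "fgen a = Poly_Mapping.single (Gen a) 1"

definition fideal :: "('a monomial \<Rightarrow>\<^sub>0 'k::field) set \<Rightarrow> bool" where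
  "fideal I \<longleftrightarrow> free_alg.subspace I \<and> (\<forall>p\<in>I. \<forall>q. fbr p q \<in> I \<and> fbr q p \<in> I)"

subsection \<open>The principal grading\<close>

primrec principal_degree :: "'n generator monomial \<Rightarrow> int" where
  "principal_degree (Gen a) = (case a of GenX i \<Rightarrow> 1 | GenY i \<Rightarrow> -1 | GenH i \<Rightarrow> 0)"
| "principal_degree (Br s t) = principal_degree s + principal_degree t"

definition homogeneous_component ::
    "int \<Rightarrow> ('n generator monomial \<Rightarrow>\<^sub>0 'k::field) \<Rightarrow> ('n generator monomial \<Rightarrow>\<^sub>0 'k)" where
  "homogeneous_component d p =
     (\<Sum>t | t \<in> Poly_Mapping.keys p \<and> principal_degree t = d.
       Poly_Mapping.single t (Poly_Mapping.lookup p t))"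

definition graded :: "('n generator monomial \<Rightarrow>\<^sub>0 'k::field) set \<Rightarrow> bool" where
  "graded I \<longleftrightarrow> (\<forall>p\<in>I. \<forall>d. homogeneous_component d p \<in> I)"

section \<open>The Lie algebra of a Cartan matrix\<close>

definition lie_relators :: "('a monomial \<Rightarrow>\<^sub>0 'k::field) set" where
  "lie_relators = {fbr p p | p. True} \<union>
     {fbr p (fbr q r) + fbr q (fbr r p) + fbr r (fbr p q) | p q r. True}"

definition chevalley_relators ::
    "'k::field ^ 'n ^ 'n \<Rightarrow> ('n::finite generator monomial \<Rightarrow>\<^sub>0 'k) set" where
  "chevalley_relators A =
     {fbr (fgen (GenX i)) (fgen (GenY j)) - (if i = j then fgen (GenH i) else 0) | i j. True} \<union>
     {fbr (fgen (GenH i)) (fgen (GenH j)) | i j. True} \<union>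
     {fbr (fgen (GenH i)) (fgen (GenX j)) - fscale (A $ i $ j) (fgen (GenX j)) | i j. True} \<union>
     {fbr (fgen (GenH i)) (fgen (GenY j)) + fscale (A $ i $ j) (fgen (GenY j)) | i j. True}"

text \<open>The free nonassociative algebra modulo the following ideal is the Lie algebra presented by
  the generators and the Chevalley relations; its ideals are the \<open>J / relation_ideal A\<close> with
  \<open>J\<close> an ideal containing \<open>relation_ideal A\<close>.\<close>

definition relation_ideal ::
    "'k::field ^ 'n ^ 'n \<Rightarrow> ('n::finite generator monomial \<Rightarrow>\<^sub>0 'k) set" where
  "relation_ideal A = \<Inter>{I. fideal I \<and> lie_relators \<subseteq> I \<and> chevalley_relators A \<subseteq> I}"

definition cartan_span :: "('n generator monomial \<Rightarrow>\<^sub>0 'k::field) set" where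
  "cartan_span = free_alg.span (range (\<lambda>i. fgen (GenH i)))"

text \<open>Preimages of the graded ideals that meet the span of the \<open>h\<^sub>i\<close> trivially. Gradedness cannot
  be dropped in positive characteristic, as there need not be a largest ideal among all those
  meeting that span trivially: for the cocycle \<open>c_m12\<close> below, \<open>[X,Y] + c_m12(X,Y)\<close> is again a
  Lie bracket and satisfies the Chevalley relations, but has another kernel.\<close>

definition admissible_ideal ::
    "'k::field ^ 'n ^ 'n \<Rightarrow> ('n::finite generator monomial \<Rightarrow>\<^sub>0 'k) set \<Rightarrow> bool" where
  "admissible_ideal A J \<longleftrightarrow> fideal J \<and> graded J \<and> relation_ideal A \<subseteq> J \<and>
     J \<inter> cartan_span \<subseteq> relation_ideal A"

primrec monomial_value :: "('g \<Rightarrow> 'g \<Rightarrow> 'g) \<Rightarrow> ('a \<Rightarrow> 'g) \<Rightarrow> 'a monomial \<Rightarrow> 'g" where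
  "monomial_value br \<phi> (Gen a) = \<phi> a"
| "monomial_value br \<phi> (Br s t) = br (monomial_value br \<phi> s) (monomial_value br \<phi> t)"

locale lie_algebra = vector_space scale
  for scale :: "'k::field \<Rightarrow> 'g::ab_group_add \<Rightarrow> 'g" (infixr \<open>*\<^sub>g\<close> 75) +
  fixes br :: "'g \<Rightarrow> 'g \<Rightarrow> 'g" (\<open>\<lbrakk>_,/ _\<rbrakk>\<close>)
  assumes linear_br_right: "Vector_Spaces.linear scale scale (\<lambda>Y. \<lbrakk>X, Y\<rbrakk>)"
    and linear_br_left: "Vector_Spaces.linear scale scale (\<lambda>X. \<lbrakk>X, Y\<rbrakk>)"
    and br_self: "\<lbrakk>X, X\<rbrakk> = 0"
    and jacobi: "\<lbrakk>X, \<lbrakk>Y, Z\<rbrakk>\<rbrakk> + \<lbrakk>Y, \<lbrakk>Z, X\<rbrakk>\<rbrakk> + \<lbrakk>Z, \<lbrakk>X, Y\<rbrakk>\<rbrakk> = 0"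
begin

subsection \<open>Chevalley--Eilenberg cohomology of degree two with adjoint coefficients\<close>

definition cscale :: "'k \<Rightarrow> ('g \<Rightarrow> 'g \<Rightarrow> 'g) \<Rightarrow> ('g \<Rightarrow> 'g \<Rightarrow> 'g)" (infixr \<open>\<odot>\<close> 70) where
  "a \<odot> c = (\<lambda>X Y. a *\<^sub>g c X Y)"

sublocale cochains: vector_space cscale
  by unfold_locales
    (auto simp: cscale_def fun_eq_iff scale_right_distrib scale_left_distrib)

definition C1 :: "('g \<Rightarrow> 'g) set" where
  "C1 = {f. Vector_Spaces.linear scale scale f}"

definition C2 :: "('g \<Rightarrow> 'g \<Rightarrow> 'g) set" where
  "C2 = {c. (\<forall>X. Vector_Spaces.linear scale scale (\<lambda>Y. c X Y)) \<and>
            (\<forall>Y. Vector_Spaces.linear scale scale (\<lambda>X. c X Y)) \<and>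
            (\<forall>X. c X X = 0)}"

definition d1 :: "('g \<Rightarrow> 'g) \<Rightarrow> 'g \<Rightarrow> 'g \<Rightarrow> 'g" where
  "d1 f X Y = \<lbrakk>X, f Y\<rbrakk> - \<lbrakk>Y, f X\<rbrakk> - f \<lbrakk>X, Y\<rbrakk>"

definition d2 :: "('g \<Rightarrow> 'g \<Rightarrow> 'g) \<Rightarrow> 'g \<Rightarrow> 'g \<Rightarrow> 'g \<Rightarrow> 'g" where
  "d2 c X Y Z = \<lbrakk>X, c Y Z\<rbrakk> - \<lbrakk>Y, c X Z\<rbrakk> + \<lbrakk>Z, c X Y\<rbrakk>
     - c \<lbrakk>X, Y\<rbrakk> Z + c \<lbrakk>X, Z\<rbrakk> Y - c \<lbrakk>Y, Z\<rbrakk> X"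

definition Z2 :: "('g \<Rightarrow> 'g \<Rightarrow> 'g) set" where
  "Z2 = {c \<in> C2. \<forall>X Y Z. d2 c X Y Z = 0}"

definition B2 :: "('g \<Rightarrow> 'g \<Rightarrow> 'g) set" where
  "B2 = d1 ` C1"

definition cohomology_class :: "('g \<Rightarrow> 'g \<Rightarrow> 'g) \<Rightarrow> ('g \<Rightarrow> 'g \<Rightarrow> 'g) set" where
  "cohomology_class c = {c + b | b. b \<in> B2}"

definition H2 :: "('g \<Rightarrow> 'g \<Rightarrow> 'g) set set" where
  "H2 = cohomology_class ` Z2"

text \<open>The vector space operations of \<^const>\<open>H2\<close> are those induced from cocycles, so the linear
  combinations of the classes of \<open>S\<close> are the classes of the linear combinations of \<open>S\<close>.\<close>

definition H2_spanned_by_classes :: "('g \<Rightarrow> 'g \<Rightarrow> 'g) set \<Rightarrow> bool" where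
  "H2_spanned_by_classes S \<longleftrightarrow> S \<subseteq> Z2 \<and> H2 = cohomology_class ` cochains.span S"

definition automorphism :: "('g \<Rightarrow> 'g) \<Rightarrow> bool" where
  "automorphism \<phi> \<longleftrightarrow> Vector_Spaces.linear scale scale \<phi> \<and> bij \<phi> \<and>
     (\<forall>X Y. \<phi> \<lbrakk>X, Y\<rbrakk> = \<lbrakk>\<phi> X, \<phi> Y\<rbrakk>)"

definition act :: "('g \<Rightarrow> 'g) \<Rightarrow> ('g \<Rightarrow> 'g \<Rightarrow> 'g) \<Rightarrow> ('g \<Rightarrow> 'g \<Rightarrow> 'g)" where
  "act \<phi> c = (\<lambda>X Y. \<phi> (c (inv \<phi> X) (inv \<phi> Y)))"

definition evaluation :: "('a \<Rightarrow> 'g) \<Rightarrow> ('a monomial \<Rightarrow>\<^sub>0 'k) \<Rightarrow> 'g" where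
  "evaluation \<phi> p = (\<Sum>t\<in>Poly_Mapping.keys p. Poly_Mapping.lookup p t *\<^sub>g monomial_value br \<phi> t)"

end

text \<open>A Lie algebra with elements \<open>e\<^sub>i\<close>, \<open>f\<^sub>i\<close>, \<open>h\<^sub>i\<close> is \<open>g(A)\<close> (with generators \<open>x\<^sub>i\<close>, \<open>y\<^sub>i\<close>, \<open>h\<^sub>i\<close>) iff
  the evaluation homomorphism from the free algebra is onto and its kernel is the largest
  admissible ideal.\<close>

locale cartan_matrix_lie_algebra = lie_algebra scale br
  for scale :: "'k::field \<Rightarrow> 'g::ab_group_add \<Rightarrow> 'g" (infixr \<open>*\<^sub>g\<close> 75)
    and br :: "'g \<Rightarrow> 'g \<Rightarrow> 'g" (\<open>\<lbrakk>_,/ _\<rbrakk>\<close>) +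
  fixes A :: "'k ^ 'n ^ 'n::finite" and e f h :: "'n \<Rightarrow> 'g"
  assumes range_evaluation: "range (evaluation (case_generator e f h)) = UNIV"
    and kernel_admissible: "admissible_ideal A {p. evaluation (case_generator e f h) p = 0}"
    and kernel_greatest: "admissible_ideal A J \<Longrightarrow> J \<subseteq> {p. evaluation (case_generator e f h) p = 0}"
begin

definition \<omega> :: "'g \<Rightarrow> 'g" where
  "\<omega> = (THE \<phi>. automorphism \<phi> \<and> (\<forall>i. \<phi> (e i) = f i \<and> \<phi> (f i) = e i \<and> \<phi> (h i) = h i))"

end

section \<open>The Weisfeiler--Kac algebra\<close>

definition wk4_matrix :: "'k::field \<Rightarrow> 'k ^ 4 ^ 4" where
  "wk4_matrix \<alpha> = vector
     [vector [0, \<alpha>, 1, 0],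
      vector [\<alpha>, 0, 0, 0],
      vector [1, 0, 0, 1],
      vector [0, 0, 1, 0]]"

locale wk4 = cartan_matrix_lie_algebra scale br "wk4_matrix \<alpha>" e f h
  for scale :: "'k::field \<Rightarrow> 'g::ab_group_add \<Rightarrow> 'g" (infixr \<open>*\<^sub>g\<close> 75)
    and br :: "'g \<Rightarrow> 'g \<Rightarrow> 'g" (\<open>\<lbrakk>_,/ _\<rbrakk>\<close>)
    and \<alpha> :: 'k and e f h :: "4 \<Rightarrow> 'g"
begin

definition root_vectors :: "(4 \<Rightarrow> 'g) \<Rightarrow> 'g list" where
  "root_vectors g =
     [g 1,
      g 2,
      g 3,
      g 4,
      \<lbrakk>g 1, g 2\<rbrakk>,
      \<lbrakk>g 1, g 3\<rbrakk>,
      \<lbrakk>g 3, g 4\<rbrakk>,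
      \<lbrakk>g 3, \<lbrakk>g 1, g 2\<rbrakk>\<rbrakk>,
      \<lbrakk>g 4, \<lbrakk>g 1, g 3\<rbrakk>\<rbrakk>,
      \<lbrakk>\<lbrakk>g 1, g 2\<rbrakk>, \<lbrakk>g 1, g 3\<rbrakk>\<rbrakk>,
      \<lbrakk>\<lbrakk>g 1, g 2\<rbrakk>, \<lbrakk>g 3, g 4\<rbrakk>\<rbrakk>,
      \<lbrakk>\<lbrakk>g 1, g 2\<rbrakk>, \<lbrakk>g 4, \<lbrakk>g 1, g 3\<rbrakk>\<rbrakk>\<rbrakk>,
      \<lbrakk>\<lbrakk>g 3, \<lbrakk>g 1, g 2\<rbrakk>\<rbrakk>, \<lbrakk>g 4, \<lbrakk>g 1, g 3\<rbrakk>\<rbrakk>\<rbrakk>,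
      \<lbrakk>\<lbrakk>g 4, \<lbrakk>g 1, g 3\<rbrakk>\<rbrakk>, \<lbrakk>\<lbrakk>g 1, g 2\<rbrakk>, \<lbrakk>g 1, g 3\<rbrakk>\<rbrakk>\<rbrakk>,
      \<lbrakk>\<lbrakk>\<lbrakk>g 1, g 2\<rbrakk>, \<lbrakk>g 1, g 3\<rbrakk>\<rbrakk>, \<lbrakk>\<lbrakk>g 1, g 2\<rbrakk>, \<lbrakk>g 3, g 4\<rbrakk>\<rbrakk>\<rbrakk>]"

definition x :: "nat \<Rightarrow> 'g" where "x k = root_vectors e ! (k - 1)"
definition y :: "nat \<Rightarrow> 'g" where "y k = root_vectors f ! (k - 1)"

definition standard_basis :: "'g set" where
  "standard_basis = x ` {1..15} \<union> y ` {1..15} \<union> range h"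

definition tensor :: "'g \<Rightarrow> 'g \<Rightarrow> 'g \<Rightarrow> 'g \<Rightarrow> 'g \<Rightarrow> 'g" (\<open>_ \<otimes> _ \<^bold>\<and> _\<close> [76, 76, 76] 75) where
  "u \<otimes> v \<^bold>\<and> w = (\<lambda>X Y.
     (representation standard_basis X v * representation standard_basis Y w +
      representation standard_basis Y v * representation standard_basis X w) *\<^sub>g u)"

text \<open>Four coefficients below carry a factor \<open>1 + \<alpha>\<close> missing from the printed source (which
  has \<open>\<alpha>^2\<close> there): those written \<open>\<alpha>^2 * (1 + \<alpha>)\<close> in \<open>c_m12\<close>, \<open>c_m10\<close> (twice) and \<open>c_m8_1\<close>. Without
  it these three cochains are not cocycles: for \<open>c_m12\<close> the value of the differential on
  \<open>(x 5, x 9, x 13)\<close> would be \<open>\<alpha>^3 * (1 + \<alpha>)\<close> times \<open>y 3\<close>.\<close>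

definition c_m12 :: "'g \<Rightarrow> 'g \<Rightarrow> 'g" where
  "c_m12 =
    (1 + \<alpha>) \<odot>
      (\<alpha>^3 \<odot> y 3 \<otimes> x 9 \<^bold>\<and> x 15 + \<alpha>^3 \<odot> y 3 \<otimes> x 11 \<^bold>\<and> x 14 +
       (\<alpha>^2 * (1 + \<alpha>)) \<odot> y 3 \<otimes> x 12 \<^bold>\<and> x 13 + \<alpha>^3 \<odot> y 6 \<otimes> x 7 \<^bold>\<and> x 15 +
       \<alpha>^2 \<odot> y 6 \<otimes> x 11 \<^bold>\<and> x 13 + \<alpha>^3 \<odot> y 7 \<otimes> x 6 \<^bold>\<and> x 15 +
       \<alpha>^3 \<odot> y 7 \<otimes> x 8 \<^bold>\<and> x 14 + \<alpha>^2 \<odot> y 8 \<otimes> x 7 \<^bold>\<and> x 14 +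
       \<alpha> \<odot> y 8 \<otimes> x 9 \<^bold>\<and> x 13 + \<alpha>^3 \<odot> y 9 \<otimes> x 3 \<^bold>\<and> x 15 +
       \<alpha>^2 \<odot> y 9 \<otimes> x 8 \<^bold>\<and> x 13 + \<alpha> \<odot> y 10 \<otimes> x 7 \<^bold>\<and> x 13 +
       \<alpha>^2 \<odot> y 11 \<otimes> x 3 \<^bold>\<and> x 14 + \<alpha> \<odot> y 11 \<otimes> x 6 \<^bold>\<and> x 13 +
       \<alpha> \<odot> y 12 \<otimes> x 3 \<^bold>\<and> x 13 + \<alpha> \<odot> y 13 \<otimes> x 3 \<^bold>\<and> x 12 +
       \<alpha> \<odot> y 13 \<otimes> x 7 \<^bold>\<and> x 10) +
    \<alpha> \<odot> y 13 \<otimes> x 8 \<^bold>\<and> x 9 + \<alpha> \<odot> y 14 \<otimes> x 3 \<^bold>\<and> x 11 +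
    \<alpha> \<odot> y 14 \<otimes> x 7 \<^bold>\<and> x 8 + y 15 \<otimes> x 3 \<^bold>\<and> x 9 +
    y 15 \<otimes> x 6 \<^bold>\<and> x 7 + (\<alpha>^2 * (1 + \<alpha>^2)) \<odot> y 7 \<otimes> x 10 \<^bold>\<and> x 13 +
    \<alpha> \<odot> y 13 \<otimes> x 6 \<^bold>\<and> x 11"

definition c_m10 :: "'g \<Rightarrow> 'g \<Rightarrow> 'g" where
  "c_m10 =
    (1 + \<alpha>) \<odot>
      (\<alpha>^3 \<odot> x 3 \<otimes> x 9 \<^bold>\<and> x 15 + \<alpha>^3 \<odot> x 3 \<otimes> x 11 \<^bold>\<and> x 14 +
       (\<alpha>^2 * (1 + \<alpha>)) \<odot> x 3 \<otimes> x 12 \<^bold>\<and> x 13 + \<alpha>^3 \<odot> y 1 \<otimes> x 4 \<^bold>\<and> x 15 +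
       \<alpha>^2 \<odot> y 1 \<otimes> x 11 \<^bold>\<and> x 12 + \<alpha>^3 \<odot> y 4 \<otimes> x 1 \<^bold>\<and> x 15 +
       \<alpha>^3 \<odot> y 4 \<otimes> x 5 \<^bold>\<and> x 14 + (\<alpha>^2 * (1 + \<alpha>)) \<odot> y 4 \<otimes> x 10 \<^bold>\<and> x 12 +
       \<alpha>^2 \<odot> y 5 \<otimes> x 4 \<^bold>\<and> x 14 + \<alpha> \<odot> y 5 \<otimes> x 9 \<^bold>\<and> x 12 +
       \<alpha>^2 \<odot> y 9 \<otimes> x 5 \<^bold>\<and> x 12 + \<alpha>^3 \<odot> y 9 \<otimes> x 15 \<^bold>\<and> y 3 +
       \<alpha> \<odot> y 10 \<otimes> x 4 \<^bold>\<and> x 12 + \<alpha> \<odot> y 11 \<otimes> x 1 \<^bold>\<and> x 12 +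
       \<alpha>^2 \<odot> y 11 \<otimes> x 14 \<^bold>\<and> y 3 + \<alpha> \<odot> y 12 \<otimes> x 4 \<^bold>\<and> x 10 +
       \<alpha> \<odot> y 12 \<otimes> x 13 \<^bold>\<and> y 3 + \<alpha> \<odot> y 13 \<otimes> x 12 \<^bold>\<and> y 3) +
    \<alpha> \<odot> y 12 \<otimes> x 1 \<^bold>\<and> x 11 + \<alpha> \<odot> y 12 \<otimes> x 5 \<^bold>\<and> x 9 +
    \<alpha> \<odot> y 14 \<otimes> x 4 \<^bold>\<and> x 5 + \<alpha> \<odot> y 14 \<otimes> x 11 \<^bold>\<and> y 3 +
    y 15 \<otimes> x 1 \<^bold>\<and> x 4 + y 15 \<otimes> x 9 \<^bold>\<and> y 3"

definition c_m8_1 :: "'g \<Rightarrow> 'g \<Rightarrow> 'g" where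
  "c_m8_1 =
    (1 + \<alpha>) \<odot>
      (\<alpha>^3 \<odot> x 4 \<otimes> x 1 \<^bold>\<and> x 15 + \<alpha>^3 \<odot> x 4 \<otimes> x 5 \<^bold>\<and> x 14 +
       (\<alpha>^2 * (1 + \<alpha>)) \<odot> x 4 \<otimes> x 10 \<^bold>\<and> x 12 + \<alpha>^3 \<odot> x 7 \<otimes> x 6 \<^bold>\<and> x 15 +
       \<alpha>^3 \<odot> x 7 \<otimes> x 8 \<^bold>\<and> x 14 + \<alpha>^2 \<odot> y 1 \<otimes> x 8 \<^bold>\<and> x 10 +
       \<alpha>^3 \<odot> y 1 \<otimes> x 15 \<^bold>\<and> y 4 + \<alpha> \<odot> y 5 \<otimes> x 6 \<^bold>\<and> x 10 +
       \<alpha>^2 \<odot> y 5 \<otimes> x 14 \<^bold>\<and> y 4 + \<alpha>^2 \<odot> y 6 \<otimes> x 5 \<^bold>\<and> x 10 +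
       \<alpha>^3 \<odot> y 6 \<otimes> x 15 \<^bold>\<and> y 7 + \<alpha> \<odot> y 8 \<otimes> x 1 \<^bold>\<and> x 10 +
       \<alpha>^2 \<odot> y 8 \<otimes> x 14 \<^bold>\<and> y 7 + \<alpha> \<odot> y 10 \<otimes> x 12 \<^bold>\<and> y 4 +
       \<alpha> \<odot> y 10 \<otimes> x 13 \<^bold>\<and> y 7 + \<alpha> \<odot> y 12 \<otimes> x 10 \<^bold>\<and> y 4 +
       \<alpha> \<odot> y 13 \<otimes> x 10 \<^bold>\<and> y 7) +
    \<alpha> \<odot> y 10 \<otimes> x 1 \<^bold>\<and> x 8 + \<alpha> \<odot> y 10 \<otimes> x 5 \<^bold>\<and> x 6 +
    \<alpha> \<odot> y 14 \<otimes> x 5 \<^bold>\<and> y 4 + \<alpha> \<odot> y 14 \<otimes> x 8 \<^bold>\<and> y 7 +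
    y 15 \<otimes> x 1 \<^bold>\<and> y 4 + y 15 \<otimes> x 6 \<^bold>\<and> y 7 +
    (\<alpha>^2 * (1 + \<alpha>^2)) \<odot> x 7 \<otimes> x 10 \<^bold>\<and> x 13"

definition c_m8_2 :: "'g \<Rightarrow> 'g \<Rightarrow> 'g" where
  "c_m8_2 =
    (1 + \<alpha>) \<odot>
      (\<alpha>^3 \<odot> x 1 \<otimes> x 4 \<^bold>\<and> x 15 + \<alpha>^2 \<odot> x 1 \<otimes> x 11 \<^bold>\<and> x 12 +
       \<alpha>^3 \<odot> x 6 \<otimes> x 7 \<^bold>\<and> x 15 + \<alpha>^2 \<odot> x 6 \<otimes> x 11 \<^bold>\<and> x 13 +
       \<alpha>^2 \<odot> y 2 \<otimes> x 4 \<^bold>\<and> x 13 + \<alpha>^2 \<odot> y 2 \<otimes> x 7 \<^bold>\<and> x 12 +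
       \<alpha>^2 \<odot> y 4 \<otimes> x 2 \<^bold>\<and> x 13 + \<alpha>^2 \<odot> y 4 \<otimes> x 8 \<^bold>\<and> x 11 +
       \<alpha>^3 \<odot> y 4 \<otimes> x 15 \<^bold>\<and> y 1 + \<alpha> \<odot> y 5 \<otimes> x 7 \<^bold>\<and> x 11 +
       \<alpha>^2 \<odot> y 7 \<otimes> x 2 \<^bold>\<and> x 12 + \<alpha>^2 \<odot> y 7 \<otimes> x 5 \<^bold>\<and> x 11 +
       \<alpha>^3 \<odot> y 7 \<otimes> x 15 \<^bold>\<and> y 6 + \<alpha> \<odot> y 8 \<otimes> x 4 \<^bold>\<and> x 11 +
       \<alpha> \<odot> y 11 \<otimes> x 4 \<^bold>\<and> x 8 + \<alpha> \<odot> y 11 \<otimes> x 5 \<^bold>\<and> x 7 +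
       \<alpha> \<odot> y 11 \<otimes> x 12 \<^bold>\<and> y 1 + \<alpha> \<odot> y 11 \<otimes> x 13 \<^bold>\<and> y 6) +
    \<alpha> \<odot> y 12 \<otimes> x 2 \<^bold>\<and> x 7 + \<alpha> \<odot> y 12 \<otimes> x 11 \<^bold>\<and> y 1 +
    \<alpha> \<odot> y 13 \<otimes> x 2 \<^bold>\<and> x 4 + \<alpha> \<odot> y 13 \<otimes> x 11 \<^bold>\<and> y 6 +
    y 15 \<otimes> x 4 \<^bold>\<and> y 1 + y 15 \<otimes> x 7 \<^bold>\<and> y 6"

definition c_m6_1 :: "'g \<Rightarrow> 'g \<Rightarrow> 'g" where
  "c_m6_1 =
    (1 + \<alpha>) \<odot>
      (\<alpha> \<odot> x 2 \<otimes> x 4 \<^bold>\<and> x 13 + \<alpha> \<odot> x 2 \<otimes> x 7 \<^bold>\<and> x 12 +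
       \<alpha> \<odot> x 5 \<otimes> x 4 \<^bold>\<and> x 14 + x 5 \<otimes> x 9 \<^bold>\<and> x 12 +
       \<alpha> \<odot> x 8 \<otimes> x 7 \<^bold>\<and> x 14 + x 8 \<otimes> x 9 \<^bold>\<and> x 13 +
       y 1 \<otimes> x 7 \<^bold>\<and> x 9 + y 4 \<otimes> x 6 \<^bold>\<and> x 9 +
       \<alpha> \<odot> y 4 \<otimes> x 13 \<^bold>\<and> y 2 + \<alpha>^2 \<odot> y 4 \<otimes> x 14 \<^bold>\<and> y 5 +
       y 6 \<otimes> x 4 \<^bold>\<and> x 9 + y 7 \<otimes> x 1 \<^bold>\<and> x 9 +
       \<alpha> \<odot> y 7 \<otimes> x 12 \<^bold>\<and> y 2 + \<alpha>^2 \<odot> y 7 \<otimes> x 14 \<^bold>\<and> y 8 +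
       y 9 \<otimes> x 1 \<^bold>\<and> x 7 + y 9 \<otimes> x 4 \<^bold>\<and> x 6 +
       \<alpha> \<odot> y 9 \<otimes> x 12 \<^bold>\<and> y 5 + \<alpha> \<odot> y 9 \<otimes> x 13 \<^bold>\<and> y 8) +
    y 12 \<otimes> x 7 \<^bold>\<and> y 2 + y 12 \<otimes> x 9 \<^bold>\<and> y 5 +
    y 13 \<otimes> x 4 \<^bold>\<and> y 2 + y 13 \<otimes> x 9 \<^bold>\<and> y 8 +
    y 14 \<otimes> x 4 \<^bold>\<and> y 5 + y 14 \<otimes> x 7 \<^bold>\<and> y 8"

definition c_m6_2 :: "'g \<Rightarrow> 'g \<Rightarrow> 'g" where
  "c_m6_2 =
    (1 + \<alpha>) \<odot>
      (\<alpha>^2 \<odot> x 1 \<otimes> x 8 \<^bold>\<and> x 10 + \<alpha>^3 \<odot> x 1 \<otimes> x 15 \<^bold>\<and> y 4 +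
       \<alpha>^2 \<odot> x 4 \<otimes> x 2 \<^bold>\<and> x 13 + \<alpha>^2 \<odot> x 4 \<otimes> x 8 \<^bold>\<and> x 11 +
       \<alpha>^3 \<odot> x 4 \<otimes> x 15 \<^bold>\<and> y 1 + \<alpha>^3 \<odot> x 9 \<otimes> x 3 \<^bold>\<and> x 15 +
       \<alpha>^2 \<odot> x 9 \<otimes> x 8 \<^bold>\<and> x 13 + \<alpha>^2 \<odot> y 2 \<otimes> x 3 \<^bold>\<and> x 10 +
       \<alpha>^2 \<odot> y 2 \<otimes> x 13 \<^bold>\<and> y 4 + \<alpha>^2 \<odot> y 3 \<otimes> x 2 \<^bold>\<and> x 10 +
       \<alpha>^2 \<odot> y 3 \<otimes> x 5 \<^bold>\<and> x 8 + \<alpha>^3 \<odot> y 3 \<otimes> x 15 \<^bold>\<and> y 9 +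
       \<alpha> \<odot> y 5 \<otimes> x 3 \<^bold>\<and> x 8 + \<alpha> \<odot> y 8 \<otimes> x 3 \<^bold>\<and> x 5 +
       \<alpha> \<odot> y 8 \<otimes> x 10 \<^bold>\<and> y 1 + \<alpha> \<odot> y 8 \<otimes> x 11 \<^bold>\<and> y 4 +
       \<alpha> \<odot> y 8 \<otimes> x 13 \<^bold>\<and> y 9 + \<alpha> \<odot> y 11 \<otimes> x 8 \<^bold>\<and> y 4) +
    \<alpha> \<odot> y 13 \<otimes> x 2 \<^bold>\<and> y 4 + \<alpha> \<odot> y 10 \<otimes> x 2 \<^bold>\<and> x 3 +
    \<alpha> \<odot> y 10 \<otimes> x 8 \<^bold>\<and> y 1 + \<alpha> \<odot> y 13 \<otimes> x 8 \<^bold>\<and> y 9 +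
    y 15 \<otimes> x 3 \<^bold>\<and> y 9 + y 15 \<otimes> y 1 \<^bold>\<and> y 4"

definition c_m4_1 :: "'g \<Rightarrow> 'g \<Rightarrow> 'g" where
  "c_m4_1 =
    (1 + \<alpha>) \<odot>
      (\<alpha> \<odot> x 2 \<otimes> x 3 \<^bold>\<and> x 10 + \<alpha> \<odot> x 2 \<otimes> x 13 \<^bold>\<and> y 4 +
       x 4 \<otimes> x 6 \<^bold>\<and> x 9 + \<alpha> \<odot> x 4 \<otimes> x 13 \<^bold>\<and> y 2 +
       \<alpha>^2 \<odot> x 4 \<otimes> x 14 \<^bold>\<and> y 5 + x 5 \<otimes> x 6 \<^bold>\<and> x 10 +
       \<alpha> \<odot> x 5 \<otimes> x 14 \<^bold>\<and> y 4 + \<alpha> \<odot> x 11 \<otimes> x 3 \<^bold>\<and> x 14 +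
       x 11 \<otimes> x 6 \<^bold>\<and> x 13 + y 1 \<otimes> x 3 \<^bold>\<and> x 6 +
       y 3 \<otimes> x 1 \<^bold>\<and> x 6 + \<alpha> \<odot> y 3 \<otimes> x 10 \<^bold>\<and> y 2 +
       \<alpha>^2 \<odot> y 3 \<otimes> x 14 \<^bold>\<and> y 11 + y 6 \<otimes> x 1 \<^bold>\<and> x 3 +
       y 6 \<otimes> x 9 \<^bold>\<and> y 4 + \<alpha> \<odot> y 6 \<otimes> x 10 \<^bold>\<and> y 5 +
       \<alpha> \<odot> y 6 \<otimes> x 13 \<^bold>\<and> y 11 + y 9 \<otimes> x 6 \<^bold>\<and> y 4) +
    y 10 \<otimes> x 3 \<^bold>\<and> y 2 + y 10 \<otimes> x 6 \<^bold>\<and> y 5 +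
    y 13 \<otimes> x 6 \<^bold>\<and> y 11 + y 13 \<otimes> y 2 \<^bold>\<and> y 4 +
    y 14 \<otimes> x 3 \<^bold>\<and> y 11 + y 14 \<otimes> y 4 \<^bold>\<and> y 5"

definition c_m4_2 :: "'g \<Rightarrow> 'g \<Rightarrow> 'g" where
  "c_m4_2 =
    (1 + \<alpha>) \<odot>
      (\<alpha>^2 \<odot> x 3 \<otimes> x 2 \<^bold>\<and> x 10 + \<alpha>^2 \<odot> x 3 \<otimes> x 5 \<^bold>\<and> x 8 +
       \<alpha>^3 \<odot> x 3 \<otimes> x 15 \<^bold>\<and> y 9 + \<alpha>^2 \<odot> x 6 \<otimes> x 5 \<^bold>\<and> x 10 +
       \<alpha>^3 \<odot> x 6 \<otimes> x 15 \<^bold>\<and> y 7 + \<alpha>^2 \<odot> x 7 \<otimes> x 2 \<^bold>\<and> x 12 +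
       \<alpha>^2 \<odot> x 7 \<otimes> x 5 \<^bold>\<and> x 11 + \<alpha>^3 \<odot> x 7 \<otimes> x 15 \<^bold>\<and> y 6 +
       \<alpha>^2 \<odot> x 9 \<otimes> x 5 \<^bold>\<and> x 12 + \<alpha>^3 \<odot> x 9 \<otimes> x 15 \<^bold>\<and> y 3 +
       \<alpha>^2 \<odot> y 2 \<otimes> x 10 \<^bold>\<and> y 3 + \<alpha>^2 \<odot> y 2 \<otimes> x 12 \<^bold>\<and> y 7 +
       \<alpha> \<odot> y 5 \<otimes> x 8 \<^bold>\<and> y 3 + \<alpha> \<odot> y 5 \<otimes> x 10 \<^bold>\<and> y 6 +
       \<alpha> \<odot> y 5 \<otimes> x 11 \<^bold>\<and> y 7 + \<alpha> \<odot> y 5 \<otimes> x 12 \<^bold>\<and> y 9 +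
       \<alpha> \<odot> y 8 \<otimes> x 5 \<^bold>\<and> y 3 + \<alpha> \<odot> y 11 \<otimes> x 5 \<^bold>\<and> y 7) +
    \<alpha> \<odot> y 10 \<otimes> x 2 \<^bold>\<and> y 3 + \<alpha> \<odot> y 10 \<otimes> x 5 \<^bold>\<and> y 6 +
    \<alpha> \<odot> y 12 \<otimes> x 2 \<^bold>\<and> y 7 + \<alpha> \<odot> y 12 \<otimes> x 5 \<^bold>\<and> y 9 +
    y 15 \<otimes> y 3 \<^bold>\<and> y 9 + y 15 \<otimes> y 6 \<^bold>\<and> y 7"

definition c_m2 :: "'g \<Rightarrow> 'g \<Rightarrow> 'g" where
  "c_m2 =
    (1 + \<alpha>) \<odot>
      (\<alpha> \<odot> x 2 \<otimes> x 10 \<^bold>\<and> y 3 + \<alpha> \<odot> x 2 \<otimes> x 12 \<^bold>\<and> y 7 +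
       x 3 \<otimes> x 1 \<^bold>\<and> x 6 + \<alpha> \<odot> x 3 \<otimes> x 10 \<^bold>\<and> y 2 +
       \<alpha>^2 \<odot> x 3 \<otimes> x 14 \<^bold>\<and> y 11 + x 7 \<otimes> x 1 \<^bold>\<and> x 9 +
       \<alpha> \<odot> x 7 \<otimes> x 12 \<^bold>\<and> y 2 + \<alpha>^2 \<odot> x 7 \<otimes> x 14 \<^bold>\<and> y 8 +
       x 8 \<otimes> x 1 \<^bold>\<and> x 10 + \<alpha> \<odot> x 8 \<otimes> x 14 \<^bold>\<and> y 7 +
       x 11 \<otimes> x 1 \<^bold>\<and> x 12 + \<alpha> \<odot> x 11 \<otimes> x 14 \<^bold>\<and> y 3 +
       y 1 \<otimes> x 6 \<^bold>\<and> y 3 + y 1 \<otimes> x 9 \<^bold>\<and> y 7 +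
       \<alpha> \<odot> y 1 \<otimes> x 10 \<^bold>\<and> y 8 + \<alpha> \<odot> y 1 \<otimes> x 12 \<^bold>\<and> y 11 +
       y 6 \<otimes> x 1 \<^bold>\<and> y 3 + y 9 \<otimes> x 1 \<^bold>\<and> y 7) +
    y 10 \<otimes> x 1 \<^bold>\<and> y 8 + y 10 \<otimes> y 2 \<^bold>\<and> y 3 +
    y 12 \<otimes> x 1 \<^bold>\<and> y 11 + y 12 \<otimes> y 2 \<^bold>\<and> y 7 +
    y 14 \<otimes> y 3 \<^bold>\<and> y 11 + y 14 \<otimes> y 7 \<^bold>\<and> y 8"

definition c_0 :: "'g \<Rightarrow> 'g \<Rightarrow> 'g" where
  "c_0 =
    \<alpha> \<odot> h 1 \<otimes> x 14 \<^bold>\<and> y 14 + \<alpha>^2 \<odot> h 1 \<otimes> x 15 \<^bold>\<and> y 15 +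
    h 2 \<otimes> x 5 \<^bold>\<and> y 5 + h 2 \<otimes> x 8 \<^bold>\<and> y 8 +
    h 2 \<otimes> x 10 \<^bold>\<and> y 10 + h 2 \<otimes> x 11 \<^bold>\<and> y 11 +
    h 2 \<otimes> x 12 \<^bold>\<and> y 12 + h 2 \<otimes> x 13 \<^bold>\<and> y 13 +
    \<alpha>^2 \<odot> h 2 \<otimes> x 14 \<^bold>\<and> y 14 + h 3 \<otimes> x 1 \<^bold>\<and> y 1 +
    \<alpha> \<odot> h 3 \<otimes> x 5 \<^bold>\<and> y 5 + h 3 \<otimes> x 6 \<^bold>\<and> y 6 +
    \<alpha> \<odot> h 3 \<otimes> x 8 \<^bold>\<and> y 8 + h 3 \<otimes> x 9 \<^bold>\<and> y 9 +
    \<alpha> \<odot> h 3 \<otimes> x 10 \<^bold>\<and> y 10 + \<alpha> \<odot> h 3 \<otimes> x 11 \<^bold>\<and> y 11 +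
    \<alpha> \<odot> h 3 \<otimes> x 12 \<^bold>\<and> y 12 + (\<alpha>^2 * (1 + \<alpha>)) \<odot> h 3 \<otimes> x 14 \<^bold>\<and> y 14 +
    (\<alpha>^3 * (1 + \<alpha>)) \<odot> h 3 \<otimes> x 15 \<^bold>\<and> y 15 + \<alpha> \<odot> h 4 \<otimes> x 12 \<^bold>\<and> y 12 +
    \<alpha> \<odot> h 4 \<otimes> x 13 \<^bold>\<and> y 13 + \<alpha> \<odot> h 4 \<otimes> x 14 \<^bold>\<and> y 14 +
    \<alpha>^2 \<odot> h 4 \<otimes> x 15 \<^bold>\<and> y 15 + x 1 \<otimes> h 1 \<^bold>\<and> x 1 +
    \<alpha> \<odot> x 1 \<otimes> x 10 \<^bold>\<and> y 8 + \<alpha> \<odot> x 1 \<otimes> x 12 \<^bold>\<and> y 11 +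
    \<alpha> \<odot> x 1 \<otimes> x 14 \<^bold>\<and> y 13 + x 2 \<otimes> h 1 \<^bold>\<and> x 2 +
    x 2 \<otimes> x 5 \<^bold>\<and> y 1 + x 2 \<otimes> x 8 \<^bold>\<and> y 6 +
    x 2 \<otimes> x 11 \<^bold>\<and> y 9 + \<alpha>^3 \<odot> x 2 \<otimes> x 15 \<^bold>\<and> y 14 +
    \<alpha> \<odot> x 3 \<otimes> x 13 \<^bold>\<and> y 12 + x 4 \<otimes> h 1 \<^bold>\<and> x 4 +
    \<alpha> \<odot> x 4 \<otimes> x 12 \<^bold>\<and> y 10 + x 5 \<otimes> x 10 \<^bold>\<and> y 6 +
    x 5 \<otimes> x 12 \<^bold>\<and> y 9 + \<alpha> \<odot> x 5 \<otimes> x 15 \<^bold>\<and> y 13 +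
    x 6 \<otimes> h 1 \<^bold>\<and> x 6 + \<alpha> \<odot> x 6 \<otimes> x 10 \<^bold>\<and> y 5 +
    \<alpha> \<odot> x 6 \<otimes> x 13 \<^bold>\<and> y 11 + \<alpha> \<odot> x 6 \<otimes> x 14 \<^bold>\<and> y 12 +
    x 7 \<otimes> h 1 \<^bold>\<and> x 7 + \<alpha> \<odot> x 7 \<otimes> x 13 \<^bold>\<and> y 10 +
    x 8 \<otimes> x 10 \<^bold>\<and> y 1 + x 8 \<otimes> x 13 \<^bold>\<and> y 9 +
    \<alpha> \<odot> x 8 \<otimes> x 15 \<^bold>\<and> y 12 + \<alpha> \<odot> x 9 \<otimes> x 12 \<^bold>\<and> y 5 +
    \<alpha> \<odot> x 9 \<otimes> x 13 \<^bold>\<and> y 8 + \<alpha> \<odot> x 9 \<otimes> x 14 \<^bold>\<and> y 10 +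
    x 10 \<otimes> h 1 \<^bold>\<and> x 10 + x 10 \<otimes> x 14 \<^bold>\<and> y 9 +
    \<alpha> \<odot> x 10 \<otimes> x 15 \<^bold>\<and> y 11 + x 11 \<otimes> h 1 \<^bold>\<and> x 11 +
    x 11 \<otimes> x 12 \<^bold>\<and> y 1 + x 11 \<otimes> x 13 \<^bold>\<and> y 6 +
    \<alpha> \<odot> x 11 \<otimes> x 15 \<^bold>\<and> y 10 + x 12 \<otimes> x 14 \<^bold>\<and> y 6 +
    \<alpha> \<odot> x 12 \<otimes> x 15 \<^bold>\<and> y 8 + x 13 \<otimes> x 14 \<^bold>\<and> y 1 +
    \<alpha> \<odot> x 13 \<otimes> x 15 \<^bold>\<and> y 5 + x 14 \<otimes> h 1 \<^bold>\<and> x 14 +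
    y 1 \<otimes> h 1 \<^bold>\<and> y 1 + \<alpha> \<odot> y 1 \<otimes> x 8 \<^bold>\<and> y 10 +
    \<alpha> \<odot> y 1 \<otimes> x 11 \<^bold>\<and> y 12 + \<alpha> \<odot> y 1 \<otimes> x 13 \<^bold>\<and> y 14 +
    y 2 \<otimes> h 1 \<^bold>\<and> y 2 + y 2 \<otimes> x 1 \<^bold>\<and> y 5 +
    y 2 \<otimes> x 6 \<^bold>\<and> y 8 + y 2 \<otimes> x 9 \<^bold>\<and> y 11 +
    \<alpha>^3 \<odot> y 2 \<otimes> x 14 \<^bold>\<and> y 15 + \<alpha> \<odot> y 3 \<otimes> x 12 \<^bold>\<and> y 13 +
    y 4 \<otimes> h 1 \<^bold>\<and> y 4 + \<alpha> \<odot> y 4 \<otimes> x 10 \<^bold>\<and> y 12 +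
    y 5 \<otimes> x 6 \<^bold>\<and> y 10 + y 5 \<otimes> x 9 \<^bold>\<and> y 12 +
    \<alpha> \<odot> y 5 \<otimes> x 13 \<^bold>\<and> y 15 + y 6 \<otimes> h 1 \<^bold>\<and> y 6 +
    \<alpha> \<odot> y 6 \<otimes> x 5 \<^bold>\<and> y 10 + \<alpha> \<odot> y 6 \<otimes> x 11 \<^bold>\<and> y 13 +
    \<alpha> \<odot> y 6 \<otimes> x 12 \<^bold>\<and> y 14 + y 7 \<otimes> h 1 \<^bold>\<and> y 7 +
    \<alpha> \<odot> y 7 \<otimes> x 10 \<^bold>\<and> y 13 + y 8 \<otimes> x 1 \<^bold>\<and> y 10 +
    y 8 \<otimes> x 9 \<^bold>\<and> y 13 + \<alpha> \<odot> y 8 \<otimes> x 12 \<^bold>\<and> y 15 +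
    \<alpha> \<odot> y 9 \<otimes> x 5 \<^bold>\<and> y 12 + \<alpha> \<odot> y 9 \<otimes> x 8 \<^bold>\<and> y 13 +
    \<alpha> \<odot> y 9 \<otimes> x 10 \<^bold>\<and> y 14 + y 10 \<otimes> h 1 \<^bold>\<and> y 10 +
    y 10 \<otimes> x 9 \<^bold>\<and> y 14 + \<alpha> \<odot> y 10 \<otimes> x 11 \<^bold>\<and> y 15 +
    y 11 \<otimes> h 1 \<^bold>\<and> y 11 + y 11 \<otimes> x 1 \<^bold>\<and> y 12 +
    y 11 \<otimes> x 6 \<^bold>\<and> y 13 + \<alpha> \<odot> y 11 \<otimes> x 10 \<^bold>\<and> y 15 +
    y 12 \<otimes> x 6 \<^bold>\<and> y 14 + \<alpha> \<odot> y 12 \<otimes> x 8 \<^bold>\<and> y 15 +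
    y 13 \<otimes> x 1 \<^bold>\<and> y 14 + \<alpha> \<odot> y 13 \<otimes> x 5 \<^bold>\<and> y 15 +
    y 14 \<otimes> h 1 \<^bold>\<and> y 14"

definition negative_cocycles :: "('g \<Rightarrow> 'g \<Rightarrow> 'g) set" where
  "negative_cocycles =
     {c_m12, c_m10, c_m8_1, c_m8_2, c_m6_1, c_m6_2, c_m4_1, c_m4_2, c_m2}"

end

end

theory Submission
  imports Defs
begin

text \<open>
  Reduced modulo two, the roots of the algebra become the nonzero vectors of the space
  \<open>F\<^sub>2\<^sup>4\<close>, each of them coming from exactly one pair of opposite roots. The Cartan matrix being
  invertible, combinations of the \<open>h\<^sub>i\<close> act on the root spaces through the four coordinates modulo two
  (\<open>torus_element\<close>). By Cartan's formula such an element acts on cocycles by coboundaries, so every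
  cocycle is cohomologous to one that respects this grading (\<open>torus_invariant\<close>). The coordinates
  of such a cocycle fall into 31 blocks, one for weight zero and one for twice each root, and the
  cocycle equations do not mix them.

  The classes have two sources. In characteristic two, \<open>(X, Y) \<mapsto> [[U,X],[U,Y]]\<close> is a cocycle for
  every \<open>U\<close> (\<open>square_Z2\<close>): up to sign it is the formal coboundary of \<open>(ad U)\<^sup>2 / 2\<close>, and only the
  division by two keeps it from being a coboundary. For nine of the root vectors \<open>U = y\<^sub>k\<close> it is,
  up to an invertible scalar and the coboundary of a multiple of \<open>y\<^sub>k \<otimes> x\<^sub>k\<close>, a listed cocycle of
  negative degree (\<open>square_data_cocycle\<close>); \<open>\<omega>\<close> carries these to the positive ones. The cocycle
  \<open>c\<^sub>0\<close> is, up to a coboundary, the derivative of the bracket with respect to \<open>\<alpha>\<close>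
  (\<open>t_0_cocycle\<close>): the Jacobi identity holds identically in \<open>\<alpha>\<close> and can be differentiated.

  That nothing else occurs is elimination. Subtracting coboundaries and listed cocycles makes
  91 chosen coordinates vanish (\<open>eliminate\<close>). After that, the cocycle identity on suitable triples
  of basis vectors contains one coordinate not yet known to vanish, with a coefficient that is a
  product of powers of \<open>\<alpha>\<close> and \<open>1 + \<alpha>\<close>, so that this coordinate vanishes too. In this way all
  values at a Chevalley generator disappear, and a cocycle with this property is zero, because the
  \<open>X\<close> at which it vanishes form a subalgebra (\<open>normalised_cocycle_zero\<close>).

  All of this presupposes the bracket in the standard basis, while the algebra is given through
  the largest admissible ideal. A model with an explicit table is a Lie algebra, and its relations
  are those of the given algebra (\<open>kernel_eq\<close>): they form an admissible ideal, and, conversely,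
  the largest admissible ideal has zero image in the model, since a nonzero homogeneous element
  of that image could be brought to degree zero by bracketing with generators of the opposite
  sign, where the image meets the span of the \<open>h\<^sub>i\<close> trivially.

  The table, the cocycles and the elimination have coefficients that are polynomials in \<open>\<alpha>\<close> over the
  field with two elements. They are written out as lists, on which every finite verification is
  a computation; the algebraic part interprets the lists.
\<close>

section \<open>Basis labels and polynomials over the field with two elements\<close>

text \<open>The labels \<open>Xk\<close>, \<open>Yk\<close>, \<open>Ti\<close> stand for \<open>x\<^sub>k\<close>, \<open>y\<^sub>k\<close>, \<open>h\<^sub>i\<close>.\<close>

datatype basis =
    X1 | X2 | X3 | X4 | X5 | X6 | X7 | X8 | X9 | X10 | X11 | X12 | X13 | X14 | X15
  | Y1 | Y2 | Y3 | Y4 | Y5 | Y6 | Y7 | Y8 | Y9 | Y10 | Y11 | Y12 | Y13 | Y14 | Y15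
  | T1 | T2 | T3 | T4

text \<open>Coefficients of powers of \<open>\<alpha>\<close>, constant term first. In the names of the constants below, \<open>a\<close>
  stands for \<open>\<alpha>\<close> and \<open>b\<close> for \<open>1 + \<alpha>\<close>; thus \<open>c1\<close> is the constant 1 and \<open>ca2bb\<close> is \<open>\<alpha>\<^sup>2 (1 + \<alpha>)\<^sup>2\<close>.\<close>

type_synonym coef = "bool list"

abbreviation c1 :: coef where "c1 \<equiv> [True]"
abbreviation ca :: coef where "ca \<equiv> [False, True]"
abbreviation cb :: coef where "cb \<equiv> [True, True]"
abbreviation cab :: coef where "cab \<equiv> [False, True, True]"
abbreviation ca2 :: coef where "ca2 \<equiv> [False, False, True]"
abbreviation ca3 :: coef where "ca3 \<equiv> [False, False, False, True]"
abbreviation ca2b :: coef where "ca2b \<equiv> [False, False, True, True]"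
abbreviation ca2bb :: coef where "ca2bb \<equiv> [False, False, True, False, True]"
abbreviation ca3b :: coef where "ca3b \<equiv> [False, False, False, True, True]"

fun coef_add :: "coef \<Rightarrow> coef \<Rightarrow> coef" where
  "coef_add [] q = q"
| "coef_add p [] = p"
| "coef_add (b # p) (c # q) = (b \<noteq> c) # coef_add p q"

primrec coef_mult :: "coef \<Rightarrow> coef \<Rightarrow> coef" where
  "coef_mult [] q = []"
| "coef_mult (b # p) q =
     (if b then coef_add q (False # coef_mult p q) else False # coef_mult p q)"

primrec coef_deriv :: "coef \<Rightarrow> coef" where
  "coef_deriv [] = []"
| "coef_deriv (b # p) = coef_add p (False # coef_deriv p)"

definition coef_zero :: "coef \<Rightarrow> bool" where
  "coef_zero p = list_all Not p"

text \<open>Equality with one of finitely many products of powers of \<open>\<alpha>\<close> and \<open>1 + \<alpha>\<close>, namely those by which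
  the proof divides. Lists may differ by trailing zeros, hence the comparison through the sum.\<close>

definition coef_unit :: "coef \<Rightarrow> bool" where
  "coef_unit p = list_ex (\<lambda>q. coef_zero (coef_add p q)) [c1, ca, cb, cab, ca2, ca2b, ca3b]"

text \<open>Formal linear combinations, in which a label may occur repeatedly.\<close>

type_synonym 'i combi = "('i \<times> coef) list"

definition combi_scale :: "coef \<Rightarrow> 'i combi \<Rightarrow> 'i combi" where
  "combi_scale p = map (\<lambda>(i, q). (i, coef_mult p q))"

primrec combi_insert :: "'i \<Rightarrow> coef \<Rightarrow> 'i combi \<Rightarrow> 'i combi" where
  "combi_insert i p [] = [(i, p)]"
| "combi_insert i p (t # ts) =
     (if fst t = i then (i, coef_add p (snd t)) # ts else t # combi_insert i p ts)"

primrec combi_collect :: "'i combi \<Rightarrow> 'i combi" where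
  "combi_collect [] = []"
| "combi_collect (t # ts) = combi_insert (fst t) (snd t) (combi_collect ts)"

definition vanishes :: "'i combi \<Rightarrow> bool" where
  "vanishes ts = list_all (\<lambda>t. coef_zero (snd t)) (combi_collect ts)"

section \<open>The bracket table\<close>

text \<open>The structure constants are polynomials in \<open>\<alpha>\<close> because every \<open>x\<^sub>k\<close> and \<open>y\<^sub>k\<close> is an iterated bracket
  of generators, on which the \<open>h\<^sub>i\<close> act through the Cartan matrix.\<close>

primrec bracket :: "basis \<Rightarrow> basis \<Rightarrow> basis combi" where
  "bracket X1 j = (case j of
     X2 \<Rightarrow> [(X5,c1)] | X3 \<Rightarrow> [(X6,c1)] | X7 \<Rightarrow> [(X9,c1)] | X8 \<Rightarrow> [(X10,c1)] | X11 \<Rightarrow> [(X12,c1)]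
     | X13 \<Rightarrow> [(X14,c1)] | Y1 \<Rightarrow> [(T1,c1)] | Y5 \<Rightarrow> [(Y2,ca)] | Y6 \<Rightarrow> [(Y3,c1)] | Y9 \<Rightarrow> [(Y7,c1)]
     | Y10 \<Rightarrow> [(Y8,cb)] | Y12 \<Rightarrow> [(Y11,cb)] | Y14 \<Rightarrow> [(Y13,ca)] | T2 \<Rightarrow> [(X1,ca)] | T3 \<Rightarrow> [(X1,c1)]
     | _ \<Rightarrow> [])"
| "bracket X2 j = (case j of
     X1 \<Rightarrow> [(X5,c1)] | X6 \<Rightarrow> [(X8,c1)] | X9 \<Rightarrow> [(X11,c1)] | X14 \<Rightarrow> [(X15,c1)] | Y2 \<Rightarrow> [(T2,c1)]
     | Y5 \<Rightarrow> [(Y1,ca)] | Y8 \<Rightarrow> [(Y6,ca)] | Y11 \<Rightarrow> [(Y9,ca)] | Y15 \<Rightarrow> [(Y14,ca)] | T1 \<Rightarrow> [(X2,ca)]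
     | _ \<Rightarrow> [])"
| "bracket X3 j = (case j of
     X1 \<Rightarrow> [(X6,c1)] | X4 \<Rightarrow> [(X7,c1)] | X5 \<Rightarrow> [(X8,c1)] | X12 \<Rightarrow> [(X13,c1)] | Y3 \<Rightarrow> [(T3,c1)]
     | Y6 \<Rightarrow> [(Y1,c1)] | Y7 \<Rightarrow> [(Y4,c1)] | Y8 \<Rightarrow> [(Y5,c1)] | Y13 \<Rightarrow> [(Y12,c1)] | T1 \<Rightarrow> [(X3,c1)]
     | T4 \<Rightarrow> [(X3,c1)] | _ \<Rightarrow> [])"
| "bracket X4 j = (case j of
     X3 \<Rightarrow> [(X7,c1)] | X6 \<Rightarrow> [(X9,c1)] | X8 \<Rightarrow> [(X11,c1)] | X10 \<Rightarrow> [(X12,c1)] | Y4 \<Rightarrow> [(T4,c1)]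
     | Y7 \<Rightarrow> [(Y3,c1)] | Y9 \<Rightarrow> [(Y6,c1)] | Y11 \<Rightarrow> [(Y8,c1)] | Y12 \<Rightarrow> [(Y10,c1)] | T3 \<Rightarrow> [(X4,c1)]
     | _ \<Rightarrow> [])"
| "bracket X5 j = (case j of
     X3 \<Rightarrow> [(X8,c1)] | X6 \<Rightarrow> [(X10,c1)] | X7 \<Rightarrow> [(X11,c1)] | X9 \<Rightarrow> [(X12,c1)] | X13 \<Rightarrow> [(X15,c1)]
     | Y1 \<Rightarrow> [(X2,ca)] | Y2 \<Rightarrow> [(X1,ca)] | Y5 \<Rightarrow> [(T1,ca), (T2,ca)] | Y8 \<Rightarrow> [(Y3,ca)]
     | Y10 \<Rightarrow> [(Y6,cab)] | Y11 \<Rightarrow> [(Y7,ca)] | Y12 \<Rightarrow> [(Y9,cab)] | Y15 \<Rightarrow> [(Y13,ca2)]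
     | T1 \<Rightarrow> [(X5,ca)] | T2 \<Rightarrow> [(X5,ca)] | T3 \<Rightarrow> [(X5,c1)] | _ \<Rightarrow> [])"
| "bracket X6 j = (case j of
     X2 \<Rightarrow> [(X8,c1)] | X4 \<Rightarrow> [(X9,c1)] | X5 \<Rightarrow> [(X10,c1)] | X11 \<Rightarrow> [(X13,c1)] | X12 \<Rightarrow> [(X14,c1)]
     | Y1 \<Rightarrow> [(X3,c1)] | Y3 \<Rightarrow> [(X1,c1)] | Y6 \<Rightarrow> [(T1,c1), (T3,c1)] | Y8 \<Rightarrow> [(Y2,ca)]
     | Y9 \<Rightarrow> [(Y4,c1)] | Y10 \<Rightarrow> [(Y5,cb)] | Y13 \<Rightarrow> [(Y11,cb)] | Y14 \<Rightarrow> [(Y12,ca)] | T1 \<Rightarrow> [(X6,c1)]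
     | T2 \<Rightarrow> [(X6,ca)] | T3 \<Rightarrow> [(X6,c1)] | T4 \<Rightarrow> [(X6,c1)] | _ \<Rightarrow> [])"
| "bracket X7 j = (case j of
     X1 \<Rightarrow> [(X9,c1)] | X5 \<Rightarrow> [(X11,c1)] | X10 \<Rightarrow> [(X13,c1)] | Y3 \<Rightarrow> [(X4,c1)] | Y4 \<Rightarrow> [(X3,c1)]
     | Y7 \<Rightarrow> [(T3,c1), (T4,c1)] | Y9 \<Rightarrow> [(Y1,c1)] | Y11 \<Rightarrow> [(Y5,c1)] | Y13 \<Rightarrow> [(Y10,c1)]
     | T1 \<Rightarrow> [(X7,c1)] | T3 \<Rightarrow> [(X7,c1)] | T4 \<Rightarrow> [(X7,c1)] | _ \<Rightarrow> [])"
| "bracket X8 j = (case j of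
     X1 \<Rightarrow> [(X10,c1)] | X4 \<Rightarrow> [(X11,c1)] | X9 \<Rightarrow> [(X13,c1)] | X12 \<Rightarrow> [(X15,c1)] | Y2 \<Rightarrow> [(X6,ca)]
     | Y3 \<Rightarrow> [(X5,c1)] | Y5 \<Rightarrow> [(X3,ca)] | Y6 \<Rightarrow> [(X2,ca)] | Y8 \<Rightarrow> [(T1,ca), (T2,ca), (T3,ca)]
     | Y10 \<Rightarrow> [(Y1,cab)] | Y11 \<Rightarrow> [(Y4,ca)] | Y13 \<Rightarrow> [(Y9,cab)] | Y15 \<Rightarrow> [(Y12,ca2)]
     | T1 \<Rightarrow> [(X8,cb)] | T2 \<Rightarrow> [(X8,ca)] | T3 \<Rightarrow> [(X8,c1)] | T4 \<Rightarrow> [(X8,c1)] | _ \<Rightarrow> [])"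
| "bracket X9 j = (case j of
     X2 \<Rightarrow> [(X11,c1)] | X5 \<Rightarrow> [(X12,c1)] | X8 \<Rightarrow> [(X13,c1)] | X10 \<Rightarrow> [(X14,c1)] | Y1 \<Rightarrow> [(X7,c1)]
     | Y4 \<Rightarrow> [(X6,c1)] | Y6 \<Rightarrow> [(X4,c1)] | Y7 \<Rightarrow> [(X1,c1)] | Y9 \<Rightarrow> [(T1,c1), (T3,c1), (T4,c1)]
     | Y11 \<Rightarrow> [(Y2,ca)] | Y12 \<Rightarrow> [(Y5,cb)] | Y13 \<Rightarrow> [(Y8,cb)] | Y14 \<Rightarrow> [(Y10,ca)] | T1 \<Rightarrow> [(X9,c1)]
     | T2 \<Rightarrow> [(X9,ca)] | T4 \<Rightarrow> [(X9,c1)] | _ \<Rightarrow> [])"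
| "bracket X10 j = (case j of
     X4 \<Rightarrow> [(X12,c1)] | X7 \<Rightarrow> [(X13,c1)] | X9 \<Rightarrow> [(X14,c1)] | X11 \<Rightarrow> [(X15,c1)] | Y1 \<Rightarrow> [(X8,cb)]
     | Y5 \<Rightarrow> [(X6,cab)] | Y6 \<Rightarrow> [(X5,cb)] | Y8 \<Rightarrow> [(X1,cab)] | Y10 \<Rightarrow> [(T2,cab), (T3,cab)]
     | Y12 \<Rightarrow> [(Y4,cab)] | Y13 \<Rightarrow> [(Y7,cab)] | Y14 \<Rightarrow> [(Y9,ca2b)] | Y15 \<Rightarrow> [(Y11,ca2b)]
     | T1 \<Rightarrow> [(X10,cb)] | T4 \<Rightarrow> [(X10,c1)] | _ \<Rightarrow> [])"
| "bracket X11 j = (case j of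
     X1 \<Rightarrow> [(X12,c1)] | X6 \<Rightarrow> [(X13,c1)] | X10 \<Rightarrow> [(X15,c1)] | Y2 \<Rightarrow> [(X9,ca)] | Y4 \<Rightarrow> [(X8,c1)]
     | Y5 \<Rightarrow> [(X7,ca)] | Y7 \<Rightarrow> [(X5,c1)] | Y8 \<Rightarrow> [(X4,ca)] | Y9 \<Rightarrow> [(X2,ca)]
     | Y11 \<Rightarrow> [(T1,ca), (T2,ca), (T3,ca), (T4,ca)] | Y12 \<Rightarrow> [(Y1,cab)] | Y13 \<Rightarrow> [(Y6,cab)]
     | Y15 \<Rightarrow> [(Y10,ca2)] | T1 \<Rightarrow> [(X11,cb)] | T2 \<Rightarrow> [(X11,ca)] | T4 \<Rightarrow> [(X11,c1)] | _ \<Rightarrow> [])"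
| "bracket X12 j = (case j of
     X3 \<Rightarrow> [(X13,c1)] | X6 \<Rightarrow> [(X14,c1)] | X8 \<Rightarrow> [(X15,c1)] | Y1 \<Rightarrow> [(X11,cb)] | Y4 \<Rightarrow> [(X10,c1)]
     | Y5 \<Rightarrow> [(X9,cab)] | Y9 \<Rightarrow> [(X5,cb)] | Y10 \<Rightarrow> [(X4,cab)] | Y11 \<Rightarrow> [(X1,cab)]
     | Y12 \<Rightarrow> [(T2,cab), (T3,cab), (T4,cab)] | Y13 \<Rightarrow> [(Y3,cab)] | Y14 \<Rightarrow> [(Y6,ca2b)]
     | Y15 \<Rightarrow> [(Y8,ca2b)] | T1 \<Rightarrow> [(X12,cb)] | T3 \<Rightarrow> [(X12,c1)] | T4 \<Rightarrow> [(X12,c1)] | _ \<Rightarrow> [])"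
| "bracket X13 j = (case j of
     X1 \<Rightarrow> [(X14,c1)] | X5 \<Rightarrow> [(X15,c1)] | Y3 \<Rightarrow> [(X12,c1)] | Y6 \<Rightarrow> [(X11,cb)] | Y7 \<Rightarrow> [(X10,c1)]
     | Y8 \<Rightarrow> [(X9,cab)] | Y9 \<Rightarrow> [(X8,cb)] | Y10 \<Rightarrow> [(X7,cab)] | Y11 \<Rightarrow> [(X6,cab)]
     | Y12 \<Rightarrow> [(X3,cab)] | Y13 \<Rightarrow> [(T2,cab), (T4,cab)] | Y14 \<Rightarrow> [(Y1,ca2b)] | Y15 \<Rightarrow> [(Y5,ca2b)]
     | T1 \<Rightarrow> [(X13,ca)] | T3 \<Rightarrow> [(X13,c1)] | _ \<Rightarrow> [])"
| "bracket X14 j = (case j of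
     X2 \<Rightarrow> [(X15,c1)] | Y1 \<Rightarrow> [(X13,ca)] | Y6 \<Rightarrow> [(X12,ca)] | Y9 \<Rightarrow> [(X10,ca)] | Y10 \<Rightarrow> [(X9,ca2b)]
     | Y12 \<Rightarrow> [(X6,ca2b)] | Y13 \<Rightarrow> [(X1,ca2b)] | Y14 \<Rightarrow> [(T1,ca2b), (T2,ca2b), (T4,ca2b)]
     | Y15 \<Rightarrow> [(Y2,ca3b)] | T1 \<Rightarrow> [(X14,ca)] | T2 \<Rightarrow> [(X14,ca)] | _ \<Rightarrow> [])"
| "bracket X15 j = (case j of
     Y2 \<Rightarrow> [(X14,ca)] | Y5 \<Rightarrow> [(X13,ca2)] | Y8 \<Rightarrow> [(X12,ca2)] | Y10 \<Rightarrow> [(X11,ca2b)]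
     | Y11 \<Rightarrow> [(X10,ca2)] | Y12 \<Rightarrow> [(X8,ca2b)] | Y13 \<Rightarrow> [(X5,ca2b)] | Y14 \<Rightarrow> [(X2,ca3b)]
     | Y15 \<Rightarrow> [(T1,ca3b), (T4,ca3b)] | T2 \<Rightarrow> [(X15,ca)] | _ \<Rightarrow> [])"
| "bracket Y1 j = (case j of
     X1 \<Rightarrow> [(T1,c1)] | X5 \<Rightarrow> [(X2,ca)] | X6 \<Rightarrow> [(X3,c1)] | X9 \<Rightarrow> [(X7,c1)] | X10 \<Rightarrow> [(X8,cb)]
     | X12 \<Rightarrow> [(X11,cb)] | X14 \<Rightarrow> [(X13,ca)] | Y2 \<Rightarrow> [(Y5,c1)] | Y3 \<Rightarrow> [(Y6,c1)] | Y7 \<Rightarrow> [(Y9,c1)]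
     | Y8 \<Rightarrow> [(Y10,c1)] | Y11 \<Rightarrow> [(Y12,c1)] | Y13 \<Rightarrow> [(Y14,c1)] | T2 \<Rightarrow> [(Y1,ca)] | T3 \<Rightarrow> [(Y1,c1)]
     | _ \<Rightarrow> [])"
| "bracket Y2 j = (case j of
     X2 \<Rightarrow> [(T2,c1)] | X5 \<Rightarrow> [(X1,ca)] | X8 \<Rightarrow> [(X6,ca)] | X11 \<Rightarrow> [(X9,ca)] | X15 \<Rightarrow> [(X14,ca)]
     | Y1 \<Rightarrow> [(Y5,c1)] | Y6 \<Rightarrow> [(Y8,c1)] | Y9 \<Rightarrow> [(Y11,c1)] | Y14 \<Rightarrow> [(Y15,c1)] | T1 \<Rightarrow> [(Y2,ca)]
     | _ \<Rightarrow> [])"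
| "bracket Y3 j = (case j of
     X3 \<Rightarrow> [(T3,c1)] | X6 \<Rightarrow> [(X1,c1)] | X7 \<Rightarrow> [(X4,c1)] | X8 \<Rightarrow> [(X5,c1)] | X13 \<Rightarrow> [(X12,c1)]
     | Y1 \<Rightarrow> [(Y6,c1)] | Y4 \<Rightarrow> [(Y7,c1)] | Y5 \<Rightarrow> [(Y8,c1)] | Y12 \<Rightarrow> [(Y13,c1)] | T1 \<Rightarrow> [(Y3,c1)]
     | T4 \<Rightarrow> [(Y3,c1)] | _ \<Rightarrow> [])"
| "bracket Y4 j = (case j of
     X4 \<Rightarrow> [(T4,c1)] | X7 \<Rightarrow> [(X3,c1)] | X9 \<Rightarrow> [(X6,c1)] | X11 \<Rightarrow> [(X8,c1)] | X12 \<Rightarrow> [(X10,c1)]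
     | Y3 \<Rightarrow> [(Y7,c1)] | Y6 \<Rightarrow> [(Y9,c1)] | Y8 \<Rightarrow> [(Y11,c1)] | Y10 \<Rightarrow> [(Y12,c1)] | T3 \<Rightarrow> [(Y4,c1)]
     | _ \<Rightarrow> [])"
| "bracket Y5 j = (case j of
     X1 \<Rightarrow> [(Y2,ca)] | X2 \<Rightarrow> [(Y1,ca)] | X5 \<Rightarrow> [(T1,ca), (T2,ca)] | X8 \<Rightarrow> [(X3,ca)]
     | X10 \<Rightarrow> [(X6,cab)] | X11 \<Rightarrow> [(X7,ca)] | X12 \<Rightarrow> [(X9,cab)] | X15 \<Rightarrow> [(X13,ca2)]
     | Y3 \<Rightarrow> [(Y8,c1)] | Y6 \<Rightarrow> [(Y10,c1)] | Y7 \<Rightarrow> [(Y11,c1)] | Y9 \<Rightarrow> [(Y12,c1)] | Y13 \<Rightarrow> [(Y15,c1)]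
     | T1 \<Rightarrow> [(Y5,ca)] | T2 \<Rightarrow> [(Y5,ca)] | T3 \<Rightarrow> [(Y5,c1)] | _ \<Rightarrow> [])"
| "bracket Y6 j = (case j of
     X1 \<Rightarrow> [(Y3,c1)] | X3 \<Rightarrow> [(Y1,c1)] | X6 \<Rightarrow> [(T1,c1), (T3,c1)] | X8 \<Rightarrow> [(X2,ca)]
     | X9 \<Rightarrow> [(X4,c1)] | X10 \<Rightarrow> [(X5,cb)] | X13 \<Rightarrow> [(X11,cb)] | X14 \<Rightarrow> [(X12,ca)] | Y2 \<Rightarrow> [(Y8,c1)]
     | Y4 \<Rightarrow> [(Y9,c1)] | Y5 \<Rightarrow> [(Y10,c1)] | Y11 \<Rightarrow> [(Y13,c1)] | Y12 \<Rightarrow> [(Y14,c1)] | T1 \<Rightarrow> [(Y6,c1)]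
     | T2 \<Rightarrow> [(Y6,ca)] | T3 \<Rightarrow> [(Y6,c1)] | T4 \<Rightarrow> [(Y6,c1)] | _ \<Rightarrow> [])"
| "bracket Y7 j = (case j of
     X3 \<Rightarrow> [(Y4,c1)] | X4 \<Rightarrow> [(Y3,c1)] | X7 \<Rightarrow> [(T3,c1), (T4,c1)] | X9 \<Rightarrow> [(X1,c1)]
     | X11 \<Rightarrow> [(X5,c1)] | X13 \<Rightarrow> [(X10,c1)] | Y1 \<Rightarrow> [(Y9,c1)] | Y5 \<Rightarrow> [(Y11,c1)] | Y10 \<Rightarrow> [(Y13,c1)]
     | T1 \<Rightarrow> [(Y7,c1)] | T3 \<Rightarrow> [(Y7,c1)] | T4 \<Rightarrow> [(Y7,c1)] | _ \<Rightarrow> [])"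
| "bracket Y8 j = (case j of
     X2 \<Rightarrow> [(Y6,ca)] | X3 \<Rightarrow> [(Y5,c1)] | X5 \<Rightarrow> [(Y3,ca)] | X6 \<Rightarrow> [(Y2,ca)]
     | X8 \<Rightarrow> [(T1,ca), (T2,ca), (T3,ca)] | X10 \<Rightarrow> [(X1,cab)] | X11 \<Rightarrow> [(X4,ca)] | X13 \<Rightarrow> [(X9,cab)]
     | X15 \<Rightarrow> [(X12,ca2)] | Y1 \<Rightarrow> [(Y10,c1)] | Y4 \<Rightarrow> [(Y11,c1)] | Y9 \<Rightarrow> [(Y13,c1)]
     | Y12 \<Rightarrow> [(Y15,c1)] | T1 \<Rightarrow> [(Y8,cb)] | T2 \<Rightarrow> [(Y8,ca)] | T3 \<Rightarrow> [(Y8,c1)] | T4 \<Rightarrow> [(Y8,c1)]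
     | _ \<Rightarrow> [])"
| "bracket Y9 j = (case j of
     X1 \<Rightarrow> [(Y7,c1)] | X4 \<Rightarrow> [(Y6,c1)] | X6 \<Rightarrow> [(Y4,c1)] | X7 \<Rightarrow> [(Y1,c1)]
     | X9 \<Rightarrow> [(T1,c1), (T3,c1), (T4,c1)] | X11 \<Rightarrow> [(X2,ca)] | X12 \<Rightarrow> [(X5,cb)] | X13 \<Rightarrow> [(X8,cb)]
     | X14 \<Rightarrow> [(X10,ca)] | Y2 \<Rightarrow> [(Y11,c1)] | Y5 \<Rightarrow> [(Y12,c1)] | Y8 \<Rightarrow> [(Y13,c1)]
     | Y10 \<Rightarrow> [(Y14,c1)] | T1 \<Rightarrow> [(Y9,c1)] | T2 \<Rightarrow> [(Y9,ca)] | T4 \<Rightarrow> [(Y9,c1)] | _ \<Rightarrow> [])"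
| "bracket Y10 j = (case j of
     X1 \<Rightarrow> [(Y8,cb)] | X5 \<Rightarrow> [(Y6,cab)] | X6 \<Rightarrow> [(Y5,cb)] | X8 \<Rightarrow> [(Y1,cab)]
     | X10 \<Rightarrow> [(T2,cab), (T3,cab)] | X12 \<Rightarrow> [(X4,cab)] | X13 \<Rightarrow> [(X7,cab)] | X14 \<Rightarrow> [(X9,ca2b)]
     | X15 \<Rightarrow> [(X11,ca2b)] | Y4 \<Rightarrow> [(Y12,c1)] | Y7 \<Rightarrow> [(Y13,c1)] | Y9 \<Rightarrow> [(Y14,c1)]
     | Y11 \<Rightarrow> [(Y15,c1)] | T1 \<Rightarrow> [(Y10,cb)] | T4 \<Rightarrow> [(Y10,c1)] | _ \<Rightarrow> [])"
| "bracket Y11 j = (case j of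
     X2 \<Rightarrow> [(Y9,ca)] | X4 \<Rightarrow> [(Y8,c1)] | X5 \<Rightarrow> [(Y7,ca)] | X7 \<Rightarrow> [(Y5,c1)] | X8 \<Rightarrow> [(Y4,ca)]
     | X9 \<Rightarrow> [(Y2,ca)] | X11 \<Rightarrow> [(T1,ca), (T2,ca), (T3,ca), (T4,ca)] | X12 \<Rightarrow> [(X1,cab)]
     | X13 \<Rightarrow> [(X6,cab)] | X15 \<Rightarrow> [(X10,ca2)] | Y1 \<Rightarrow> [(Y12,c1)] | Y6 \<Rightarrow> [(Y13,c1)]
     | Y10 \<Rightarrow> [(Y15,c1)] | T1 \<Rightarrow> [(Y11,cb)] | T2 \<Rightarrow> [(Y11,ca)] | T4 \<Rightarrow> [(Y11,c1)] | _ \<Rightarrow> [])"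
| "bracket Y12 j = (case j of
     X1 \<Rightarrow> [(Y11,cb)] | X4 \<Rightarrow> [(Y10,c1)] | X5 \<Rightarrow> [(Y9,cab)] | X9 \<Rightarrow> [(Y5,cb)] | X10 \<Rightarrow> [(Y4,cab)]
     | X11 \<Rightarrow> [(Y1,cab)] | X12 \<Rightarrow> [(T2,cab), (T3,cab), (T4,cab)] | X13 \<Rightarrow> [(X3,cab)]
     | X14 \<Rightarrow> [(X6,ca2b)] | X15 \<Rightarrow> [(X8,ca2b)] | Y3 \<Rightarrow> [(Y13,c1)] | Y6 \<Rightarrow> [(Y14,c1)]
     | Y8 \<Rightarrow> [(Y15,c1)] | T1 \<Rightarrow> [(Y12,cb)] | T3 \<Rightarrow> [(Y12,c1)] | T4 \<Rightarrow> [(Y12,c1)] | _ \<Rightarrow> [])"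
| "bracket Y13 j = (case j of
     X3 \<Rightarrow> [(Y12,c1)] | X6 \<Rightarrow> [(Y11,cb)] | X7 \<Rightarrow> [(Y10,c1)] | X8 \<Rightarrow> [(Y9,cab)] | X9 \<Rightarrow> [(Y8,cb)]
     | X10 \<Rightarrow> [(Y7,cab)] | X11 \<Rightarrow> [(Y6,cab)] | X12 \<Rightarrow> [(Y3,cab)] | X13 \<Rightarrow> [(T2,cab), (T4,cab)]
     | X14 \<Rightarrow> [(X1,ca2b)] | X15 \<Rightarrow> [(X5,ca2b)] | Y1 \<Rightarrow> [(Y14,c1)] | Y5 \<Rightarrow> [(Y15,c1)]
     | T1 \<Rightarrow> [(Y13,ca)] | T3 \<Rightarrow> [(Y13,c1)] | _ \<Rightarrow> [])"
| "bracket Y14 j = (case j of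
     X1 \<Rightarrow> [(Y13,ca)] | X6 \<Rightarrow> [(Y12,ca)] | X9 \<Rightarrow> [(Y10,ca)] | X10 \<Rightarrow> [(Y9,ca2b)]
     | X12 \<Rightarrow> [(Y6,ca2b)] | X13 \<Rightarrow> [(Y1,ca2b)] | X14 \<Rightarrow> [(T1,ca2b), (T2,ca2b), (T4,ca2b)]
     | X15 \<Rightarrow> [(X2,ca3b)] | Y2 \<Rightarrow> [(Y15,c1)] | T1 \<Rightarrow> [(Y14,ca)] | T2 \<Rightarrow> [(Y14,ca)] | _ \<Rightarrow> [])"
| "bracket Y15 j = (case j of
     X2 \<Rightarrow> [(Y14,ca)] | X5 \<Rightarrow> [(Y13,ca2)] | X8 \<Rightarrow> [(Y12,ca2)] | X10 \<Rightarrow> [(Y11,ca2b)]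
     | X11 \<Rightarrow> [(Y10,ca2)] | X12 \<Rightarrow> [(Y8,ca2b)] | X13 \<Rightarrow> [(Y5,ca2b)] | X14 \<Rightarrow> [(Y2,ca3b)]
     | X15 \<Rightarrow> [(T1,ca3b), (T4,ca3b)] | T2 \<Rightarrow> [(Y15,ca)] | _ \<Rightarrow> [])"
| "bracket T1 j = (case j of
     X2 \<Rightarrow> [(X2,ca)] | X3 \<Rightarrow> [(X3,c1)] | X5 \<Rightarrow> [(X5,ca)] | X6 \<Rightarrow> [(X6,c1)] | X7 \<Rightarrow> [(X7,c1)]
     | X8 \<Rightarrow> [(X8,cb)] | X9 \<Rightarrow> [(X9,c1)] | X10 \<Rightarrow> [(X10,cb)] | X11 \<Rightarrow> [(X11,cb)] | X12 \<Rightarrow> [(X12,cb)]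
     | X13 \<Rightarrow> [(X13,ca)] | X14 \<Rightarrow> [(X14,ca)] | Y2 \<Rightarrow> [(Y2,ca)] | Y3 \<Rightarrow> [(Y3,c1)] | Y5 \<Rightarrow> [(Y5,ca)]
     | Y6 \<Rightarrow> [(Y6,c1)] | Y7 \<Rightarrow> [(Y7,c1)] | Y8 \<Rightarrow> [(Y8,cb)] | Y9 \<Rightarrow> [(Y9,c1)] | Y10 \<Rightarrow> [(Y10,cb)]
     | Y11 \<Rightarrow> [(Y11,cb)] | Y12 \<Rightarrow> [(Y12,cb)] | Y13 \<Rightarrow> [(Y13,ca)] | Y14 \<Rightarrow> [(Y14,ca)] | _ \<Rightarrow> [])"
| "bracket T2 j = (case j of
     X1 \<Rightarrow> [(X1,ca)] | X5 \<Rightarrow> [(X5,ca)] | X6 \<Rightarrow> [(X6,ca)] | X8 \<Rightarrow> [(X8,ca)] | X9 \<Rightarrow> [(X9,ca)]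
     | X11 \<Rightarrow> [(X11,ca)] | X14 \<Rightarrow> [(X14,ca)] | X15 \<Rightarrow> [(X15,ca)] | Y1 \<Rightarrow> [(Y1,ca)] | Y5 \<Rightarrow> [(Y5,ca)]
     | Y6 \<Rightarrow> [(Y6,ca)] | Y8 \<Rightarrow> [(Y8,ca)] | Y9 \<Rightarrow> [(Y9,ca)] | Y11 \<Rightarrow> [(Y11,ca)] | Y14 \<Rightarrow> [(Y14,ca)]
     | Y15 \<Rightarrow> [(Y15,ca)] | _ \<Rightarrow> [])"
| "bracket T3 j = (case j of
     X1 \<Rightarrow> [(X1,c1)] | X4 \<Rightarrow> [(X4,c1)] | X5 \<Rightarrow> [(X5,c1)] | X6 \<Rightarrow> [(X6,c1)] | X7 \<Rightarrow> [(X7,c1)]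
     | X8 \<Rightarrow> [(X8,c1)] | X12 \<Rightarrow> [(X12,c1)] | X13 \<Rightarrow> [(X13,c1)] | Y1 \<Rightarrow> [(Y1,c1)] | Y4 \<Rightarrow> [(Y4,c1)]
     | Y5 \<Rightarrow> [(Y5,c1)] | Y6 \<Rightarrow> [(Y6,c1)] | Y7 \<Rightarrow> [(Y7,c1)] | Y8 \<Rightarrow> [(Y8,c1)] | Y12 \<Rightarrow> [(Y12,c1)]
     | Y13 \<Rightarrow> [(Y13,c1)] | _ \<Rightarrow> [])"
| "bracket T4 j = (case j of
     X3 \<Rightarrow> [(X3,c1)] | X6 \<Rightarrow> [(X6,c1)] | X7 \<Rightarrow> [(X7,c1)] | X8 \<Rightarrow> [(X8,c1)] | X9 \<Rightarrow> [(X9,c1)]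
     | X10 \<Rightarrow> [(X10,c1)] | X11 \<Rightarrow> [(X11,c1)] | X12 \<Rightarrow> [(X12,c1)] | Y3 \<Rightarrow> [(Y3,c1)] | Y6 \<Rightarrow> [(Y6,c1)]
     | Y7 \<Rightarrow> [(Y7,c1)] | Y8 \<Rightarrow> [(Y8,c1)] | Y9 \<Rightarrow> [(Y9,c1)] | Y10 \<Rightarrow> [(Y10,c1)] | Y11 \<Rightarrow> [(Y11,c1)]
     | Y12 \<Rightarrow> [(Y12,c1)] | _ \<Rightarrow> [])"

definition ad_combi :: "basis \<Rightarrow> basis combi \<Rightarrow> basis combi" where
  "ad_combi i ts = concat (map (\<lambda>(k, p). combi_scale p (bracket i k)) ts)"

definition jacobi_terms :: "basis \<Rightarrow> basis \<Rightarrow> basis \<Rightarrow> basis combi" where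
  "jacobi_terms i j k =
     ad_combi i (bracket j k) @ ad_combi j (bracket k i) @ ad_combi k (bracket i j)"

definition basis_list :: "basis list" where
  "basis_list = [X1, X2, X3, X4, X5, X6, X7, X8, X9, X10, X11, X12, X13, X14, X15, Y1, Y2, Y3, Y4, Y5, Y6,
      Y7, Y8, Y9, Y10, Y11, Y12, Y13, Y14, Y15, T1, T2, T3, T4]"

text \<open>The effect of \<open>\<omega>\<close> on the basis.\<close>

primrec swap :: "basis \<Rightarrow> basis" where
  "swap X1 = Y1" | "swap X2 = Y2" | "swap X3 = Y3" | "swap X4 = Y4" | "swap X5 = Y5"
| "swap X6 = Y6" | "swap X7 = Y7" | "swap X8 = Y8" | "swap X9 = Y9" | "swap X10 = Y10"
| "swap X11 = Y11" | "swap X12 = Y12" | "swap X13 = Y13" | "swap X14 = Y14" | "swap X15 = Y15"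
| "swap Y1 = X1" | "swap Y2 = X2" | "swap Y3 = X3" | "swap Y4 = X4" | "swap Y5 = X5"
| "swap Y6 = X6" | "swap Y7 = X7" | "swap Y8 = X8" | "swap Y9 = X9" | "swap Y10 = X10"
| "swap Y11 = X11" | "swap Y12 = X12" | "swap Y13 = X13" | "swap Y14 = X14" | "swap Y15 = X15"
| "swap T1 = T1" | "swap T2 = T2" | "swap T3 = T3" | "swap T4 = T4"

primrec basis_degree :: "basis \<Rightarrow> int" where
  "basis_degree X1 = 1" | "basis_degree X2 = 1" | "basis_degree X3 = 1" | "basis_degree X4 = 1"
| "basis_degree X5 = 2" | "basis_degree X6 = 2" | "basis_degree X7 = 2" | "basis_degree X8 = 3"
| "basis_degree X9 = 3" | "basis_degree X10 = 4" | "basis_degree X11 = 4"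
| "basis_degree X12 = 5" | "basis_degree X13 = 6" | "basis_degree X14 = 7"
| "basis_degree X15 = 8" | "basis_degree Y1 = - 1" | "basis_degree Y2 = - 1"
| "basis_degree Y3 = - 1" | "basis_degree Y4 = - 1" | "basis_degree Y5 = - 2"
| "basis_degree Y6 = - 2" | "basis_degree Y7 = - 2" | "basis_degree Y8 = - 3"
| "basis_degree Y9 = - 3" | "basis_degree Y10 = - 4" | "basis_degree Y11 = - 4"
| "basis_degree Y12 = - 5" | "basis_degree Y13 = - 6" | "basis_degree Y14 = - 7"
| "basis_degree Y15 = - 8" | "basis_degree T1 = 0" | "basis_degree T2 = 0"
| "basis_degree T3 = 0" | "basis_degree T4 = 0"

text \<open>The coordinates of the root modulo two, with respect to the simple roots.\<close>

primrec parity :: "basis \<Rightarrow> bool list" where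
  "parity X1 = [True, False, False, False]" | "parity X2 = [False, True, False, False]"
| "parity X3 = [False, False, True, False]" | "parity X4 = [False, False, False, True]"
| "parity X5 = [True, True, False, False]" | "parity X6 = [True, False, True, False]"
| "parity X7 = [False, False, True, True]" | "parity X8 = [True, True, True, False]"
| "parity X9 = [True, False, True, True]" | "parity X10 = [False, True, True, False]"
| "parity X11 = [True, True, True, True]" | "parity X12 = [False, True, True, True]"
| "parity X13 = [False, True, False, True]" | "parity X14 = [True, True, False, True]"
| "parity X15 = [True, False, False, True]" | "parity Y1 = [True, False, False, False]"
| "parity Y2 = [False, True, False, False]" | "parity Y3 = [False, False, True, False]"
| "parity Y4 = [False, False, False, True]" | "parity Y5 = [True, True, False, False]"
| "parity Y6 = [True, False, True, False]" | "parity Y7 = [False, False, True, True]"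
| "parity Y8 = [True, True, True, False]" | "parity Y9 = [True, False, True, True]"
| "parity Y10 = [False, True, True, False]" | "parity Y11 = [True, True, True, True]"
| "parity Y12 = [False, True, True, True]" | "parity Y13 = [False, True, False, True]"
| "parity Y14 = [True, True, False, True]" | "parity Y15 = [True, False, False, True]"
| "parity T1 = [False, False, False, False]" | "parity T2 = [False, False, False, False]"
| "parity T3 = [False, False, False, False]" | "parity T4 = [False, False, False, False]"

primrec all_pairs :: "('a \<Rightarrow> 'a \<Rightarrow> bool) \<Rightarrow> 'a list \<Rightarrow> bool" where
  "all_pairs P [] = True"
| "all_pairs P (j # js) = (list_all (P j) js \<and> all_pairs P js)"

primrec all_triples :: "('a \<Rightarrow> 'a \<Rightarrow> 'a \<Rightarrow> bool) \<Rightarrow> 'a list \<Rightarrow> bool" where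
  "all_triples P [] = True"
| "all_triples P (i # is) = (all_pairs (P i) is \<and> all_triples P is)"

definition for_all :: "(basis \<Rightarrow> bool) \<Rightarrow> bool" where
  "for_all P = list_all P basis_list"

text \<open>The last two conjuncts make \<open>\<omega>\<close> an automorphism and the kernel of the model graded.\<close>

lemma bracket_check:
  "for_all (\<lambda>i. vanishes (bracket i i)
     \<and> for_all (\<lambda>j. vanishes (bracket i j @ bracket j i)
          \<and> vanishes (map (map_prod swap id) (bracket i j) @ bracket (swap i) (swap j))
          \<and> list_all (\<lambda>(k, p). basis_degree k = basis_degree i + basis_degree j) (bracket i j)))"
  by code_simp

lemma jacobi_check: "all_triples (\<lambda>i j k. vanishes (jacobi_terms i j k)) basis_list"
  by code_simp

text \<open>For \<open>i\<close> of nonzero degree, \<open>lowering i = (g, m)\<close> names a generator \<open>g\<close> of the opposite sign and a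
  label \<open>m\<close> such that among the labels of the same degree as \<open>i\<close> only \<open>i\<close> contributes to the
  coordinate \<open>m\<close> of a bracket with \<open>g\<close>. Such a pair exists because the roots are distinct and no
  root vector of nonzero degree is killed by all generators of the opposite sign. At the \<open>Ti\<close>
  the value is a dummy.\<close>

primrec lowering :: "basis \<Rightarrow> basis \<times> basis" where
  "lowering X1 = (Y1, T1)" | "lowering X2 = (Y2, T2)" | "lowering X3 = (Y3, T3)"
| "lowering X4 = (Y4, T4)" | "lowering X5 = (Y1, X2)" | "lowering X6 = (Y1, X3)"
| "lowering X7 = (Y3, X4)" | "lowering X8 = (Y2, X6)" | "lowering X9 = (Y1, X7)"
| "lowering X10 = (Y1, X8)" | "lowering X11 = (Y2, X9)" | "lowering X12 = (Y1, X11)"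
| "lowering X13 = (Y3, X12)" | "lowering X14 = (Y1, X13)" | "lowering X15 = (Y2, X14)"
| "lowering Y1 = (X1, T1)" | "lowering Y2 = (X2, T2)" | "lowering Y3 = (X3, T3)"
| "lowering Y4 = (X4, T4)" | "lowering Y5 = (X1, Y2)" | "lowering Y6 = (X1, Y3)"
| "lowering Y7 = (X3, Y4)" | "lowering Y8 = (X2, Y6)" | "lowering Y9 = (X1, Y7)"
| "lowering Y10 = (X1, Y8)" | "lowering Y11 = (X2, Y9)" | "lowering Y12 = (X1, Y11)"
| "lowering Y13 = (X3, Y12)" | "lowering Y14 = (X1, Y13)" | "lowering Y15 = (X2, Y14)"
| "lowering T1 = (T1, T1)" | "lowering T2 = (T2, T2)" | "lowering T3 = (T3, T3)"
| "lowering T4 = (T4, T4)"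

lemma lowering_check:
  "for_all (\<lambda>i. basis_degree i = 0 \<or> (let (g, m) = lowering i in
      basis_degree g * sgn (basis_degree i) = - 1 \<and>
      (case bracket g i of [] \<Rightarrow> False
       | t # ts \<Rightarrow> fst t = m \<and> coef_unit (snd t) \<and> list_all (\<lambda>t. fst t \<noteq> m) ts) \<and>
      for_all (\<lambda>k. basis_degree k = basis_degree i \<longrightarrow>
        k = i \<or> list_all (\<lambda>t. fst t \<noteq> m) (bracket g k))))"
  by code_simp

text \<open>The columns of the inverse of the Cartan matrix, cleared of the denominator \<open>\<alpha>\<close>: bracketing with
  the \<open>n\<close>-th combination multiplies \<open>b i\<close> by the attached scalar times the \<open>n\<close>-th parity of \<open>i\<close>.\<close>

definition torus :: "(basis combi \<times> coef) list" where
  "torus = [([(T2, c1)], ca), ([(T1, c1), (T4, c1)], ca), ([(T4, c1)], c1),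
     ([(T2, c1), (T3, ca)], ca)]"

lemma torus_check:
  "list_all (\<lambda>(n, ts, s). coef_unit s \<and> for_all (\<lambda>i. vanishes
      (ad_combi i ts @ (if parity i ! n then [(i, s)] else [])))) (List.enumerate 0 torus)"
  by code_simp

section \<open>Cochains\<close>

text \<open>The quadruple \<open>(p, u, v, w)\<close> stands for \<open>p\<close> times the cochain \<open>u \<otimes> v \<and> w\<close>.\<close>

type_synonym form = "(coef \<times> basis \<times> basis \<times> basis) list"

definition scale_form :: "coef \<Rightarrow> form \<Rightarrow> form" where
  "scale_form p = map (\<lambda>(q, r). (coef_mult p q, r))"

text \<open>A form is evaluated in its first argument once and for all, so that a comparison over all
  pairs of basis vectors scans it once per first argument. A term with \<open>v = w\<close> is zero in
  characteristic two.\<close>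

primrec form_row :: "form \<Rightarrow> basis \<Rightarrow> (basis \<times> basis \<times> coef) list" where
  "form_row [] i = []"
| "form_row (t # ts) i = (case t of (p, u, v, w) \<Rightarrow>
     if v \<noteq> w \<and> v = i then (w, u, p) # form_row ts i
     else if v \<noteq> w \<and> w = i then (v, u, p) # form_row ts i
     else form_row ts i)"

primrec row_at :: "(basis \<times> basis \<times> coef) list \<Rightarrow> basis \<Rightarrow> basis combi" where
  "row_at [] j = []"
| "row_at (t # ts) j = (if fst t = j then snd t # row_at ts j else row_at ts j)"

text \<open>The triple \<open>(p, a, b)\<close> stands for \<open>p\<close> times the linear map sending the basis vector \<open>a\<close> to \<open>b\<close> and
  all others to zero.\<close>

type_synonym endo = "(coef \<times> basis \<times> basis) list"

definition endo_at :: "endo \<Rightarrow> basis \<Rightarrow> basis combi" where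
  "endo_at es i = concat (map (\<lambda>(p, a, b). if a = i then [(b, p)] else []) es)"

definition endo_combi :: "endo \<Rightarrow> basis combi \<Rightarrow> basis combi" where
  "endo_combi es ts = concat (map (\<lambda>(k, p). combi_scale p (endo_at es k)) ts)"

text \<open>The value at \<open>(i, j)\<close> of the coboundary of the linear map \<open>es\<close>.\<close>

definition diff_at :: "endo \<Rightarrow> basis \<Rightarrow> basis \<Rightarrow> basis combi" where
  "diff_at es i j =
     ad_combi i (endo_at es j) @ ad_combi j (endo_at es i) @ endo_combi es (bracket i j)"

text \<open>The value at \<open>(i, j)\<close> of \<open>(X, Y) \<mapsto> [[z,X],[z,Y]]\<close>.\<close>

definition square_at :: "basis \<Rightarrow> basis \<Rightarrow> basis \<Rightarrow> basis combi" where
  "square_at z i j =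
     concat (map (\<lambda>(n, p). combi_scale p (ad_combi n (bracket z j))) (bracket z i))"

definition t_m12 :: form where
  "t_m12 = scale_form cb [
     (ca3,Y3,X9,X15), (ca3,Y3,X11,X14), (ca2b,Y3,X12,X13), (ca3,Y6,X7,X15), (ca2,Y6,X11,X13),
     (ca3,Y7,X6,X15), (ca3,Y7,X8,X14), (ca2,Y8,X7,X14), (ca,Y8,X9,X13), (ca3,Y9,X3,X15),
     (ca2,Y9,X8,X13), (ca,Y10,X7,X13), (ca2,Y11,X3,X14), (ca,Y11,X6,X13), (ca,Y12,X3,X13),
     (ca,Y13,X3,X12), (ca,Y13,X7,X10)] @
    [(ca,Y13,X8,X9), (ca,Y14,X3,X11), (ca,Y14,X7,X8), (c1,Y15,X3,X9), (c1,Y15,X6,X7),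
     (ca2bb,Y7,X10,X13), (ca,Y13,X6,X11)]"

definition t_m10 :: form where
  "t_m10 = scale_form cb [
     (ca3,X3,X9,X15), (ca3,X3,X11,X14), (ca2b,X3,X12,X13), (ca3,Y1,X4,X15), (ca2,Y1,X11,X12),
     (ca3,Y4,X1,X15), (ca3,Y4,X5,X14), (ca2b,Y4,X10,X12), (ca2,Y5,X4,X14), (ca,Y5,X9,X12),
     (ca2,Y9,X5,X12), (ca3,Y9,X15,Y3), (ca,Y10,X4,X12), (ca,Y11,X1,X12), (ca2,Y11,X14,Y3),
     (ca,Y12,X4,X10), (ca,Y12,X13,Y3), (ca,Y13,X12,Y3)] @
    [(ca,Y12,X1,X11), (ca,Y12,X5,X9), (ca,Y14,X4,X5), (ca,Y14,X11,Y3), (c1,Y15,X1,X4),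
     (c1,Y15,X9,Y3)]"

definition t_m8_1 :: form where
  "t_m8_1 = scale_form cb [
     (ca3,X4,X1,X15), (ca3,X4,X5,X14), (ca2b,X4,X10,X12), (ca3,X7,X6,X15), (ca3,X7,X8,X14),
     (ca2,Y1,X8,X10), (ca3,Y1,X15,Y4), (ca,Y5,X6,X10), (ca2,Y5,X14,Y4), (ca2,Y6,X5,X10),
     (ca3,Y6,X15,Y7), (ca,Y8,X1,X10), (ca2,Y8,X14,Y7), (ca,Y10,X12,Y4), (ca,Y10,X13,Y7),
     (ca,Y12,X10,Y4), (ca,Y13,X10,Y7)] @
    [(ca,Y10,X1,X8), (ca,Y10,X5,X6), (ca,Y14,X5,Y4), (ca,Y14,X8,Y7), (c1,Y15,X1,Y4),
     (c1,Y15,X6,Y7), (ca2bb,X7,X10,X13)]"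

definition t_m8_2 :: form where
  "t_m8_2 = scale_form cb [
     (ca3,X1,X4,X15), (ca2,X1,X11,X12), (ca3,X6,X7,X15), (ca2,X6,X11,X13), (ca2,Y2,X4,X13),
     (ca2,Y2,X7,X12), (ca2,Y4,X2,X13), (ca2,Y4,X8,X11), (ca3,Y4,X15,Y1), (ca,Y5,X7,X11),
     (ca2,Y7,X2,X12), (ca2,Y7,X5,X11), (ca3,Y7,X15,Y6), (ca,Y8,X4,X11), (ca,Y11,X4,X8),
     (ca,Y11,X5,X7), (ca,Y11,X12,Y1), (ca,Y11,X13,Y6)] @
    [(ca,Y12,X2,X7), (ca,Y12,X11,Y1), (ca,Y13,X2,X4), (ca,Y13,X11,Y6), (c1,Y15,X4,Y1),
     (c1,Y15,X7,Y6)]"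

definition t_m6_1 :: form where
  "t_m6_1 = scale_form cb [
     (ca,X2,X4,X13), (ca,X2,X7,X12), (ca,X5,X4,X14), (c1,X5,X9,X12), (ca,X8,X7,X14),
     (c1,X8,X9,X13), (c1,Y1,X7,X9), (c1,Y4,X6,X9), (ca,Y4,X13,Y2), (ca2,Y4,X14,Y5),
     (c1,Y6,X4,X9), (c1,Y7,X1,X9), (ca,Y7,X12,Y2), (ca2,Y7,X14,Y8), (c1,Y9,X1,X7), (c1,Y9,X4,X6),
     (ca,Y9,X12,Y5), (ca,Y9,X13,Y8)] @
    [(c1,Y12,X7,Y2), (c1,Y12,X9,Y5), (c1,Y13,X4,Y2), (c1,Y13,X9,Y8), (c1,Y14,X4,Y5),
     (c1,Y14,X7,Y8)]"

definition t_m6_2 :: form where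
  "t_m6_2 = scale_form cb [
     (ca2,X1,X8,X10), (ca3,X1,X15,Y4), (ca2,X4,X2,X13), (ca2,X4,X8,X11), (ca3,X4,X15,Y1),
     (ca3,X9,X3,X15), (ca2,X9,X8,X13), (ca2,Y2,X3,X10), (ca2,Y2,X13,Y4), (ca2,Y3,X2,X10),
     (ca2,Y3,X5,X8), (ca3,Y3,X15,Y9), (ca,Y5,X3,X8), (ca,Y8,X3,X5), (ca,Y8,X10,Y1),
     (ca,Y8,X11,Y4), (ca,Y8,X13,Y9), (ca,Y11,X8,Y4)] @
    [(ca,Y13,X2,Y4), (ca,Y10,X2,X3), (ca,Y10,X8,Y1), (ca,Y13,X8,Y9), (c1,Y15,X3,Y9),
     (c1,Y15,Y1,Y4)]"

definition t_m4_1 :: form where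
  "t_m4_1 = scale_form cb [
     (ca,X2,X3,X10), (ca,X2,X13,Y4), (c1,X4,X6,X9), (ca,X4,X13,Y2), (ca2,X4,X14,Y5),
     (c1,X5,X6,X10), (ca,X5,X14,Y4), (ca,X11,X3,X14), (c1,X11,X6,X13), (c1,Y1,X3,X6),
     (c1,Y3,X1,X6), (ca,Y3,X10,Y2), (ca2,Y3,X14,Y11), (c1,Y6,X1,X3), (c1,Y6,X9,Y4),
     (ca,Y6,X10,Y5), (ca,Y6,X13,Y11), (c1,Y9,X6,Y4)] @
    [(c1,Y10,X3,Y2), (c1,Y10,X6,Y5), (c1,Y13,X6,Y11), (c1,Y13,Y2,Y4), (c1,Y14,X3,Y11),
     (c1,Y14,Y4,Y5)]"

definition t_m4_2 :: form where
  "t_m4_2 = scale_form cb [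
     (ca2,X3,X2,X10), (ca2,X3,X5,X8), (ca3,X3,X15,Y9), (ca2,X6,X5,X10), (ca3,X6,X15,Y7),
     (ca2,X7,X2,X12), (ca2,X7,X5,X11), (ca3,X7,X15,Y6), (ca2,X9,X5,X12), (ca3,X9,X15,Y3),
     (ca2,Y2,X10,Y3), (ca2,Y2,X12,Y7), (ca,Y5,X8,Y3), (ca,Y5,X10,Y6), (ca,Y5,X11,Y7),
     (ca,Y5,X12,Y9), (ca,Y8,X5,Y3), (ca,Y11,X5,Y7)] @
    [(ca,Y10,X2,Y3), (ca,Y10,X5,Y6), (ca,Y12,X2,Y7), (ca,Y12,X5,Y9), (c1,Y15,Y3,Y9),
     (c1,Y15,Y6,Y7)]"

definition t_m2 :: form where
  "t_m2 = scale_form cb [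
     (ca,X2,X10,Y3), (ca,X2,X12,Y7), (c1,X3,X1,X6), (ca,X3,X10,Y2), (ca2,X3,X14,Y11),
     (c1,X7,X1,X9), (ca,X7,X12,Y2), (ca2,X7,X14,Y8), (c1,X8,X1,X10), (ca,X8,X14,Y7),
     (c1,X11,X1,X12), (ca,X11,X14,Y3), (c1,Y1,X6,Y3), (c1,Y1,X9,Y7), (ca,Y1,X10,Y8),
     (ca,Y1,X12,Y11), (c1,Y6,X1,Y3), (c1,Y9,X1,Y7)] @
    [(c1,Y10,X1,Y8), (c1,Y10,Y2,Y3), (c1,Y12,X1,Y11), (c1,Y12,Y2,Y7), (c1,Y14,Y3,Y11),
     (c1,Y14,Y7,Y8)]"

definition t_0 :: form where
  "t_0 = [
     (ca,T1,X14,Y14), (ca2,T1,X15,Y15), (c1,T2,X5,Y5), (c1,T2,X8,Y8), (c1,T2,X10,Y10),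
     (c1,T2,X11,Y11), (c1,T2,X12,Y12), (c1,T2,X13,Y13), (ca2,T2,X14,Y14), (c1,T3,X1,Y1),
     (ca,T3,X5,Y5), (c1,T3,X6,Y6), (ca,T3,X8,Y8), (c1,T3,X9,Y9), (ca,T3,X10,Y10),
     (ca,T3,X11,Y11), (ca,T3,X12,Y12), (ca2b,T3,X14,Y14), (ca3b,T3,X15,Y15), (ca,T4,X12,Y12),
     (ca,T4,X13,Y13), (ca,T4,X14,Y14), (ca2,T4,X15,Y15), (c1,X1,T1,X1), (ca,X1,X10,Y8),
     (ca,X1,X12,Y11), (ca,X1,X14,Y13), (c1,X2,T1,X2), (c1,X2,X5,Y1), (c1,X2,X8,Y6),
     (c1,X2,X11,Y9), (ca3,X2,X15,Y14), (ca,X3,X13,Y12), (c1,X4,T1,X4), (ca,X4,X12,Y10),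
     (c1,X5,X10,Y6), (c1,X5,X12,Y9), (ca,X5,X15,Y13), (c1,X6,T1,X6), (ca,X6,X10,Y5),
     (ca,X6,X13,Y11), (ca,X6,X14,Y12), (c1,X7,T1,X7), (ca,X7,X13,Y10), (c1,X8,X10,Y1),
     (c1,X8,X13,Y9), (ca,X8,X15,Y12), (ca,X9,X12,Y5), (ca,X9,X13,Y8), (ca,X9,X14,Y10),
     (c1,X10,T1,X10), (c1,X10,X14,Y9), (ca,X10,X15,Y11), (c1,X11,T1,X11), (c1,X11,X12,Y1),
     (c1,X11,X13,Y6), (ca,X11,X15,Y10), (c1,X12,X14,Y6), (ca,X12,X15,Y8), (c1,X13,X14,Y1),
     (ca,X13,X15,Y5), (c1,X14,T1,X14), (c1,Y1,T1,Y1), (ca,Y1,X8,Y10), (ca,Y1,X11,Y12),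
     (ca,Y1,X13,Y14), (c1,Y2,T1,Y2), (c1,Y2,X1,Y5), (c1,Y2,X6,Y8), (c1,Y2,X9,Y11),
     (ca3,Y2,X14,Y15), (ca,Y3,X12,Y13), (c1,Y4,T1,Y4), (ca,Y4,X10,Y12), (c1,Y5,X6,Y10),
     (c1,Y5,X9,Y12), (ca,Y5,X13,Y15), (c1,Y6,T1,Y6), (ca,Y6,X5,Y10), (ca,Y6,X11,Y13),
     (ca,Y6,X12,Y14), (c1,Y7,T1,Y7), (ca,Y7,X10,Y13), (c1,Y8,X1,Y10), (c1,Y8,X9,Y13),
     (ca,Y8,X12,Y15), (ca,Y9,X5,Y12), (ca,Y9,X8,Y13), (ca,Y9,X10,Y14), (c1,Y10,T1,Y10),
     (c1,Y10,X9,Y14), (ca,Y10,X11,Y15), (c1,Y11,T1,Y11), (c1,Y11,X1,Y12), (c1,Y11,X6,Y13),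
     (ca,Y11,X10,Y15), (c1,Y12,X6,Y14), (ca,Y12,X8,Y15), (c1,Y13,X1,Y14), (ca,Y13,X5,Y15),
     (c1,Y14,T1,Y14)]"


definition negative_forms :: "form list" where
  "negative_forms = [t_m12, t_m10, t_m8_1, t_m8_2, t_m6_1, t_m6_2, t_m4_1, t_m4_2, t_m2]"

definition swap_form :: "form \<Rightarrow> form" where
  "swap_form = map (map_prod id (map_prod swap (map_prod swap swap)))"

text \<open>An entry \<open>(c, s, U, f)\<close> records that \<open>s c\<close> is the sum of \<open>(X, Y) \<mapsto> [[U,X],[U,Y]]\<close> and the
  coboundary of \<open>f\<close>. The scalars are found by comparing two coordinates.\<close>

definition square_data :: "(form \<times> coef \<times> basis \<times> endo) list" where
  "square_data =
    [(t_m12, cb, Y13, [(ca2b, X13, Y13)]), (t_m10, cb, Y12, [(ca2b, X12, Y12)]),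
     (t_m8_1, cb, Y10, [(ca2b, X10, Y10)]), (t_m8_2, c1, Y11, [(ca2, X11, Y11)]),
     (t_m6_1, c1, Y9, [(ca, X9, Y9)]), (t_m6_2, c1, Y8, [(ca2, X8, Y8)]),
     (t_m4_1, c1, Y6, [(ca, X6, Y6)]), (t_m4_2, c1, Y5, [(ca2, X5, Y5)]),
     (t_m2, c1, Y1, [(ca, X1, Y1)])]"

definition square_cell ::
    "coef \<Rightarrow> basis \<Rightarrow> endo \<Rightarrow> basis \<Rightarrow> (basis \<times> basis \<times> coef) list \<Rightarrow> basis \<Rightarrow> bool" where
  "square_cell s z es i r j =
     vanishes (combi_scale s (row_at r j) @ square_at z i j @ diff_at es i j)"

definition square_row :: "form \<Rightarrow> coef \<Rightarrow> basis \<Rightarrow> endo \<Rightarrow> basis \<Rightarrow> basis \<Rightarrow> bool" where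
  "square_row ts s z es i = square_cell s z es i (form_row ts i)"

lemma square_check:
  "list_all (\<lambda>(ts, s, z, es). coef_unit s \<and> all_pairs (square_row ts s z es) basis_list)
     square_data"
  by code_simp

text \<open>The coboundary of this map is the difference between \<open>\<alpha> c\<^sub>0\<close> and \<open>\<alpha>\<close> times the \<open>\<alpha>\<close>-derivative of the
  bracket. Apart from \<open>h\<^sub>2\<close>, its diagonal part concerns the \<open>y\<^sub>k\<close> whose root contains the second
  simple root an odd number of times.\<close>

definition endo_0 :: endo where
  "endo_0 = (ca, T1, T3) # (c1, T2, T2) #
     map (\<lambda>i. (c1, i, i)) [Y2, Y5, Y8, Y10, Y11, Y12, Y13, Y14]"

definition derivative_cell ::
    "endo \<Rightarrow> basis \<Rightarrow> (basis \<times> basis \<times> coef) list \<Rightarrow> basis \<Rightarrow> bool" where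
  "derivative_cell es i r j = vanishes (combi_scale ca (row_at r j)
     @ combi_scale ca (map (map_prod id coef_deriv) (bracket i j)) @ diff_at es i j)"

definition derivative_row :: "form \<Rightarrow> endo \<Rightarrow> basis \<Rightarrow> basis \<Rightarrow> bool" where
  "derivative_row ts es i = derivative_cell es i (form_row ts i)"

lemma derivative_check: "all_pairs (derivative_row t_0 endo_0) basis_list"
  by code_simp

section \<open>The certificate for the elimination\<close>

text \<open>The cocycles that are subtracted: coboundaries and listed cocycles.\<close>

datatype move = Diff endo | Coc form

text \<open>The key \<open>(i, j, m)\<close> denotes the coordinate \<open>m\<close> of the value of a cochain at \<open>(b i, b j)\<close>.\<close>

type_synonym key = "basis \<times> basis \<times> basis"

primrec move_at :: "move \<Rightarrow> key \<Rightarrow> coef" where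
  "move_at (Diff es) k = (case k of (i, j, m) \<Rightarrow>
     fold coef_add (map snd (filter (\<lambda>t. fst t = m) (diff_at es i j))) [])"
| "move_at (Coc ts) k = (case k of (i, j, m) \<Rightarrow>
     fold coef_add (map snd (filter (\<lambda>t. fst t = m) (row_at (form_row ts i) j))) [])"

primrec swap_move :: "move \<Rightarrow> move" where
  "swap_move (Diff es) = Diff (map (map_prod id (map_prod swap swap)) es)"
| "swap_move (Coc ts) = Coc (swap_form ts)"

text \<open>A block handles the coordinates of one weight. Its first part pairs every move with the
  coordinate that this move is used to cancel, its second part lists the instances
  \<open>(i, j, l, m)\<close> (coordinate \<open>m\<close> of the cocycle identity at \<open>b i\<close>, \<open>b j\<close>, \<open>b l\<close>) in an order in which
  each of them has a single unknown left.\<close>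

type_synonym block = "(move \<times> key) list \<times> (basis \<times> key) list"

definition swap_block :: "block \<Rightarrow> block" where
  "swap_block = map_prod (map (map_prod swap_move (map_prod swap (map_prod swap swap))))
     (map (map_prod swap (map_prod swap (map_prod swap swap))))"

text \<open>The blocks of weight twice a negative root. Those of the positive roots are their images under
  \<open>\<omega>\<close>.\<close>

definition negative_blocks :: "block list" where
  "negative_blocks =
    [([(Diff [(c1,X15,Y15)], (X2,X14,Y15))],
      [(X2,X14,X15,T1)]),
     ([(Diff [(c1,X14,Y14)], (X1,X13,Y14))],
      [(X1,X13,X14,T2), (X1,X13,Y2,Y15), (X1,X15,Y5,Y14)]),
     ([(Coc t_m12, (X3,X9,Y15)), (Diff [(c1,X13,Y13)], (X3,X12,Y13))],
      [(X2,X3,X9,Y14), (X3,X4,X10,Y13), (X3,X5,X9,Y13), (X3,X9,X10,Y11), (X3,X9,X15,T1),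
      (X3,X12,X13,T2), (X3,X12,Y1,Y14), (X9,X10,Y1,Y13)]),
     ([(Coc t_m10, (X1,X4,Y15)), (Diff [(c1,X12,Y12)], (X1,X11,Y12))],
      [(X1,X2,X4,Y14), (X1,X4,X8,Y12), (X1,X4,X11,Y10), (X1,X4,X13,Y5), (X1,X4,X15,T1),
      (X1,X4,X15,T4), (X1,X7,Y3,Y15), (X1,X11,X12,T2), (X4,X8,Y3,Y14), (X4,X10,Y3,Y13),
      (X4,X13,Y7,Y12), (X4,X14,Y3,Y8), (X4,X15,Y3,Y6)]),
     ([(Coc t_m8_1, (X1,Y4,Y15)), (Diff [(c1,X10,Y10)], (X1,X8,Y10))],
      [(X1,X2,Y4,Y14), (X1,X8,X10,T2), (X1,X8,Y4,Y12), (X1,X11,Y4,Y10), (X1,X13,Y4,Y5),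
      (X1,X15,Y4,T1), (X1,X15,Y4,T4)]),
     ([(Coc t_m8_2, (X2,X4,Y13)), (Diff [(c1,X11,Y11)], (X2,X9,Y11))],
      [(X2,X3,X4,Y12), (X2,X4,X6,Y11), (X2,X4,X9,Y8), (X2,X4,X10,Y7), (X2,X4,X13,T2),
      (X2,X4,X13,T4), (X2,X4,X14,X1), (X2,X4,Y1,Y14), (X2,X9,X11,T1), (X2,X9,Y1,Y12),
      (X2,X12,Y5,Y11), (X2,X14,Y1,Y4)]),
     ([(Coc t_m6_1, (X4,Y2,Y13)), (Diff [(c1,X9,Y9)], (X1,X7,Y9))],
      [(X1,X3,X4,Y9), (X1,X4,X7,Y6), (X1,X4,Y5,Y13), (X1,X7,X9,T3), (X3,X4,Y2,Y12),
      (X4,X10,Y2,Y7), (X4,X13,Y2,T2), (X4,X13,Y2,T4), (X4,X14,Y2,X1), (X4,X6,Y2,Y11),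
      (X4,X8,Y2,Y9)]),
     ([(Coc t_m6_2, (X2,Y4,Y13)), (Diff [(c1,X8,Y8)], (X2,X6,Y8))],
      [(X2,X3,Y4,Y12), (X2,X6,X8,T1), (X2,X6,Y4,Y11), (X2,X6,Y9,Y13), (X2,X9,Y4,Y8),
      (X2,X10,Y4,Y7), (X2,X13,Y4,T2), (X2,X13,Y4,T4), (X2,X14,Y4,X1), (X2,Y1,Y4,Y14),
      (X1,X2,X3,Y8), (X2,X3,X6,Y5), (X2,X3,X10,T2), (X2,X3,X14,X9), (X2,X3,Y9,Y14),
      (X2,X6,Y1,Y10), (X10,Y1,Y9,Y13), (X2,X14,Y1,X4)]),
     ([(Diff [(c1,X5,Y5)], (X1,X2,Y5)), (Coc t_m4_2, (X2,Y3,Y10))],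
      [(X1,X2,X5,T1), (X1,X2,X5,T2), (X1,X2,Y3,Y8), (X2,X4,Y7,Y10), (X2,X6,Y3,Y5), (X2,X10,Y3,T2),
      (X2,X10,Y3,T3), (X2,X12,Y3,X4), (X2,X14,Y3,X9), (X2,Y3,Y9,Y14)]),
     ([(Coc t_m4_1, (X3,Y2,Y10)), (Diff [(c1,X6,Y6)], (X1,X3,Y6))],
      [(X1,X3,X6,T1), (X1,X3,X6,T3), (X1,X3,Y2,Y8), (X1,X3,Y4,Y9), (X1,X3,Y5,Y10), (X1,X7,Y4,Y6),
      (X3,X5,Y2,Y6), (X3,X9,Y11,Y10), (X3,X10,Y2,T2), (X3,X10,Y2,T3), (X3,X12,Y2,X4),
      (X3,X14,Y2,X9), (X3,Y2,Y4,Y12), (X6,Y4,Y5,Y12), (X3,X12,Y4,X2), (X3,X14,Y4,X8)]),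
     ([(Diff [(c1,X7,Y7)], (X3,X4,Y7))],
      [(X3,X4,X7,T3), (X3,X4,X7,T4), (X3,X4,Y1,Y9), (X3,X9,Y6,Y7)]),
     ([(Diff [(c1,X1,Y1)], (X1,Y2,Y5)), (Coc t_m2, (X1,Y3,Y6))],
      [(X1,X4,Y4,Y1), (X1,X4,Y7,Y6), (X1,X5,Y2,T1), (X1,X5,Y2,T2), (X1,X6,Y3,T1), (X1,X6,Y3,T3),
      (X1,X9,Y3,X4), (X1,X14,Y15,Y5), (X1,Y2,Y3,Y8), (X1,Y2,Y13,Y15), (X1,X15,Y15,Y1),
      (X1,Y2,Y7,Y11), (X1,X2,Y2,Y1), (X1,X5,Y8,Y6), (X1,X5,Y11,Y9), (X1,X8,Y3,X2), (X1,X3,Y3,Y1),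
      (X1,X5,X6,X8), (X1,X8,Y2,X3), (X1,X5,X9,X11), (X1,X11,Y2,X7), (X1,X14,Y3,X12),
      (X9,Y3,Y11,Y10)]),
     ([(Diff [(c1,X2,Y2)], (X2,Y1,Y5))],
      [(X2,X3,Y3,Y2), (X2,X3,Y6,Y5), (X2,X4,Y4,Y2), (X2,X5,Y1,T1), (X2,X5,Y1,T2), (X2,X7,Y9,Y5),
      (X2,X8,Y1,X3), (X2,X11,Y1,X7), (X2,X13,Y14,Y5), (X2,X15,Y1,X13), (X2,X10,Y10,Y2),
      (X1,X2,Y1,Y2)]),
     ([(Diff [(c1,X3,Y3)], (X3,Y1,Y6))],
      [(X2,X3,Y2,Y3), (X2,X3,Y5,Y6), (X3,X6,Y1,T1), (X3,X6,Y1,T3), (X3,X7,Y9,Y6), (X3,X8,Y1,X2),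
      (X3,X11,Y12,Y6), (X3,X13,Y1,X11), (X3,Y1,Y4,Y9), (X7,Y1,Y4,Y6), (X3,X10,Y10,Y3),
      (X1,X3,Y1,Y3), (X3,X4,Y4,Y3)]),
     ([(Diff [(c1,X4,Y4)], (X4,Y3,Y7))],
      [(X1,X4,Y1,Y4), (X1,X4,Y6,Y7), (X2,X4,Y2,Y4), (X4,X5,Y8,Y7), (X4,X7,Y3,T3), (X4,X7,Y3,T4),
      (X4,X9,Y3,X1), (X4,X11,Y3,X5), (X4,X12,Y13,Y7), (X4,Y3,Y10,Y13), (X4,X15,Y15,Y4),
      (X3,X4,Y3,Y4)])]"

text \<open>The block of weight zero. The four maps \<open>x\<^sub>i \<mapsto> x\<^sub>i\<close> with \<open>i \<le> 4\<close> are left out of the moves: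
  the coboundaries of the diagonal maps satisfy four relations, because the elements of the
  torus act as derivations.\<close>

definition zero_block :: block where
  "zero_block =
     ([(Diff [(c1,T2,T1)], (X2,T2,X2)), (Diff [(c1,T2,T3)], (X4,T2,X4)),
      (Diff [(c1,T2,T2)], (X1,T2,X1)), (Diff [(c1,T2,T4)], (X3,T2,X3)),
      (Diff [(c1,T3,T1)], (X2,T3,X2)), (Diff [(c1,T3,T3)], (X4,T3,X4)),
      (Diff [(c1,T3,T2)], (X1,T3,X1)), (Diff [(c1,T3,T4)], (X3,T3,X3)),
      (Diff [(c1,T4,T1)], (X2,T4,X2)), (Diff [(c1,T4,T3)], (X4,T4,X4)),
      (Diff [(c1,T4,T2)], (X1,T4,X1)), (Diff [(c1,T4,T4)], (X3,T4,X3)),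
      (Diff [(c1,X5,X5)], (X1,X2,X5)), (Diff [(c1,X6,X6)], (X1,X3,X6)),
      (Diff [(c1,X7,X7)], (X3,X4,X7)), (Diff [(c1,Y2,Y2)], (X2,Y2,T2)),
      (Diff [(c1,Y3,Y3)], (X3,Y3,T3)), (Diff [(c1,Y4,Y4)], (X4,Y4,T4)),
      (Diff [(c1,Y7,Y7)], (Y3,Y4,Y7)), (Diff [(c1,T1,T2)], (X1,Y1,T2)),
      (Diff [(c1,T1,T4)], (X1,Y1,T4)), (Diff [(c1,T1,T1)], (X3,T1,X3)), (Coc t_0, (X2,T1,X2)),
      (Diff [(c1,T1,T3)], (X1,T1,X1)), (Diff [(c1,Y1,Y1)], (X1,Y1,T1)),
      (Diff [(c1,Y5,Y5)], (Y1,Y2,Y5)), (Diff [(c1,Y6,Y6)], (Y1,Y3,Y6)),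
      (Diff [(c1,X8,X8)], (X2,X6,X8)), (Diff [(c1,X9,X9)], (X1,X7,X9)),
      (Diff [(c1,Y8,Y8)], (Y2,Y6,Y8)), (Diff [(c1,Y9,Y9)], (Y1,Y7,Y9)),
      (Diff [(c1,X10,X10)], (X1,X8,X10)), (Diff [(c1,X11,X11)], (X2,X9,X11)),
      (Diff [(c1,Y10,Y10)], (Y1,Y8,Y10)), (Diff [(c1,Y11,Y11)], (Y2,Y9,Y11)),
      (Diff [(c1,X12,X12)], (X1,X11,X12)), (Diff [(c1,Y12,Y12)], (Y1,Y11,Y12)),
      (Diff [(c1,X13,X13)], (X3,X12,X13)), (Diff [(c1,Y13,Y13)], (Y3,Y12,Y13)),
      (Diff [(c1,X14,X14)], (X1,X13,X14)), (Diff [(c1,Y14,Y14)], (Y1,Y13,Y14)),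
      (Diff [(c1,X15,X15)], (X2,X14,X15)), (Diff [(c1,Y15,Y15)], (Y2,Y14,Y15))],
      [(X1,X2,X3,X8), (X1,X2,X6,X10), (X1,X2,X7,X11), (X1,X2,X9,X12), (X1,X2,X13,X15),
      (X1,X2,Y1,X2), (X1,X2,T4,X5), (X1,X3,X4,X9), (X1,X3,X11,X13), (X1,X3,X12,X14),
      (X1,X3,Y1,X3), (X1,Y1,T1,T1), (X2,X3,Y3,X2), (X2,X4,Y2,X4), (X2,X4,Y4,X2), (X2,X10,Y10,X2),
      (X2,Y2,T2,T2), (X2,Y2,T3,T3), (X3,X4,Y3,X4), (X3,Y3,T3,T3), (X4,X13,Y13,X4), (X4,Y4,T4,T4),
      (Y1,Y2,Y3,Y8), (Y1,Y2,Y6,Y10), (Y1,Y2,Y7,Y11), (Y1,Y2,Y9,Y12), (Y1,Y2,Y13,Y15),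
      (Y1,Y3,Y4,Y9), (Y1,Y3,Y11,Y13), (Y1,Y3,Y12,Y14), (X3,X4,X5,X11), (X5,X14,Y1,X15),
      (X5,Y1,Y2,T2), (X5,Y1,T4,X2), (X5,Y2,T4,X1), (X4,X5,X6,X12), (X5,X6,X7,X13), (X4,X6,Y1,X7),
      (X5,X6,Y1,X8), (X3,Y2,Y3,Y2), (X1,X2,Y2,X1), (X2,Y2,Y4,Y4), (X3,X4,Y4,X3), (X3,X10,Y10,X3),
      (X3,Y3,T2,T3), (X6,X7,Y3,X9), (Y3,Y4,Y5,Y11), (Y4,Y5,Y6,Y12), (Y5,Y6,Y7,Y13),
      (X7,X8,Y3,X11), (X6,X12,Y1,X13), (X1,X2,Y5,T2), (X7,X10,Y3,X12), (X9,Y1,Y3,X4),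
      (X3,X5,Y2,X6), (X5,X7,Y2,X9), (X5,X13,Y2,X14), (X1,X7,Y4,X6), (X5,X7,Y4,X8),
      (X7,X12,Y4,X13), (X1,X8,Y10,T4), (X1,X3,Y3,X1), (X6,Y1,Y3,T1), (X10,Y1,Y3,X5),
      (X1,X5,Y5,X1), (X1,Y1,Y2,Y2), (X1,Y5,Y14,Y15), (X6,Y3,Y5,Y2), (X13,Y1,Y3,X11),
      (X1,X7,Y6,X4), (X3,X9,Y6,X7), (X8,Y1,Y2,X3), (X11,Y2,Y6,X4), (X1,X15,Y5,X14),
      (X9,Y3,Y4,X1), (X13,Y3,Y4,X10), (X1,X3,Y6,T2), (X8,Y3,Y5,T2), (X9,Y4,Y6,T1), (X1,X2,Y5,T3),
      (X4,X5,Y5,X4), (X5,X13,Y15,T3), (X5,Y4,Y5,Y4), (X5,Y2,Y5,Y2), (X5,Y2,Y14,Y13),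
      (X1,X3,Y8,Y2), (X9,Y4,Y8,Y2), (X13,Y2,Y6,X9), (X13,Y4,Y6,X8), (X1,Y1,Y3,Y3), (X1,Y4,Y6,Y7),
      (X1,Y5,Y6,Y8), (X1,Y6,Y12,Y13), (X3,X6,Y6,X3), (X3,Y1,Y3,Y1), (X3,Y6,Y7,Y9),
      (X3,Y6,Y11,Y12), (X2,X6,Y5,X3), (X8,Y3,Y5,T3), (X2,X9,Y8,X4), (X15,Y5,Y6,X11),
      (X4,X6,Y7,X1), (X15,Y5,Y7,X10), (X1,X6,Y6,X1), (X10,Y5,Y6,T2), (X4,X6,Y9,T1),
      (X1,X15,Y15,X1), (X5,Y1,Y2,T1), (X1,X2,Y15,Y13), (X4,X6,Y11,Y2), (X1,X3,Y6,T4),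
      (X2,X6,Y8,T4), (X3,Y3,Y4,Y4), (X2,Y1,Y2,Y1), (X2,Y5,Y7,Y9), (X13,Y8,Y9,T3), (X4,Y3,Y4,Y3),
      (X4,Y7,Y12,Y13), (X15,Y10,Y11,T2), (X4,X6,Y9,T3), (X4,X8,Y11,T2)])"

definition blocks :: "block list" where
  "blocks = zero_block # negative_blocks @ map swap_block negative_blocks"

definition zero_at :: "key \<Rightarrow> move \<times> key \<Rightarrow> bool" where
  "zero_at k r = coef_zero (move_at (fst r) k)"

text \<open>Later moves do not disturb the pivots of earlier ones, so the moves can be used one after the
  other.\<close>

primrec triangular :: "(move \<times> key) list \<Rightarrow> bool" where
  "triangular [] = True"
| "triangular (r # rs) = (coef_unit (move_at (fst r) (snd r))
     \<and> list_all (zero_at (snd r)) rs \<and> triangular rs)"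

lemma triangular_check: "triangular (concat (map fst blocks))"
  by code_simp

definition image_part :: "basis \<Rightarrow> basis \<Rightarrow> basis \<Rightarrow> basis \<Rightarrow> basis \<Rightarrow> key combi" where
  "image_part i j l m k =
     map (map_prod (\<lambda>_. (j, l, k)) id) (filter (\<lambda>t. fst t = m) (bracket i k))"

definition equation_part :: "basis \<Rightarrow> basis \<Rightarrow> basis \<Rightarrow> basis \<Rightarrow> key combi" where
  "equation_part i j l m = concat (map (image_part i j l m) basis_list)
     @ map (map_prod (\<lambda>k. (k, l, m)) id) (bracket i j)"

text \<open>Coordinate \<open>m\<close> of the cocycle identity
  \<open>[b i, z (b j) (b l)] + z [b i, b j] (b l) + cyclic = 0\<close>, as a linear form in the coordinates
  of \<open>z\<close>.\<close>

definition equation :: "basis \<times> key \<Rightarrow> key combi" where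
  "equation = (\<lambda>(i, j, l, m).
     equation_part i j l m @ equation_part j l i m @ equation_part l i j m)"

definition same_key :: "key \<Rightarrow> key \<Rightarrow> bool" where
  "same_key = (\<lambda>(i, j, m) (i', j', m'). m = m' \<and> (i = i' \<and> j = j' \<or> i = j' \<and> j = i'))"

text \<open>Cochains being symmetric in characteristic two, the two orders of the arguments are not
  distinguished, and the diagonal is known to vanish.\<close>

definition known :: "key list \<Rightarrow> key \<Rightarrow> bool" where
  "known ks k = (fst k = fst (snd k) \<or> list_ex (same_key k) ks)"

primrec unknown_part :: "key list \<Rightarrow> key combi \<Rightarrow> key combi" where
  "unknown_part ks [] = []"
| "unknown_part ks (t # ts) =
     (if known ks (fst t) then unknown_part ks ts else t # unknown_part ks ts)"

text \<open>If all unknown terms of an equation belong to one coordinate, with an invertible total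
  coefficient, that coordinate is zero. An equation that fails the test teaches nothing, which is
  harmless for soundness.\<close>

definition solve :: "basis \<times> key \<Rightarrow> key list \<Rightarrow> key list" where
  "solve e ks = (case unknown_part ks (equation e) of
       [] \<Rightarrow> ks
     | t # ts \<Rightarrow> if list_all (\<lambda>u. same_key (fst t) (fst u)) ts
           \<and> coef_unit (fold coef_add (map snd ts) (snd t))
         then fst t # ks else ks)"

definition solved :: "block \<Rightarrow> key list" where
  "solved = (\<lambda>(ms, es). fold solve es (map snd ms))"

primrec off_weight :: "key \<Rightarrow> bool" where
  "off_weight (i, jm) = (case jm of (j, m) \<Rightarrow>
     list_ex (\<lambda>(p, q, r). p \<noteq> (q \<noteq> r)) (zip (parity i) (zip (parity j) (parity m))))"

definition settled :: "key list \<Rightarrow> basis \<Rightarrow> basis \<Rightarrow> basis \<Rightarrow> bool" where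
  "settled ks g j m = (off_weight (g, j, m) \<or> known ks (g, j, m))"

definition settled_at :: "key list \<Rightarrow> basis \<Rightarrow> basis \<Rightarrow> bool" where
  "settled_at ks g j = for_all (settled ks g j)"

definition settled_everywhere :: "key list \<Rightarrow> basis \<Rightarrow> bool" where
  "settled_everywhere ks g = for_all (settled_at ks g)"

text \<open>Only keys that involve the generator at hand can settle its coordinates.\<close>

primrec involving :: "basis \<Rightarrow> key list \<Rightarrow> key list" where
  "involving g [] = []"
| "involving g (k # ks) =
     (if fst k = g \<or> fst (snd k) = g then k # involving g ks else involving g ks)"

definition all_settled :: "key list \<Rightarrow> basis \<Rightarrow> bool" where
  "all_settled ks g = settled_everywhere (involving g ks) g"

definition all_solved :: "key list" where
  "all_solved = concat (map solved blocks)"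

text \<open>Values at the eight generators are enough, since a cocycle vanishing there is zero; coordinates of
  nonzero weight are left to the torus.\<close>

lemma solved_check: "list_all (all_settled all_solved) [X1, X2, X3, X4, Y1, Y2, Y3, Y4]"
  by code_simp

section \<open>Interpretation of the formal data\<close>

lemma char2_double: "CHAR('a::comm_ring_1) = 2 \<Longrightarrow> (x::'a) + x = 0"
proof -
  assume "CHAR('a) = 2"
  then have "of_nat 2 = (0::'a)"
    using of_nat_CHAR[where 'a = 'a] by simp
  then have "(2::'a) * x = 0"
    by simp
  then show "x + x = 0"
    by (simp only: mult_2)
qed

lemma char2_double_left: "CHAR('a::comm_ring_1) = 2 \<Longrightarrow> (x::'a) + (x + y) = y"
  by (metis add.assoc add_0 char2_double)

primrec coef_val :: "'k::comm_ring_1 \<Rightarrow> coef \<Rightarrow> 'k" where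
  "coef_val a [] = 0"
| "coef_val a (b # p) = of_bool b + a * coef_val a p"

lemma coef_val_zero: "coef_zero p \<Longrightarrow> coef_val a p = 0"
  by (induction p) (auto simp: coef_zero_def)

lemma coef_val_add:
  assumes "CHAR('k::comm_ring_1) = 2"
  shows "coef_val (a::'k) (coef_add p q) = coef_val a p + coef_val a q"
  by (induction p q rule: coef_add.induct)
     (auto simp: algebra_simps char2_double[OF assms] char2_double_left[OF assms])

lemma coef_val_mult:
  assumes "CHAR('k::comm_ring_1) = 2"
  shows "coef_val (a::'k) (coef_mult p q) = coef_val a p * coef_val a q"
  by (induction p) (auto simp: coef_val_add[OF assms] algebra_simps)

lemma coef_val_deriv_zero: "coef_zero p \<Longrightarrow> CHAR('k::comm_ring_1) = 2 \<Longrightarrow> coef_val (a::'k) (coef_deriv p) = 0"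
  by (induction p) (auto simp: coef_zero_def coef_val_add coef_val_zero[unfolded coef_zero_def])

lemma coef_val_deriv_add:
  assumes "CHAR('k::comm_ring_1) = 2"
  shows "coef_val (a::'k) (coef_deriv (coef_add p q)) = coef_val a (coef_deriv p) + coef_val a (coef_deriv q)"
  by (induction p q rule: coef_add.induct) (auto simp: coef_val_add[OF assms] algebra_simps)

lemma coef_val_deriv_mult:
  assumes "CHAR('k::comm_ring_1) = 2"
  shows "coef_val (a::'k) (coef_deriv (coef_mult p q))
       = coef_val a (coef_deriv p) * coef_val a q + coef_val a p * coef_val a (coef_deriv q)"
  by (induction p)
     (auto simp: coef_val_add[OF assms] coef_val_mult[OF assms] coef_val_deriv_add[OF assms] algebra_simps)

lemma coef_val_unit:
  assumes "CHAR('k::field) = 2" "coef_unit p" "a \<noteq> 0" "a \<noteq> 1"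
  shows "coef_val (a::'k) p \<noteq> 0"
proof -
  obtain q where q: "q \<in> set [c1, ca, cb, cab, ca2, ca2b, ca3b]" "coef_zero (coef_add p q)"
    using assms(2) by (auto simp: coef_unit_def list_ex_iff)
  have "coef_val a p + coef_val a q = 0"
    using coef_val_zero[OF q(2), of a] by (simp add: coef_val_add[OF assms(1)])
  then have "coef_val a p = - coef_val a q"
    by (simp add: eq_neg_iff_add_eq_0)
  moreover have "1 + a \<noteq> 0"
    using assms(4) char2_double[OF assms(1), of a] by (metis add_right_cancel)
  ultimately show ?thesis
    using q(1) assms(3) by auto
qed

text \<open>The functional on coefficients is a parameter because it will be either the value at \<open>\<alpha>\<close> or the
  value of the derivative at \<open>\<alpha>\<close>.\<close>

definition combination ::
    "('k \<Rightarrow> 'g \<Rightarrow> 'g::ab_group_add) \<Rightarrow> (coef \<Rightarrow> 'k) \<Rightarrow> ('i \<Rightarrow> 'g) \<Rightarrow> 'i combi \<Rightarrow> 'g" where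
  "combination sc \<phi> b ts = (\<Sum>t\<leftarrow>ts. sc (\<phi> (snd t)) (b (fst t)))"

lemma combination_Nil [simp]: "combination sc \<phi> b [] = 0"
  and combination_Cons [simp]:
    "combination sc \<phi> b (t # ts) = sc (\<phi> (snd t)) (b (fst t)) + combination sc \<phi> b ts"
  and combination_append [simp]:
    "combination sc \<phi> b (ts @ us) = combination sc \<phi> b ts + combination sc \<phi> b us"
  by (simp_all add: combination_def)

lemma combination_map_key: "combination sc \<phi> b (map (map_prod f id) ts) = combination sc \<phi> (\<lambda>i. b (f i)) ts"
  by (induction ts) auto

lemma combination_map_coef: "combination sc \<phi> b (map (map_prod id f) ts) = combination sc (\<lambda>p. \<phi> (f p)) b ts"
  by (induction ts) auto

locale char2_space = vector_space scale
  for scale :: "'k::field \<Rightarrow> 'g::ab_group_add \<Rightarrow> 'g" (infixr \<open>*\<^sub>g\<close> 75) +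
  fixes \<alpha> :: 'k
  assumes char2: "CHAR('k) = 2" and \<alpha>_nonzero: "\<alpha> \<noteq> 0" and \<alpha>_nonone: "\<alpha> \<noteq> 1"
begin

abbreviation "val \<equiv> coef_val \<alpha>"

abbreviation "dval \<equiv> (\<lambda>p. coef_val \<alpha> (coef_deriv p))"

lemma scalar_double [simp]: "(c::'k) + c = 0" "c + (c + d) = d"
  by (simp_all add: char2_double[OF char2] flip: add.assoc)

lemma two_eq_zero [simp]: "(2::'k) = 0"
  by (metis one_add_one scalar_double(1))

lemma double [simp]: "(v::'g) + v = 0" "v + (v + w) = w"
proof -
  show "v + v = 0" for v :: 'g
    using scale_left_distrib[of 1 1 v] by simp
  then show "v + (v + w) = w" for v w :: 'g
    by (simp flip: add.assoc)
qed

lemma uminus_same [simp]: "- (v::'g) = v" "- (c::'k) = c"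
  by (simp_all add: neg_eq_iff_add_eq_0)

lemma minus_plus [simp]: "(v::'g) - w = v + w" "(c::'k) - d = c + d"
  by (metis add_uminus_conv_diff uminus_same(1), metis add_uminus_conv_diff uminus_same(2))

lemma sum_zero_iff: "(v::'g) + w = 0 \<longleftrightarrow> v = w"
  by (metis eq_neg_iff_add_eq_0 uminus_same(1))

lemma val_unit: "coef_unit p \<Longrightarrow> val p \<noteq> 0"
  by (rule coef_val_unit[OF char2 _ \<alpha>_nonzero \<alpha>_nonone])

lemmas val_add = coef_val_add[OF char2, of \<alpha>]
  and val_mult = coef_val_mult[OF char2, of \<alpha>]

lemma combination_insert:
  assumes "\<And>p q. \<phi> (coef_add p q) = \<phi> p + \<phi> q"
  shows "combination scale \<phi> b (combi_insert i p ts) = \<phi> p *\<^sub>g b i + combination scale \<phi> b ts"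
  by (induction ts) (auto simp: assms algebra_simps)

lemma combination_collect:
  assumes "\<And>p q. \<phi> (coef_add p q) = \<phi> p + \<phi> q"
  shows "combination scale \<phi> b (combi_collect ts) = combination scale \<phi> b ts"
  by (induction ts) (auto simp: combination_insert[OF assms])

text \<open>A formal combination that vanishes identically in \<open>\<alpha>\<close> can be evaluated, but also differentiated
  and then evaluated: both functionals are additive.\<close>

lemma combination_vanishes:
  assumes "vanishes ts"
  shows "combination scale val b ts = 0" and "combination scale dval b ts = 0"
proof -
  have "combination scale \<phi> b us = 0"
    if "list_all (\<lambda>t. coef_zero (snd t)) us" "\<And>p. coef_zero p \<Longrightarrow> \<phi> p = 0" for \<phi> us
    using that(1) by (induction us) (auto simp: that(2))
  then have "combination scale \<phi> b (combi_collect ts) = 0" if "\<And>p. coef_zero p \<Longrightarrow> \<phi> p = 0" for \<phi>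
    using assms that unfolding vanishes_def by blast
  from this[of val] this[of dval] show "combination scale val b ts = 0" "combination scale dval b ts = 0"
    by (simp_all add: combination_collect val_add coef_val_deriv_add[OF char2] coef_val_zero
        coef_val_deriv_zero char2)
qed

lemma combination_scale: "combination scale val b (combi_scale p ts) = val p *\<^sub>g combination scale val b ts"
  by (induction ts) (auto simp: combi_scale_def val_mult algebra_simps)

lemma combination_bind:
  "combination scale val b (concat (map (\<lambda>(k, p). combi_scale p (f k)) ts))
     = combination scale val (\<lambda>k. combination scale val b (f k)) ts"
  by (induction ts) (auto simp: combination_scale)

lemma combination_scale_deriv:
  "combination scale dval b (combi_scale p ts)
     = dval p *\<^sub>g combination scale val b ts + val p *\<^sub>g combination scale dval b ts"
  by (induction ts)
     (auto simp: combi_scale_def coef_val_deriv_mult[OF char2] algebra_simps)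

text \<open>The product rule.\<close>

lemma combination_bind_deriv:
  "combination scale dval b (concat (map (\<lambda>(k, p). combi_scale p (f k)) ts))
     = combination scale dval (\<lambda>k. combination scale val b (f k)) ts
       + combination scale val (\<lambda>k. combination scale dval b (f k)) ts"
  by (induction ts) (auto simp: combination_scale_deriv algebra_simps)

lemma combination_linear:
  assumes "Vector_Spaces.linear scale scale T"
  shows "T (combination scale \<phi> b ts) = combination scale \<phi> (\<lambda>k. T (b k)) ts"
proof -
  interpret T: Vector_Spaces.linear scale scale T by fact
  show ?thesis
    by (induction ts) (auto simp: T.add T.scale)
qed

lemma linearI:
  assumes "\<And>X Y. T (X + Y) = T X + T Y" "\<And>c X. T (c *\<^sub>g X) = c *\<^sub>g T X"
  shows "Vector_Spaces.linear scale scale T"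
  using assms vector_space_axioms by (simp add: Vector_Spaces.linear_iff)

end

lemma set_basis_list: "set basis_list = UNIV"
proof -
  have "i \<in> set basis_list" for i
    by (cases i) (simp_all add: basis_list_def)
  then show ?thesis by auto
qed

lemma distinct_basis_list: "distinct basis_list"
  by (simp add: basis_list_def)

instance basis :: finite
  by standard (simp flip: set_basis_list)

lemma for_all_iff: "for_all P \<longleftrightarrow> (\<forall>i. P i)"
  by (simp add: for_all_def list_all_iff set_basis_list)

lemma bracket_degree:
  assumes "(m, p) \<in> set (bracket i j)"
  shows "basis_degree m = basis_degree i + basis_degree j"
proof -
  have "list_all (\<lambda>(k, p). basis_degree k = basis_degree i + basis_degree j) (bracket i j)"
    using bracket_check unfolding for_all_iff by blast
  with assms show ?thesis
    by (auto simp: list_all_iff)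
qed

lemma all_pairs_mono: "all_pairs P is \<Longrightarrow> (\<And>i j. P i j \<Longrightarrow> Q i j) \<Longrightarrow> all_pairs Q is"
  by (induction "is") (auto simp: list_all_iff)

lemma all_triples_mono:
  "all_triples P is \<Longrightarrow> (\<And>i j k. P i j k \<Longrightarrow> Q i j k) \<Longrightarrow> all_triples Q is"
  by (induction "is") (auto intro: all_pairs_mono)

lemma all_pairs_symmetric:
  assumes "all_pairs P is" "\<And>i. P i i" "\<And>i j. P i j \<Longrightarrow> P j i" "i \<in> set is" "j \<in> set is"
  shows "P i j"
  using assms(1,4,5) by (induction "is") (auto simp: list_all_iff assms(2,3))

text \<open>Alternating trilinear identities have to be checked on increasing triples only.\<close>

lemma all_triples_symmetric:
  assumes "all_triples P is" "\<And>i j. P i i j" "\<And>i j k. P i j k \<Longrightarrow> P j k i"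
    "\<And>i j k. P i j k \<Longrightarrow> P j i k" "i \<in> set is" "j \<in> set is" "k \<in> set is"
  shows "P i j k"
  using assms(1,5-7)
proof (induction "is")
  case (Cons l "is")
  have pairs: "P l m n" if "m \<in> set (l # is)" "n \<in> set (l # is)" for m n
  proof -
    have "P l m m" for m
      using assms(2)[of m l] assms(3) by blast
    moreover have "P l m n \<Longrightarrow> P l n m" for m n
      using assms(3,4) by blast
    moreover have "P l m l" for m
      using assms(2)[of l m] assms(3) by blast
    ultimately show ?thesis
      using that all_pairs_symmetric[of "P l" "is" m n] Cons.prems(1) assms(2) by auto
  qed
  consider "i = l" | "j = l" | "k = l" | "{i, j, k} \<subseteq> set is"
    using Cons.prems by auto
  then show ?case
  proof cases
    case 1
    then show ?thesis using pairs Cons.prems by blast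
  next
    case 2
    then show ?thesis using pairs Cons.prems assms(3) by blast
  next
    case 3
    then show ?thesis using pairs Cons.prems assms(3) by blast
  next
    case 4
    then show ?thesis using Cons by simp
  qed
qed simp

section \<open>Algebras with the tabulated bracket\<close>

text \<open>Alternation and the Jacobi identity follow from the table. Both the model and the given algebra
  are instances; for the model this is the proof that it is a Lie algebra.\<close>

locale tabulated = char2_space scale \<alpha>
  for scale :: "'k::field \<Rightarrow> 'g::ab_group_add \<Rightarrow> 'g" (infixr \<open>*\<^sub>g\<close> 75) and \<alpha> :: 'k +
  fixes br :: "'g \<Rightarrow> 'g \<Rightarrow> 'g" (\<open>\<lbrakk>_,/ _\<rbrakk>\<close>)
    and b :: "basis \<Rightarrow> 'g" and coord :: "basis \<Rightarrow> 'g \<Rightarrow> 'k"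
  assumes coord_add: "coord i (X + Y) = coord i X + coord i Y"
    and coord_scale: "coord i (c *\<^sub>g X) = c * coord i X"
    and coord_b: "coord i (b j) = of_bool (i = j)"
    and expansion: "(\<Sum>i\<in>UNIV. coord i X *\<^sub>g b i) = X"
    and br_right: "Vector_Spaces.linear scale scale (\<lambda>Y. \<lbrakk>X, Y\<rbrakk>)"
    and br_left: "Vector_Spaces.linear scale scale (\<lambda>X. \<lbrakk>X, Y\<rbrakk>)"
    and br_b: "\<lbrakk>b i, b j\<rbrakk> = combination scale val b (bracket i j)"
begin

lemma br_simps:
  "\<lbrakk>X + X', Y\<rbrakk> = \<lbrakk>X, Y\<rbrakk> + \<lbrakk>X', Y\<rbrakk>" "\<lbrakk>X, Y + Y'\<rbrakk> = \<lbrakk>X, Y\<rbrakk> + \<lbrakk>X, Y'\<rbrakk>"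
  "\<lbrakk>c *\<^sub>g X, Y\<rbrakk> = c *\<^sub>g \<lbrakk>X, Y\<rbrakk>" "\<lbrakk>X, c *\<^sub>g Y\<rbrakk> = c *\<^sub>g \<lbrakk>X, Y\<rbrakk>"
  "\<lbrakk>0, Y\<rbrakk> = 0" "\<lbrakk>X, 0\<rbrakk> = 0"
proof -
  interpret r: Vector_Spaces.linear scale scale "\<lambda>Y. \<lbrakk>X, Y\<rbrakk>" for X by (rule br_right)
  interpret l: Vector_Spaces.linear scale scale "\<lambda>X. \<lbrakk>X, Y\<rbrakk>" for Y by (rule br_left)
  show "\<lbrakk>X + X', Y\<rbrakk> = \<lbrakk>X, Y\<rbrakk> + \<lbrakk>X', Y\<rbrakk>" "\<lbrakk>c *\<^sub>g X, Y\<rbrakk> = c *\<^sub>g \<lbrakk>X, Y\<rbrakk>" "\<lbrakk>0, Y\<rbrakk> = 0"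
    using l.add l.scale l.zero by auto
  show "\<lbrakk>X, Y + Y'\<rbrakk> = \<lbrakk>X, Y\<rbrakk> + \<lbrakk>X, Y'\<rbrakk>" "\<lbrakk>X, c *\<^sub>g Y\<rbrakk> = c *\<^sub>g \<lbrakk>X, Y\<rbrakk>" "\<lbrakk>X, 0\<rbrakk> = 0"
    using r.add r.scale r.zero by auto
qed

lemma linear_determined:
  assumes "Vector_Spaces.linear scale scale T" "\<And>i. T (b i) = 0"
  shows "T X = 0"
proof -
  interpret T: Vector_Spaces.linear scale scale T by fact
  have "T X = T (\<Sum>i\<in>UNIV. coord i X *\<^sub>g b i)"
    by (simp add: expansion)
  also have "\<dots> = 0"
    by (simp add: T.sum T.scale assms(2))
  finally show ?thesis .
qed

lemma bilinear_determined:
  assumes "\<And>Y. Vector_Spaces.linear scale scale (\<lambda>X. T X Y)" "\<And>X. Vector_Spaces.linear scale scale (T X)"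
    and "\<And>i j. T (b i) (b j) = 0"
  shows "T X Y = 0"
  by (rule linear_determined[of "\<lambda>X. T X Y"], rule assms,
      rule linear_determined[of "T _"], rule assms, rule assms)

lemma trilinear_determined:
  assumes "\<And>Y Z. Vector_Spaces.linear scale scale (\<lambda>X. T X Y Z)"
    and "\<And>X Z. Vector_Spaces.linear scale scale (\<lambda>Y. T X Y Z)"
    and "\<And>X Y. Vector_Spaces.linear scale scale (T X Y)"
    and "\<And>i j k. T (b i) (b j) (b k) = 0"
  shows "T X Y Z = 0"
  by (rule linear_determined[of "\<lambda>X. T X Y Z"], rule assms,
      rule bilinear_determined[of "T _"], rule assms, rule assms, rule assms)

lemma coord_zero [simp]: "coord i 0 = 0"
  using coord_scale[of i 0 0] by simp

lemma coord_sum: "coord i (\<Sum>j\<in>J. F j) = (\<Sum>j\<in>J. coord i (F j))"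
  by (induction J rule: infinite_finite_induct) (simp_all add: coord_add)

lemma coord_eqI:
  assumes "\<And>i. coord i X = coord i Y"
  shows "X = Y"
proof -
  have "(\<Sum>i\<in>UNIV. coord i X *\<^sub>g b i) = (\<Sum>i\<in>UNIV. coord i Y *\<^sub>g b i)"
    by (simp add: assms)
  then show ?thesis
    by (simp only: expansion)
qed

lemma ad_combination: "combination scale val b (ad_combi i ts) = \<lbrakk>b i, combination scale val b ts\<rbrakk>"
  unfolding ad_combi_def combination_bind
  by (simp add: combination_linear[OF br_right] flip: br_b)

lemma br_symmetric: "\<lbrakk>X, Y\<rbrakk> = \<lbrakk>Y, X\<rbrakk>"
proof -
  have "\<lbrakk>X, Y\<rbrakk> + \<lbrakk>Y, X\<rbrakk> = 0"
  proof (rule bilinear_determined[of "\<lambda>X Y. \<lbrakk>X, Y\<rbrakk> + \<lbrakk>Y, X\<rbrakk>"])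
    fix i j
    have "vanishes (bracket i j @ bracket j i)"
      using bracket_check by (simp add: for_all_iff)
    from combination_vanishes(1)[OF this, of b] show "\<lbrakk>b i, b j\<rbrakk> + \<lbrakk>b j, b i\<rbrakk> = 0"
      by (simp add: br_b)
  qed (auto intro!: linearI simp: br_simps algebra_simps)
  then show ?thesis
    by (simp add: sum_zero_iff)
qed

text \<open>In characteristic two a symmetric bilinear map has an additive diagonal.\<close>

lemma alternatingI:
  assumes left: "\<And>Y. Vector_Spaces.linear scale scale (\<lambda>X. T X Y)"
    and right: "\<And>X. Vector_Spaces.linear scale scale (T X)"
    and symmetric: "\<And>i j. T (b i) (b j) = T (b j) (b i)" and diagonal: "\<And>i. T (b i) (b i) = 0"
  shows "T X X = 0"
proof -
  interpret l: Vector_Spaces.linear scale scale "\<lambda>U. T U V" for V by (rule left)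
  interpret r: Vector_Spaces.linear scale scale "T U" for U by (rule right)
  have "T X Y + T Y X = 0" for X Y
  proof (rule bilinear_determined[of "\<lambda>X Y. T X Y + T Y X"])
    show "T (b i) (b j) + T (b j) (b i) = 0" for i j
      by (simp add: symmetric[of i j])
  qed (auto intro!: linearI simp: l.add l.scale r.add r.scale algebra_simps)
  then have sq: "T (X + Y) (X + Y) = T X X + T Y Y" for X Y
    by (simp add: l.add r.add algebra_simps sum_zero_iff)
  have "T (\<Sum>i\<in>I. coord i X *\<^sub>g b i) (\<Sum>i\<in>I. coord i X *\<^sub>g b i) = 0" if "finite I" for I
    using that
  proof induction
    case (insert i I)
    then show ?case
      unfolding sum.insert[OF insert(1,2)] sq by (simp add: l.scale r.scale diagonal)
  qed (simp add: l.zero)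
  from this[of UNIV] show ?thesis
    by (simp add: expansion)
qed

lemma br_alternating: "\<lbrakk>X, X\<rbrakk> = 0"
proof (rule alternatingI[where T = br])
  show "\<lbrakk>b i, b i\<rbrakk> = 0" for i
    using bracket_check combination_vanishes(1)[of "bracket i i" b] by (simp add: for_all_iff br_b)
qed (rule br_left br_right br_symmetric)+

lemma br_jacobi: "\<lbrakk>X, \<lbrakk>Y, Z\<rbrakk>\<rbrakk> + \<lbrakk>Y, \<lbrakk>Z, X\<rbrakk>\<rbrakk> + \<lbrakk>Z, \<lbrakk>X, Y\<rbrakk>\<rbrakk> = 0"
proof (rule trilinear_determined[of "\<lambda>X Y Z. \<lbrakk>X, \<lbrakk>Y, Z\<rbrakk>\<rbrakk> + \<lbrakk>Y, \<lbrakk>Z, X\<rbrakk>\<rbrakk> + \<lbrakk>Z, \<lbrakk>X, Y\<rbrakk>\<rbrakk>"])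
  let ?J = "\<lambda>i j k. \<lbrakk>b i, \<lbrakk>b j, b k\<rbrakk>\<rbrakk> + \<lbrakk>b j, \<lbrakk>b k, b i\<rbrakk>\<rbrakk> + \<lbrakk>b k, \<lbrakk>b i, b j\<rbrakk>\<rbrakk> = 0"
  fix i j k
  have "all_triples ?J basis_list"
  proof -
    have "?J i j k" if "vanishes (jacobi_terms i j k)" for i j k
      using combination_vanishes(1)[OF that, of b] unfolding jacobi_terms_def
      by (simp add: ad_combination br_b add.assoc)
    then show ?thesis
      using jacobi_check by (rule all_triples_mono[rotated])
  qed
  moreover have "?J i i j" for i j
    using br_symmetric[of "b j" "b i"] by (simp add: br_alternating br_simps)
  moreover have "?J j k i" if "?J i j k" for i j k
    using that by (simp add: ac_simps)
  moreover have "?J j i k" if "?J i j k" for i j k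
  proof -
    have "\<lbrakk>b j, \<lbrakk>b i, b k\<rbrakk>\<rbrakk> + \<lbrakk>b i, \<lbrakk>b k, b j\<rbrakk>\<rbrakk> + \<lbrakk>b k, \<lbrakk>b j, b i\<rbrakk>\<rbrakk>
        = \<lbrakk>b i, \<lbrakk>b j, b k\<rbrakk>\<rbrakk> + \<lbrakk>b j, \<lbrakk>b k, b i\<rbrakk>\<rbrakk> + \<lbrakk>b k, \<lbrakk>b i, b j\<rbrakk>\<rbrakk>"
      unfolding br_symmetric[of "b i" "b k"] br_symmetric[of "b k" "b j"] br_symmetric[of "b j" "b i"]
      by (simp only: ac_simps)
    with that show ?thesis by simp
  qed
  ultimately show "?J i j k"
    by (rule all_triples_symmetric[where P = ?J]) (simp_all add: set_basis_list)
qed (auto intro!: linearI simp: br_simps algebra_simps)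

definition extend :: "(basis \<Rightarrow> 'g) \<Rightarrow> 'g \<Rightarrow> 'g" where
  "extend F X = (\<Sum>i\<in>UNIV. coord i X *\<^sub>g F i)"

lemma extend_linear: "Vector_Spaces.linear scale scale (extend F)"
  by (intro linearI)
     (simp_all add: extend_def coord_add coord_scale scale_left_distrib sum.distrib scale_sum_right)

lemma extend_b [simp]: "extend F (b i) = F i"
proof -
  have "coord j (b i) *\<^sub>g F j = (if j = i then F i else 0)" for j
    by (simp add: coord_b)
  then show ?thesis
    by (simp add: extend_def)
qed

lemma extend_add: "extend (\<lambda>i. F i + G i) X = extend F X + extend G X"
  by (simp add: extend_def scale_right_distrib sum.distrib)

lemma extend_scale: "extend (\<lambda>i. c *\<^sub>g F i) X = c *\<^sub>g extend F X"
  by (simp add: extend_def scale_sum_right mult.commute)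

lemma lie: "lie_algebra scale br"
  by unfold_locales (simp_all add: br_simps br_alternating br_jacobi)

end

section \<open>Evaluation of the free algebra\<close>

context lie_algebra
begin

lemma evaluation_superset:
  assumes "finite A" "Poly_Mapping.keys p \<subseteq> A"
  shows "evaluation \<phi> p = (\<Sum>t\<in>A. Poly_Mapping.lookup p t *\<^sub>g monomial_value br \<phi> t)"
  unfolding evaluation_def using assms
  by (intro sum.mono_neutral_left) (auto simp: in_keys_iff)

lemma evaluation_linear: "Vector_Spaces.linear fscale scale (evaluation \<phi>)"
proof -
  have "evaluation \<phi> (p + q) = evaluation \<phi> p + evaluation \<phi> q" for p q
  proof -
    let ?A = "Poly_Mapping.keys p \<union> Poly_Mapping.keys q"
    have "Poly_Mapping.keys (p + q) \<subseteq> ?A"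
      by (rule Poly_Mapping.keys_add)
    then show ?thesis
      using evaluation_superset[of ?A "p + q"] evaluation_superset[of ?A p] evaluation_superset[of ?A q]
      by (simp add: Poly_Mapping.lookup_add scale_left_distrib sum.distrib)
  qed
  moreover have "evaluation \<phi> (fscale c p) = c *\<^sub>g evaluation \<phi> p" for c p
  proof -
    have "Poly_Mapping.keys (fscale c p) \<subseteq> Poly_Mapping.keys p"
      by (auto simp: in_keys_iff lookup_fscale)
    then show ?thesis
      using evaluation_superset[of "Poly_Mapping.keys p" "fscale c p"]
      by (simp add: lookup_fscale evaluation_def scale_sum_right)
  qed
  ultimately show ?thesis
    using vector_space_axioms free_alg.vector_space_axioms by (simp add: Vector_Spaces.linear_iff)
qed

sublocale evaluation: Vector_Spaces.linear fscale scale "evaluation \<phi>" for \<phi> :: "'a \<Rightarrow> 'g"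
  by (rule evaluation_linear)

sublocale br_right: Vector_Spaces.linear scale scale "\<lambda>Y. \<lbrakk>X, Y\<rbrakk>" for X
  by (rule linear_br_right)

sublocale br_left: Vector_Spaces.linear scale scale "\<lambda>X. \<lbrakk>X, Y\<rbrakk>" for Y
  by (rule linear_br_left)

lemma evaluation_single: "evaluation \<phi> (Poly_Mapping.single t c) = c *\<^sub>g monomial_value br \<phi> t"
  using evaluation_superset[of "{t}" "Poly_Mapping.single t c"] by simp

lemma evaluation_fgen: "evaluation \<phi> (fgen a) = \<phi> a"
  by (simp add: fgen_def evaluation_single)

lemma evaluation_fbr: "evaluation \<phi> (fbr p q) = \<lbrakk>evaluation \<phi> p, evaluation \<phi> q\<rbrakk>"
proof -
  have "\<lbrakk>evaluation \<phi> p, evaluation \<phi> q\<rbrakk> =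
    (\<Sum>s\<in>Poly_Mapping.keys p. \<Sum>t\<in>Poly_Mapping.keys q. Poly_Mapping.lookup p s *\<^sub>g
       Poly_Mapping.lookup q t *\<^sub>g \<lbrakk>monomial_value br \<phi> s, monomial_value br \<phi> t\<rbrakk>)"
    unfolding evaluation_def
    by (subst sum.swap) (simp add: br_left.sum br_left.scale br_right.sum br_right.scale scale_sum_right mult.commute)
  then show ?thesis
    unfolding fbr_def by (simp add: evaluation.sum evaluation_single)
qed

lemma kernel_fideal: "fideal {p. evaluation \<phi> p = 0}"
  unfolding fideal_def free_alg.subspace_def
  by (simp add: evaluation.add evaluation.scale evaluation.zero evaluation_fbr br_left.zero br_right.zero)

lemma lie_relators_kernel: "lie_relators \<subseteq> {p. evaluation \<phi> p = 0}"
  unfolding lie_relators_def by (auto simp: evaluation.add evaluation_fbr br_self jacobi)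

end

lemma relation_ideal_least:
  "fideal I \<Longrightarrow> lie_relators \<subseteq> I \<Longrightarrow> chevalley_relators A \<subseteq> I \<Longrightarrow> relation_ideal A \<subseteq> I"
  unfolding relation_ideal_def by blast

lemma zero_relation_ideal: "0 \<in> relation_ideal A"
  unfolding relation_ideal_def fideal_def free_alg.subspace_def by blast

lemma cartan_span_explicit:
  fixes p :: "'n::finite generator monomial \<Rightarrow>\<^sub>0 'k::field"
  assumes "p \<in> cartan_span"
  obtains c where "p = (\<Sum>i\<in>UNIV. fscale (c i) (fgen (GenH i)))"
proof -
  have "\<exists>c. p = (\<Sum>i\<in>UNIV. fscale (c i) (fgen (GenH i)))"
    using assms unfolding cartan_span_def
  proof (induction rule: free_alg.span_induct_alt)
    case base
    show ?case by (rule exI[of _ "\<lambda>_. 0"]) simp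
  next
    case (step a q r)
    then obtain i c where "q = fgen (GenH i)" and r: "r = (\<Sum>i\<in>UNIV. fscale (c i) (fgen (GenH i)))"
      by auto
    then have "fscale a q = (\<Sum>j\<in>UNIV. fscale (if j = i then a else 0) (fgen (GenH j)))"
      by (simp add: if_distrib[of "\<lambda>c. fscale c _"] cong: if_cong)
    with r have "fscale a q + r = (\<Sum>j\<in>UNIV. fscale ((if j = i then a else 0) + c j) (fgen (GenH j)))"
      by (simp add: sum.distrib free_alg.scale_left_distrib)
    then show ?case
      by (rule exI[of _ "\<lambda>j. (if j = i then a else 0) + c j"])
  qed
  with that show ?thesis by blast
qed

section \<open>The concrete model\<close>

definition model_scale :: "'k::field \<Rightarrow> (basis \<Rightarrow> 'k) \<Rightarrow> basis \<Rightarrow> 'k" where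
  "model_scale c u = (\<lambda>i. c * u i)"

definition unit_vec :: "basis \<Rightarrow> basis \<Rightarrow> 'k::field" where
  "unit_vec i = (\<lambda>j. of_bool (i = j))"

definition model_br :: "'k::field \<Rightarrow> (basis \<Rightarrow> 'k) \<Rightarrow> (basis \<Rightarrow> 'k) \<Rightarrow> basis \<Rightarrow> 'k" where
  "model_br a u v = (\<lambda>m. \<Sum>i\<in>UNIV. \<Sum>j\<in>UNIV.
     u i * v j * combination (*) (coef_val a) (\<lambda>n. unit_vec n m) (bracket i j))"

lemma sum_fun_apply: "(\<Sum>i\<in>I. f i) x = (\<Sum>i\<in>I. f i x)"
  by (induction I rule: infinite_finite_induct) auto

lemma combination_model_apply:
  "combination model_scale \<phi> u ts m = combination (*) \<phi> (\<lambda>n. u n m) ts"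
  by (induction ts) (auto simp: model_scale_def)

lemma model_tabulated:
  assumes "CHAR('k::field) = 2" "a \<noteq> 0" "(a::'k) \<noteq> 1"
  shows "tabulated model_scale a (model_br a) unit_vec (\<lambda>i u. u i)"
proof -
  interpret vector_space "model_scale :: 'k \<Rightarrow> _"
    by unfold_locales (auto simp: model_scale_def fun_eq_iff algebra_simps)
  interpret char2_space model_scale a
    by unfold_locales (use assms in auto)
  show ?thesis
  proof (intro tabulated.intro tabulated_axioms.intro char2_space_axioms)
    fix X :: "basis \<Rightarrow> 'k"
    show "(\<Sum>i\<in>UNIV. model_scale (X i) (unit_vec i)) = X"
    proof -
      have "X i * unit_vec i j = (if i = j then X j else 0)" for i j
        by (simp add: unit_vec_def)
      then show ?thesis
        by (simp add: fun_eq_iff sum_fun_apply model_scale_def)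
    qed
    show "Vector_Spaces.linear model_scale model_scale (model_br a X)"
      by (intro linearI) (simp_all add: fun_eq_iff model_br_def model_scale_def algebra_simps
          sum.distrib sum_distrib_left)
    show "Vector_Spaces.linear model_scale model_scale (\<lambda>Y. model_br a Y X)"
      by (intro linearI) (simp_all add: fun_eq_iff model_br_def model_scale_def algebra_simps
          sum.distrib sum_distrib_left)
  next
    fix i j
    have "(\<Sum>k\<in>UNIV. \<Sum>l\<in>UNIV. unit_vec i k * unit_vec j l * F k l) = F i j" for F :: "basis \<Rightarrow> basis \<Rightarrow> 'k"
    proof -
      have "unit_vec i k * unit_vec j l * F k l = (if l = j then if k = i then F i j else 0 else 0)" for k l
        by (simp add: unit_vec_def)
      then show ?thesis by simp
    qed
    then show "model_br a (unit_vec i) (unit_vec j) = combination model_scale (coef_val a) unit_vec (bracket i j)"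
      by (simp add: fun_eq_iff model_br_def combination_model_apply)
  qed (auto simp: model_scale_def unit_vec_def)
qed

section \<open>Identification of the algebra of the Cartan matrix\<close>

text \<open>The analogue of \<open>vector_3\<close>, to read off the entries of the Cartan matrix.\<close>

lemma vector_4:
  "(vector [a, b, c, d] :: 'a::zero ^ 4) $ 1 = a" "(vector [a, b, c, d] :: 'a::zero ^ 4) $ 2 = b"
  "(vector [a, b, c, d] :: 'a::zero ^ 4) $ 3 = c" "(vector [a, b, c, d] :: 'a::zero ^ 4) $ 4 = d"
  unfolding vector_def by simp_all

text \<open>The bracketing scheme of the root vectors, for an arbitrary operation: it is applied in the given
  algebra, in the free algebra and in the model, and is preserved by homomorphisms
  (\<open>arrange_hom\<close>).\<close>

definition bracket_words :: "('a \<Rightarrow> 'a \<Rightarrow> 'a) \<Rightarrow> (4 \<Rightarrow> 'a) \<Rightarrow> 'a list" where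
  "bracket_words B g =
     [g 1, g 2, g 3, g 4, B (g 1) (g 2), B (g 1) (g 3), B (g 3) (g 4), B (g 3) (B (g 1) (g 2)),
      B (g 4) (B (g 1) (g 3)), B (B (g 1) (g 2)) (B (g 1) (g 3)),
      B (B (g 1) (g 2)) (B (g 3) (g 4)), B (B (g 1) (g 2)) (B (g 4) (B (g 1) (g 3))),
      B (B (g 3) (B (g 1) (g 2))) (B (g 4) (B (g 1) (g 3))),
      B (B (g 4) (B (g 1) (g 3))) (B (B (g 1) (g 2)) (B (g 1) (g 3))),
      B (B (B (g 1) (g 2)) (B (g 1) (g 3))) (B (B (g 1) (g 2)) (B (g 3) (g 4)))]"

primrec arrange :: "'a list \<Rightarrow> 'a list \<Rightarrow> (4 \<Rightarrow> 'a) \<Rightarrow> basis \<Rightarrow> 'a" where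
  "arrange x y h X1 = x ! 0" | "arrange x y h X2 = x ! 1" | "arrange x y h X3 = x ! 2"
| "arrange x y h X4 = x ! 3" | "arrange x y h X5 = x ! 4" | "arrange x y h X6 = x ! 5"
| "arrange x y h X7 = x ! 6" | "arrange x y h X8 = x ! 7" | "arrange x y h X9 = x ! 8"
| "arrange x y h X10 = x ! 9" | "arrange x y h X11 = x ! 10" | "arrange x y h X12 = x ! 11"
| "arrange x y h X13 = x ! 12" | "arrange x y h X14 = x ! 13" | "arrange x y h X15 = x ! 14"
| "arrange x y h Y1 = y ! 0" | "arrange x y h Y2 = y ! 1" | "arrange x y h Y3 = y ! 2"
| "arrange x y h Y4 = y ! 3" | "arrange x y h Y5 = y ! 4" | "arrange x y h Y6 = y ! 5"
| "arrange x y h Y7 = y ! 6" | "arrange x y h Y8 = y ! 7" | "arrange x y h Y9 = y ! 8"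
| "arrange x y h Y10 = y ! 9" | "arrange x y h Y11 = y ! 10" | "arrange x y h Y12 = y ! 11"
| "arrange x y h Y13 = y ! 12" | "arrange x y h Y14 = y ! 13" | "arrange x y h Y15 = y ! 14"
| "arrange x y h T1 = h 1" | "arrange x y h T2 = h 2" | "arrange x y h T3 = h 3"
| "arrange x y h T4 = h 4"

lemma arrange_hom:
  assumes "\<And>u v. \<phi> (B u v) = B' (\<phi> u) (\<phi> v)"
  shows "\<phi> (arrange (bracket_words B x) (bracket_words B y) h i)
       = arrange (bracket_words B' (\<phi> \<circ> x)) (bracket_words B' (\<phi> \<circ> y)) (\<phi> \<circ> h) i"
  by (cases i) (simp_all add: bracket_words_def assms)

abbreviation simple :: "basis \<Rightarrow> basis \<Rightarrow> basis \<Rightarrow> basis \<Rightarrow> 4 \<Rightarrow> basis" where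
  "simple p q r s \<equiv> (\<lambda>i. if i = 1 then p else if i = 2 then q else if i = 3 then r else s)"

definition basis_gen :: "4 generator \<Rightarrow> basis" where
  "basis_gen = case_generator (simple X1 X2 X3 X4) (simple Y1 Y2 Y3 Y4) (simple T1 T2 T3 T4)"

lemma basis_gen_simps [simp]:
  "basis_gen (GenX 1) = X1" "basis_gen (GenX 2) = X2" "basis_gen (GenX 3) = X3" "basis_gen (GenX 4) = X4"
  "basis_gen (GenY 1) = Y1" "basis_gen (GenY 2) = Y2" "basis_gen (GenY 3) = Y3" "basis_gen (GenY 4) = Y4"
  "basis_gen (GenH 1) = T1" "basis_gen (GenH 2) = T2" "basis_gen (GenH 3) = T3" "basis_gen (GenH 4) = T4"
  by (simp_all add: basis_gen_def)

lemma degree_basis_gen: "basis_degree (basis_gen g) = principal_degree (Gen g)"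
  by (auto simp: basis_gen_def split: generator.splits)

locale wk4_char2 = wk4 scale br \<alpha> e f h + char2_space scale \<alpha>
  for scale :: "'k::field \<Rightarrow> 'g::ab_group_add \<Rightarrow> 'g" (infixr \<open>*\<^sub>g\<close> 75)
    and br :: "'g \<Rightarrow> 'g \<Rightarrow> 'g" (\<open>\<lbrakk>_,/ _\<rbrakk>\<close>)
    and \<alpha> :: 'k and e f h :: "4 \<Rightarrow> 'g"
begin

interpretation M: tabulated model_scale \<alpha> "model_br \<alpha>" unit_vec "\<lambda>i u. u i"
  by (rule model_tabulated[OF char2 \<alpha>_nonzero \<alpha>_nonone])

interpretation L: lie_algebra model_scale "model_br \<alpha>"
  by (rule M.lie)

abbreviation "ev \<equiv> evaluation (case_generator e f h)"

abbreviation "mev \<equiv> L.evaluation (unit_vec \<circ> basis_gen)"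

definition b :: "basis \<Rightarrow> 'g" where
  "b = arrange (root_vectors e) (root_vectors f) h"

text \<open>Elements of the free algebra that represent the basis vectors of both algebras.\<close>

definition lift :: "basis \<Rightarrow> 4 generator monomial \<Rightarrow>\<^sub>0 'k" where
  "lift = arrange (bracket_words fbr (fgen \<circ> GenX)) (bracket_words fbr (fgen \<circ> GenY)) (fgen \<circ> GenH)"

lemma b_words: "b = arrange (bracket_words br e) (bracket_words br f) h"
  by (simp add: b_def root_vectors_def bracket_words_def)

lemma ev_lift: "ev (lift i) = b i"
proof -
  have "ev \<circ> (fgen \<circ> GenX) = e" "ev \<circ> (fgen \<circ> GenY) = f" "ev \<circ> (fgen \<circ> GenH) = h"
    by (auto simp: evaluation_fgen)
  then show ?thesis
    unfolding lift_def b_words using arrange_hom[where \<phi> = ev and B = fbr and B' = br, OF evaluation_fbr]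
    by simp
qed

lemma mev_lift: "mev (lift i) = unit_vec i"
proof -
  have gens: "(mev \<circ> (fgen \<circ> GenX)) = (\<lambda>i. unit_vec (basis_gen (GenX i)))"
    "(mev \<circ> (fgen \<circ> GenY)) = (\<lambda>i. unit_vec (basis_gen (GenY i)))"
    "(mev \<circ> (fgen \<circ> GenH)) = (\<lambda>i. unit_vec (basis_gen (GenH i)))"
    by (auto simp: L.evaluation_fgen)
  have "bracket_words (model_br \<alpha>) (\<lambda>i. unit_vec (basis_gen (GenX i))) =
      map unit_vec [X1, X2, X3, X4, X5, X6, X7, X8, X9, X10, X11, X12, X13, X14, X15]"
    "bracket_words (model_br \<alpha>) (\<lambda>i. unit_vec (basis_gen (GenY i))) =
      map unit_vec [Y1, Y2, Y3, Y4, Y5, Y6, Y7, Y8, Y9, Y10, Y11, Y12, Y13, Y14, Y15]"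
    by (simp_all add: bracket_words_def M.br_b)
  then show ?thesis
    unfolding lift_def arrange_hom[where \<phi> = mev and B = fbr and B' = "model_br \<alpha>", OF L.evaluation_fbr] gens
    by (cases i) simp_all
qed

lemma mev_chevalley: "chevalley_relators (wk4_matrix \<alpha>) \<subseteq> {p. mev p = 0}"
proof -
  have "mev (fbr (fgen (GenX i)) (fgen (GenY j)) - (if i = j then fgen (GenH i) else 0)) = 0" for i j
  proof -
    have "\<forall>i j. model_br \<alpha> (unit_vec (basis_gen (GenX i))) (unit_vec (basis_gen (GenY j)))
        = (if i = j then unit_vec (basis_gen (GenH i)) else 0)"
      by (simp add: forall_4 M.br_b)
    then show ?thesis
      by (simp add: L.evaluation.diff L.evaluation_fbr L.evaluation_fgen L.evaluation.zero)
  qed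
  moreover have "mev (fbr (fgen (GenH i)) (fgen (GenH j))) = 0" for i j
  proof -
    have "\<forall>i j. model_br \<alpha> (unit_vec (basis_gen (GenH i))) (unit_vec (basis_gen (GenH j))) = 0"
      by (simp add: forall_4 M.br_b)
    then show ?thesis
      by (simp add: L.evaluation_fbr L.evaluation_fgen)
  qed
  moreover have "mev (fbr (fgen (GenH i)) (fgen (GenX j)) - fscale (wk4_matrix \<alpha> $ i $ j) (fgen (GenX j))) = 0" for i j
  proof -
    have "\<forall>i j. model_br \<alpha> (unit_vec (basis_gen (GenH i))) (unit_vec (basis_gen (GenX j)))
        = model_scale (wk4_matrix \<alpha> $ i $ j) (unit_vec (basis_gen (GenX j)))"
      by (simp add: forall_4 M.br_b wk4_matrix_def vector_4)
    then show ?thesis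
      by (simp add: L.evaluation.diff L.evaluation_fbr L.evaluation_fgen L.evaluation.scale)
  qed
  moreover have "mev (fbr (fgen (GenH i)) (fgen (GenY j)) + fscale (wk4_matrix \<alpha> $ i $ j) (fgen (GenY j))) = 0" for i j
  proof -
    have "\<forall>i j. model_br \<alpha> (unit_vec (basis_gen (GenH i))) (unit_vec (basis_gen (GenY j)))
        = model_scale (wk4_matrix \<alpha> $ i $ j) (unit_vec (basis_gen (GenY j)))"
      by (simp add: forall_4 M.br_b wk4_matrix_def vector_4)
    then show ?thesis
      by (simp add: L.evaluation.add L.evaluation_fbr L.evaluation_fgen L.evaluation.scale)
  qed
  ultimately show ?thesis
    unfolding chevalley_relators_def by blast
qed

text \<open>The table respects the principal grading, hence so does evaluation in the model. This makes its
  kernel graded.\<close>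

lemma monomial_degree:
  "monomial_value (model_br \<alpha>) (unit_vec \<circ> basis_gen) t m \<noteq> 0 \<Longrightarrow> basis_degree m = principal_degree t"
proof (induction t arbitrary: m)
  case (Gen g)
  then have "m = basis_gen g"
    by (simp add: unit_vec_def split: if_splits)
  then show ?case
    by (simp only: degree_basis_gen)
next
  case (Br s t)
  let ?u = "monomial_value (model_br \<alpha>) (unit_vec \<circ> basis_gen) s"
  let ?v = "monomial_value (model_br \<alpha>) (unit_vec \<circ> basis_gen) t"
  let ?F = "\<lambda>i j. ?u i * ?v j * combination (*) val (\<lambda>n. unit_vec n m) (bracket i j)"
  have "(\<Sum>i\<in>UNIV. \<Sum>j\<in>UNIV. ?F i j) \<noteq> 0"
    using Br.prems unfolding monomial_value.simps(2) model_br_def[of \<alpha> ?u ?v] .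
  then obtain i where "(\<Sum>j\<in>UNIV. ?F i j) \<noteq> 0"
    by (rule sum.not_neutral_contains_not_neutral)
  then obtain j where "?F i j \<noteq> 0"
    by (rule sum.not_neutral_contains_not_neutral)
  then have "?u i \<noteq> 0" "?v j \<noteq> 0" "combination (*) val (\<lambda>n. unit_vec n m) (bracket i j) \<noteq> 0"
    by auto
  moreover have "\<exists>p. (m, p) \<in> set ts" if "combination (*) val (\<lambda>n. unit_vec n m) ts \<noteq> 0" for ts
    using that
  proof (induction ts)
    case (Cons t ts)
    then show ?case
      by (cases "fst t = m") (auto simp: unit_vec_def intro: exI[of _ "snd t"])
  qed simp
  ultimately obtain p where "(m, p) \<in> set (bracket i j)" "basis_degree i = principal_degree s"
    "basis_degree j = principal_degree t"
    using Br.IH by blast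
  moreover from this(1) have "basis_degree m = basis_degree i + basis_degree j"
    by (rule bracket_degree)
  ultimately show ?case
    by simp
qed

lemma mev_homogeneous_component:
  "mev (homogeneous_component d p) m = (if basis_degree m = d then mev p m else 0)"
proof -
  let ?v = "\<lambda>t. Poly_Mapping.lookup p t * monomial_value (model_br \<alpha>) (unit_vec \<circ> basis_gen) t m"
  have "mev (homogeneous_component d p) m
      = (\<Sum>t | t \<in> Poly_Mapping.keys p \<and> principal_degree t = d. ?v t)"
    unfolding homogeneous_component_def
    by (simp add: L.evaluation.sum L.evaluation_single sum_fun_apply model_scale_def)
  also have "\<dots> = (\<Sum>t\<in>Poly_Mapping.keys p. if basis_degree m = d then ?v t else 0)"
  proof -
    have "?v t = 0" if "principal_degree t \<noteq> basis_degree m" for t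
      using monomial_degree[of t m] that by auto
    then show ?thesis
      by (intro sum.mono_neutral_cong_left) auto
  qed
  also have "\<dots> = (if basis_degree m = d then mev p m else 0)"
    by (simp add: L.evaluation_def sum_fun_apply model_scale_def)
  finally show ?thesis .
qed

lemma model_admissible: "admissible_ideal (wk4_matrix \<alpha>) {p. mev p = 0}"
  unfolding admissible_ideal_def
proof (intro conjI)
  show "fideal {p. mev p = 0}"
    by (rule L.kernel_fideal)
  show "graded {p. mev p = 0}"
    unfolding graded_def by (auto simp: fun_eq_iff mev_homogeneous_component)
  show "relation_ideal (wk4_matrix \<alpha>) \<subseteq> {p. mev p = 0}"
    by (intro relation_ideal_least L.kernel_fideal L.lie_relators_kernel mev_chevalley)
  show "{p. mev p = 0} \<inter> cartan_span \<subseteq> relation_ideal (wk4_matrix \<alpha>)"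
  proof safe
    fix p :: "4 generator monomial \<Rightarrow>\<^sub>0 'k"
    assume "p \<in> cartan_span" "mev p = 0"
    moreover from this(1) obtain c where p: "p = (\<Sum>i\<in>UNIV. fscale (c i) (fgen (GenH i)))"
      by (rule cartan_span_explicit)
    ultimately have "(\<Sum>i\<in>UNIV. c i * unit_vec (basis_gen (GenH i)) m) = 0" for m
      by (auto simp: L.evaluation.sum L.evaluation.scale L.evaluation_fgen fun_eq_iff
          sum_fun_apply model_scale_def)
    from this[of T1] this[of T2] this[of T3] this[of T4] have "\<forall>i. c i = 0"
      by (simp add: forall_4 sum_4 unit_vec_def)
    then show "p \<in> relation_ideal (wk4_matrix \<alpha>)"
      by (simp add: p zero_relation_ideal)
  qed
qed

text \<open>Let \<open>q\<close> be a relation of the given algebra with homogeneous value in the model. In degree zero this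
  value is also the value of a combination \<open>r\<close> of the \<open>h\<^sub>i\<close>. As \<open>q - r\<close> is a relation of the model,
  \<open>r\<close> is a relation of the given algebra, and admissibility makes it trivial. In other
  degrees, bracketing with a generator of the opposite sign leads to a smaller degree without
  losing the coordinate singled out by \<^const>\<open>lowering\<close>.\<close>

lemma kernel_homogeneous_zero:
  assumes "ev q = 0" "\<And>m. mev q m \<noteq> 0 \<Longrightarrow> basis_degree m = d"
  shows "mev q = 0"
  using assms
proof (induction "nat \<bar>d\<bar>" arbitrary: q d rule: less_induct)
  case less
  show ?case
  proof (cases "d = 0")
    case True
    let ?c = "\<lambda>i. mev q (basis_gen (GenH i))"
    let ?r = "\<Sum>i\<in>UNIV. fscale (?c i) (fgen (GenH i))"
    have "mev ?r m = mev q m" for m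
      using less.prems(2)[of m] True
      by (cases m) (auto simp: L.evaluation.add L.evaluation.scale L.evaluation_fgen
          model_scale_def sum_4 unit_vec_def)
    then have r: "mev ?r = mev q"
      by (rule ext)
    then have "mev (q - ?r) = 0"
      by (simp add: L.evaluation.diff)
    then have "ev (q - ?r) = 0"
      using kernel_greatest[OF model_admissible] by blast
    then have "ev ?r = 0"
      using less.prems(1) by (simp add: evaluation.diff)
    moreover have "?r \<in> cartan_span"
      unfolding cartan_span_def by (intro free_alg.span_sum free_alg.span_scale free_alg.span_base) auto
    ultimately have "?r \<in> relation_ideal (wk4_matrix \<alpha>)"
      using kernel_admissible unfolding admissible_ideal_def by blast
    then have "mev ?r = 0"
      using model_admissible unfolding admissible_ideal_def by blast
    with r show ?thesis by simp
  next
    case False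
    show ?thesis
    proof (rule ccontr)
      assume "mev q \<noteq> 0"
      then obtain i where i: "mev q i \<noteq> 0"
        by (auto simp: fun_eq_iff)
      then have di: "basis_degree i = d"
        by (rule less.prems(2))
      obtain g m where gm: "lowering i = (g, m)"
        by (cases "lowering i")
      have "basis_degree g * sgn d = - 1
          \<and> (case bracket g i of [] \<Rightarrow> False
             | t # ts \<Rightarrow> fst t = m \<and> coef_unit (snd t) \<and> list_all (\<lambda>t. fst t \<noteq> m) ts)
          \<and> for_all (\<lambda>k. basis_degree k = d \<longrightarrow> k = i \<or> list_all (\<lambda>t. fst t \<noteq> m) (bracket g k))"
        using lowering_check[unfolded for_all_iff, THEN spec, of i] gm di False
        by (simp add: for_all_iff)
      then have deg_g: "basis_degree g * sgn d = - 1"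
        and head: "case bracket g i of [] \<Rightarrow> False
          | t # ts \<Rightarrow> fst t = m \<and> coef_unit (snd t) \<and> list_all (\<lambda>t. fst t \<noteq> m) ts"
        and others: "\<And>k. basis_degree k = d \<Longrightarrow> k \<noteq> i \<Longrightarrow> list_all (\<lambda>t. fst t \<noteq> m) (bracket g k)"
        by (auto simp: for_all_iff)
      \<comment> \<open>Hence the coordinate \<open>m\<close> of the bracket with \<open>g\<close> is a nonzero multiple of the coordinate \<open>i\<close>
        of the value of \<open>q\<close>.\<close>
      have absent: "combination (*) val (\<lambda>n. unit_vec n m) ts = 0" if "list_all (\<lambda>t. fst t \<noteq> m) ts" for m ts
        using that by (induction ts) (auto simp: unit_vec_def)
      have coord: "mev (fbr (lift g) q) m' = (\<Sum>k\<in>UNIV. mev q k * combination (*) val (\<lambda>n. unit_vec n m') (bracket g k))" for m'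
      proof -
        have "(\<Sum>i\<in>UNIV. \<Sum>j\<in>UNIV. unit_vec g i * mev q j * combination (*) val (\<lambda>n. unit_vec n m') (bracket i j))
          = (\<Sum>i\<in>UNIV. if i = g then (\<Sum>k\<in>UNIV. mev q k * combination (*) val (\<lambda>n. unit_vec n m') (bracket g k)) else 0)"
          by (intro sum.cong refl) (auto simp: unit_vec_def)
        then show ?thesis
          by (simp add: L.evaluation_fbr mev_lift model_br_def)
      qed
      have "mev (fbr (lift g) q) m' = 0 \<or> basis_degree m' = d + basis_degree g" for m'
      proof (rule disjCI)
        assume "basis_degree m' \<noteq> d + basis_degree g"
        then have "list_all (\<lambda>t. fst t \<noteq> m') (bracket g k)" if "basis_degree k = d" for k
          using that bracket_degree[of _ _ g k] by (auto simp: list_all_iff)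
        then have "mev q k * combination (*) val (\<lambda>n. unit_vec n m') (bracket g k) = 0" for k
          using less.prems(2)[of k] absent[of m'] by (cases "mev q k = 0") auto
        then show "mev (fbr (lift g) q) m' = 0"
          unfolding coord by (intro sum.neutral) blast
      qed
      moreover have "ev (fbr (lift g) q) = 0"
        by (simp add: evaluation_fbr less.prems(1) br_right.zero)
      moreover have "nat \<bar>d + basis_degree g\<bar> < nat \<bar>d\<bar>"
        using deg_g False by (auto simp: sgn_if split: if_splits)
      ultimately have "mev (fbr (lift g) q) m = 0"
        using less.hyps[of "d + basis_degree g" "fbr (lift g) q"] by (metis zero_fun_apply)
      moreover have "mev (fbr (lift g) q) m = mev q i * combination (*) val (\<lambda>n. unit_vec n m) (bracket g i)"
      proof -
        have "mev q k * combination (*) val (\<lambda>n. unit_vec n m) (bracket g k) = 0" if "k \<noteq> i" for k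
          using others[of k] less.prems(2)[of k] absent that by auto
        then show ?thesis
          unfolding coord by (subst sum.remove[of _ i]) (simp_all add: sum.neutral)
      qed
      moreover have "combination (*) val (\<lambda>n. unit_vec n m) (bracket g i) \<noteq> 0"
        using head absent val_unit by (auto simp: unit_vec_def split: list.splits)
      ultimately show False
        using i by simp
    qed
  qed
qed

text \<open>One direction is the maximality of the kernel of the given algebra among admissible ideals, the
  other one splits a relation into homogeneous components.\<close>

lemma kernel_eq: "ev p = 0 \<longleftrightarrow> mev p = 0"
proof
  assume "mev p = 0"
  then show "ev p = 0"
    using kernel_greatest[OF model_admissible] by blast
next
  assume p: "ev p = 0"
  have "mev p m = 0" for m
  proof -
    let ?q = "homogeneous_component (basis_degree m) p"
    have "ev ?q = 0"
      using kernel_admissible p unfolding admissible_ideal_def graded_def by blast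
    then have "mev ?q = 0"
      by (rule kernel_homogeneous_zero[where d = "basis_degree m"]) (auto simp: mev_homogeneous_component split: if_splits)
    then show ?thesis
      using mev_homogeneous_component[of "basis_degree m" p m] by simp
  qed
  then show "mev p = 0"
    by (simp add: fun_eq_iff)
qed

lemma ev_expansion: "ev p = (\<Sum>i\<in>UNIV. mev p i *\<^sub>g b i)"
proof -
  have "mev (\<Sum>i\<in>UNIV. fscale (mev p i) (lift i)) = mev p"
    using M.expansion[of "mev p"] by (simp add: L.evaluation.sum L.evaluation.scale mev_lift)
  then have "mev (p - (\<Sum>i\<in>UNIV. fscale (mev p i) (lift i))) = 0"
    by (simp add: L.evaluation.diff)
  then show ?thesis
    by (simp add: evaluation.diff evaluation.sum evaluation.scale ev_lift sum_zero_iff flip: kernel_eq)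
qed

lemma b_independent:
  assumes "(\<Sum>i\<in>UNIV. c i *\<^sub>g b i) = 0"
  shows "c i = 0"
proof -
  have "ev (\<Sum>i\<in>UNIV. fscale (c i) (lift i)) = 0"
    using assms by (simp add: evaluation.sum evaluation.scale ev_lift)
  then have "mev (\<Sum>i\<in>UNIV. fscale (c i) (lift i)) = 0"
    by (simp add: kernel_eq)
  then have "(\<Sum>i\<in>UNIV. model_scale (c i) (unit_vec i)) = 0"
    by (simp add: L.evaluation.sum L.evaluation.scale mev_lift)
  then show ?thesis
    using M.expansion[of c] by simp
qed

lemma br_table: "\<lbrakk>b i, b j\<rbrakk> = combination scale val b (bracket i j)"
proof -
  have "\<lbrakk>b i, b j\<rbrakk> = (\<Sum>m\<in>UNIV. mev (fbr (lift i) (lift j)) m *\<^sub>g b m)"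
    using ev_expansion[of "fbr (lift i) (lift j)"] by (simp add: evaluation_fbr ev_lift)
  also have "\<dots> = (\<Sum>m\<in>UNIV. combination (*) val (\<lambda>n. unit_vec n m) (bracket i j) *\<^sub>g b m)"
    by (simp add: L.evaluation_fbr mev_lift M.br_b combination_model_apply)
  also have "\<dots> = combination scale val b (bracket i j)"
  proof -
    have "(\<Sum>m\<in>UNIV. combination (*) val (\<lambda>n. unit_vec n m) ts *\<^sub>g b m) = combination scale val b ts" for ts
    proof (induction ts)
      case (Cons t ts)
      have "(val (snd t) * unit_vec (fst t) m) *\<^sub>g b m = (if m = fst t then val (snd t) *\<^sub>g b m else 0)" for m
        by (simp add: unit_vec_def)
      with Cons show ?case
        by (simp add: scale_left_distrib sum.distrib)
    qed simp
    then show ?thesis .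
  qed
  finally show ?thesis .
qed

lemma inj_b: "inj b"
proof (rule injI, rule ccontr)
  fix i j
  assume eq: "b i = b j" and "i \<noteq> j"
  let ?c = "\<lambda>k. if k = i then 1 else if k = j then 1 else (0::'k)"
  have "(\<Sum>k\<in>UNIV. ?c k *\<^sub>g b k) = (\<Sum>k\<in>{i, j}. ?c k *\<^sub>g b k)"
    by (rule sum.mono_neutral_right) auto
  also have "\<dots> = 0"
    using eq \<open>i \<noteq> j\<close> by simp
  finally show False
    using b_independent[of ?c i] by simp
qed

lemma standard_basis_range: "standard_basis = range b"
proof -
  have "map b basis_list = map x [1..<16] @ map y [1..<16] @ map h [1, 2, 3, 4]"
  proof -
    have "[1..<16] = [1, 2, 3, 4, 5, 6, 7, 8, 9, 10, 11, 12, 13, 14, 15::nat]"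
      by (simp add: upt_conv_Cons)
    then show ?thesis
      by (simp add: basis_list_def b_def x_def y_def)
  qed
  from arg_cong[OF this, of set]
  have "range b = set (map x [1..<16] @ map y [1..<16] @ map h [1, 2, 3, 4])"
    by (simp only: set_map set_basis_list)
  moreover have "{1..15} = set [1..<16]"
    by auto
  ultimately show ?thesis
    unfolding standard_basis_def UNIV_4 by simp
qed

lemma card_standard_basis: "card standard_basis = 34"
proof -
  have "card (UNIV :: basis set) = length basis_list"
    by (metis distinct_card distinct_basis_list set_basis_list)
  then show ?thesis
    unfolding standard_basis_range using card_image[OF inj_b] by (simp add: basis_list_def)
qed

lemma span_standard_basis: "span standard_basis = UNIV"
proof -
  have "X \<in> span (range b)" for X
  proof -
    obtain p where "X = ev p"
      using range_evaluation by blast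
    moreover have "ev p \<in> span (range b)"
      unfolding ev_expansion by (intro span_sum span_scale span_base rangeI)
    ultimately show ?thesis by simp
  qed
  then show ?thesis
    unfolding standard_basis_range by blast
qed

lemma independent_standard_basis: "independent standard_basis"
  unfolding standard_basis_range
proof (rule independent_if_scalars_zero)
  fix c v
  assume "(\<Sum>v\<in>range b. c v *\<^sub>g v) = 0" "v \<in> range b"
  moreover have "(\<Sum>v\<in>range b. c v *\<^sub>g v) = (\<Sum>i\<in>UNIV. c (b i) *\<^sub>g b i)"
    using inj_b by (simp add: sum.reindex)
  ultimately show "c v = 0"
    using b_independent[of "\<lambda>i. c (b i)"] by auto
qed simp

definition coord :: "basis \<Rightarrow> 'g \<Rightarrow> 'k" where
  "coord i X = representation standard_basis X (b i)"

sublocale tabulated scale \<alpha> br b coord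
proof (intro tabulated.intro tabulated_axioms.intro char2_space_axioms)
  interpret c: Vector_Spaces.linear scale "(*)" "coord i" for i
    unfolding coord_def using linear_representation[OF independent_standard_basis span_standard_basis] .
  show "coord i (X + Y) = coord i X + coord i Y" "coord i (c *\<^sub>g X) = c * coord i X" for i c X Y
    by (rule c.add, rule c.scale)
  show "coord i (b j) = of_bool (i = j)" for i j
    unfolding coord_def
    by (subst representation_basis[OF independent_standard_basis])
       (use inj_b in \<open>auto simp: standard_basis_range inj_eq\<close>)
  show "(\<Sum>i\<in>UNIV. coord i X *\<^sub>g b i) = X" for X
  proof -
    have "(\<Sum>v\<in>range b. representation standard_basis X v *\<^sub>g v) = X"
      by (rule sum_representation_eq[OF independent_standard_basis])
         (simp_all add: span_standard_basis[unfolded standard_basis_range] standard_basis_range)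
    then show ?thesis
      using inj_b by (simp add: sum.reindex coord_def)
  qed
qed (rule linear_br_right linear_br_left br_table)+

end

context wk4_char2
begin

section \<open>The automorphism exchanging the generators\<close>

lemma b_gen: "b (basis_gen (GenX i)) = e i" "b (basis_gen (GenY i)) = f i" "b (basis_gen (GenH i)) = h i"
  using exhaust_4[of i] by (auto simp: b_words bracket_words_def)

lemma swap_br: "combination scale val (\<lambda>k. b (swap k)) (bracket i j) = \<lbrakk>b (swap i), b (swap j)\<rbrakk>"
proof -
  have "vanishes (map (map_prod swap id) (bracket i j) @ bracket (swap i) (swap j))"
    using bracket_check by (simp add: for_all_iff)
  from combination_vanishes(1)[OF this, of b] show ?thesis
    by (simp add: combination_map_key br_b sum_zero_iff)
qed

lemma swap_swap [simp]: "swap (swap i) = i"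
  by (cases i) simp_all

abbreviation flip :: "'g \<Rightarrow> 'g" where
  "flip \<equiv> extend (\<lambda>i. b (swap i))"

lemma flip_flip: "flip (flip X) = X"
proof -
  interpret F: Vector_Spaces.linear scale scale flip by (rule extend_linear)
  have "flip (flip X) + X = 0"
    by (rule linear_determined[of "\<lambda>X. flip (flip X) + X"]) (auto intro!: linearI simp: F.add F.scale algebra_simps)
  then show ?thesis
    by (simp add: sum_zero_iff)
qed

lemma flip_automorphism: "automorphism flip"
  unfolding automorphism_def
proof (intro conjI allI)
  interpret F: Vector_Spaces.linear scale scale flip by (rule extend_linear)
  show "Vector_Spaces.linear scale scale flip"
    by (rule extend_linear)
  show "bij flip"
    by (rule o_bij[of flip]) (auto simp: flip_flip)
  show "flip \<lbrakk>X, Y\<rbrakk> = \<lbrakk>flip X, flip Y\<rbrakk>" for X Y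
  proof -
    have "flip \<lbrakk>X, Y\<rbrakk> + \<lbrakk>flip X, flip Y\<rbrakk> = 0"
    proof (rule bilinear_determined[of "\<lambda>X Y. flip \<lbrakk>X, Y\<rbrakk> + \<lbrakk>flip X, flip Y\<rbrakk>"])
      show "flip \<lbrakk>b i, b j\<rbrakk> + \<lbrakk>flip (b i), flip (b j)\<rbrakk> = 0" for i j
        unfolding sum_zero_iff br_b combination_linear[OF extend_linear]
        using swap_br[of i j] by (simp flip: br_b)
    qed (auto intro!: linearI simp: F.add F.scale br_simps algebra_simps)
    then show ?thesis
      by (simp add: sum_zero_iff)
  qed
qed

text \<open>The map that exchanges \<open>x\<^sub>k\<close> and \<open>y\<^sub>k\<close> for all \<open>k\<close> is an automorphism by inspection of the table, and
  automorphisms are determined on generators.\<close>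

lemma omega_eq: "\<omega> = flip"
  unfolding \<omega>_def
proof (rule the_equality)
  have "flip (e i) = f i \<and> flip (f i) = e i \<and> flip (h i) = h i" for i
    using exhaust_4[of i] extend_b[of "\<lambda>i. b (swap i)"] by (auto simp flip: b_gen)
  with flip_automorphism show "automorphism flip \<and> (\<forall>i. flip (e i) = f i \<and> flip (f i) = e i \<and> flip (h i) = h i)"
    by blast
next
  fix \<phi>
  assume \<phi>: "automorphism \<phi> \<and> (\<forall>i. \<phi> (e i) = f i \<and> \<phi> (f i) = e i \<and> \<phi> (h i) = h i)"
  then have hom: "\<phi> \<lbrakk>X, Y\<rbrakk> = \<lbrakk>\<phi> X, \<phi> Y\<rbrakk>" and lin: "Vector_Spaces.linear scale scale \<phi>" for X Y
    by (auto simp: automorphism_def)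
  interpret F: Vector_Spaces.linear scale scale flip by (rule extend_linear)
  interpret \<phi>: Vector_Spaces.linear scale scale \<phi> by (rule lin)
  have "\<phi> \<circ> e = f" "\<phi> \<circ> f = e" "\<phi> \<circ> h = h"
    using \<phi> by auto
  then have "\<phi> (b i) = arrange (bracket_words br f) (bracket_words br e) h i" for i
    unfolding b_words arrange_hom[where \<phi> = \<phi> and B = br and B' = br, OF hom] by simp
  moreover have "b (swap i) = arrange (bracket_words br f) (bracket_words br e) h i" for i
    by (cases i) (simp_all add: b_words)
  ultimately have on_b: "\<phi> (b i) = flip (b i)" for i
    by simp
  have "\<phi> X + flip X = 0" for X
  proof (rule linear_determined[of "\<lambda>X. \<phi> X + flip X"])
    show "Vector_Spaces.linear scale scale (\<lambda>X. \<phi> X + flip X)"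
      by (rule linearI) (simp_all add: \<phi>.add \<phi>.scale F.add F.scale algebra_simps)
    show "\<phi> (b i) + flip (b i) = 0" for i
      unfolding on_b by simp
  qed
  then show "\<phi> = flip"
    by (auto simp: sum_zero_iff fun_eq_iff)
qed

lemma inv_flip: "inv flip = flip"
  by (rule inv_unique_comp) (auto simp: flip_flip)

section \<open>Cochains, cocycles and coboundaries in characteristic two\<close>

lemma C2_iff: "c \<in> C2 \<longleftrightarrow> (\<forall>X Y Z. c X (Y + Z) = c X Y + c X Z) \<and> (\<forall>a X Y. c X (a *\<^sub>g Y) = a *\<^sub>g c X Y)
    \<and> (\<forall>X Y Z. c (X + Z) Y = c X Y + c Z Y) \<and> (\<forall>a X Y. c (a *\<^sub>g X) Y = a *\<^sub>g c X Y) \<and> (\<forall>X. c X X = 0)"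
  unfolding C2_def Vector_Spaces.linear_iff using vector_space_axioms by auto

lemma C2_simps:
  assumes "c \<in> C2"
  shows "c X (Y + Z) = c X Y + c X Z" "c X (a *\<^sub>g Y) = a *\<^sub>g c X Y"
    "c (X + Z) Y = c X Y + c Z Y" "c (a *\<^sub>g X) Y = a *\<^sub>g c X Y" "c X X = 0"
    "c X 0 = 0" "c 0 X = 0"
proof -
  show *: "c X (Y + Z) = c X Y + c X Z" "c X (a *\<^sub>g Y) = a *\<^sub>g c X Y"
    "c (X + Z) Y = c X Y + c Z Y" "c (a *\<^sub>g X) Y = a *\<^sub>g c X Y" "c X X = 0" for X Y Z a
    using assms unfolding C2_iff by blast+
  show "c X 0 = 0" "c 0 X = 0"
    using *(2)[of X 0 0] *(4)[of 0 0 X] by simp_all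
qed

lemma C2_linear:
  assumes "c \<in> C2"
  shows "Vector_Spaces.linear scale scale (c X)" "Vector_Spaces.linear scale scale (\<lambda>X. c X Y)"
  by (intro linearI; simp add: C2_simps[OF assms])+

lemma C2_symmetric:
  assumes "c \<in> C2"
  shows "c X Y = c Y X"
proof -
  have "c (X + Y) (X + Y) = c X Y + c Y X"
    unfolding C2_simps(1,3)[OF assms] by (simp add: C2_simps(5)[OF assms])
  then show ?thesis
    by (simp add: C2_simps(5)[OF assms] sum_zero_iff)
qed

lemma C2_determined:
  assumes "c \<in> C2" "c' \<in> C2" "\<And>i j. c (b i) (b j) = c' (b i) (b j)"
  shows "c = c'"
proof -
  have "c X Y + c' X Y = 0" for X Y
    by (rule bilinear_determined[of "\<lambda>X Y. c X Y + c' X Y"])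
       (auto intro!: linearI simp: C2_simps[OF assms(1)] C2_simps[OF assms(2)] assms(3) algebra_simps)
  then show ?thesis
    by (simp add: fun_eq_iff sum_zero_iff)
qed

lemma d2_cyclic:
  assumes "c \<in> C2"
  shows "d2 c X Y Z = \<lbrakk>X, c Y Z\<rbrakk> + \<lbrakk>Y, c Z X\<rbrakk> + \<lbrakk>Z, c X Y\<rbrakk>
    + (c \<lbrakk>X, Y\<rbrakk> Z + c \<lbrakk>Y, Z\<rbrakk> X + c \<lbrakk>Z, X\<rbrakk> Y)"
  unfolding d2_def using C2_symmetric[OF assms, of X Z] br_symmetric[of X Z]
  by (simp add: ac_simps)

lemma Z2_iff: "c \<in> Z2 \<longleftrightarrow> c \<in> C2 \<and> (\<forall>X Y Z. \<lbrakk>X, c Y Z\<rbrakk> + \<lbrakk>Y, c Z X\<rbrakk> + \<lbrakk>Z, c X Y\<rbrakk>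
    + (c \<lbrakk>X, Y\<rbrakk> Z + c \<lbrakk>Y, Z\<rbrakk> X + c \<lbrakk>Z, X\<rbrakk> Y) = 0)"
  unfolding Z2_def using d2_cyclic by auto

lemma Z2_C2: "c \<in> Z2 \<Longrightarrow> c \<in> C2"
  by (simp add: Z2_def)

lemma C2_subspace: "cochains.subspace C2"
  unfolding cochains.subspace_def by (auto simp: C2_iff cscale_def algebra_simps)

lemma Z2_subspace: "cochains.subspace Z2"
proof -
  have "d2 (c + c') X Y Z = d2 c X Y Z + d2 c' X Y Z" for c c' X Y Z
    by (simp add: d2_def br_simps ac_simps)
  moreover have "d2 (a \<odot> c) X Y Z = a *\<^sub>g d2 c X Y Z" for a c X Y Z
    by (simp add: d2_def cscale_def br_simps scale_right_distrib)
  moreover have "d2 0 X Y Z = 0" for X Y Z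
    by (simp add: d2_def br_simps)
  ultimately show ?thesis
    using C2_subspace unfolding cochains.subspace_def Z2_def by simp
qed

lemma B2_subspace: "cochains.subspace B2"
proof -
  have "d1 (\<lambda>_. 0) = 0" "d1 f + d1 g = d1 (\<lambda>X. f X + g X)" "a \<odot> d1 f = d1 (\<lambda>X. a *\<^sub>g f X)" for a f g
    by (auto simp: d1_def fun_eq_iff br_simps cscale_def algebra_simps)
  moreover have "(\<lambda>_. 0) \<in> C1" "f \<in> C1 \<Longrightarrow> g \<in> C1 \<Longrightarrow> (\<lambda>X. f X + g X) \<in> C1"
    "f \<in> C1 \<Longrightarrow> (\<lambda>X. a *\<^sub>g f X) \<in> C1" for a f g
    using vector_space_axioms
    by (auto simp: C1_def Vector_Spaces.linear_iff algebra_simps)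
  ultimately show ?thesis
    unfolding cochains.subspace_def B2_def by (auto intro: image_eqI)
qed

lemma jacobi': "\<lbrakk>\<lbrakk>X, Y\<rbrakk>, Z\<rbrakk> = \<lbrakk>X, \<lbrakk>Y, Z\<rbrakk>\<rbrakk> + \<lbrakk>Y, \<lbrakk>X, Z\<rbrakk>\<rbrakk>"
proof -
  have "\<lbrakk>\<lbrakk>X, Y\<rbrakk>, Z\<rbrakk> + (\<lbrakk>X, \<lbrakk>Y, Z\<rbrakk>\<rbrakk> + \<lbrakk>Y, \<lbrakk>X, Z\<rbrakk>\<rbrakk>) = 0"
    using jacobi[of X Y Z] br_symmetric[of "\<lbrakk>X, Y\<rbrakk>" Z] br_symmetric[of X Z] by (simp add: ac_simps)
  then show ?thesis
    by (simp only: sum_zero_iff)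
qed

lemma d1_Z2:
  assumes "Vector_Spaces.linear scale scale g"
  shows "d1 g \<in> Z2"
proof -
  interpret g: Vector_Spaces.linear scale scale g by fact
  have C2: "d1 g \<in> C2"
    by (auto simp: C2_iff d1_def br_simps br_self g.add g.scale g.zero algebra_simps)
  have "\<lbrakk>X, d1 g Y Z\<rbrakk> + \<lbrakk>Y, d1 g Z X\<rbrakk> + \<lbrakk>Z, d1 g X Y\<rbrakk>
      + (d1 g \<lbrakk>X, Y\<rbrakk> Z + d1 g \<lbrakk>Y, Z\<rbrakk> X + d1 g \<lbrakk>Z, X\<rbrakk> Y) = 0" for X Y Z
  proof -
    have "g \<lbrakk>\<lbrakk>X, Y\<rbrakk>, Z\<rbrakk> + g \<lbrakk>\<lbrakk>Y, Z\<rbrakk>, X\<rbrakk> + g \<lbrakk>\<lbrakk>Z, X\<rbrakk>, Y\<rbrakk> = g (\<lbrakk>X, \<lbrakk>Y, Z\<rbrakk>\<rbrakk> + \<lbrakk>Y, \<lbrakk>Z, X\<rbrakk>\<rbrakk> + \<lbrakk>Z, \<lbrakk>X, Y\<rbrakk>\<rbrakk>)"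
      unfolding g.add br_symmetric[of "\<lbrakk>X, Y\<rbrakk>" Z] br_symmetric[of "\<lbrakk>Y, Z\<rbrakk>" X] br_symmetric[of "\<lbrakk>Z, X\<rbrakk>" Y]
      by (simp add: ac_simps)
    then have *: "g \<lbrakk>\<lbrakk>X, Y\<rbrakk>, Z\<rbrakk> + g \<lbrakk>\<lbrakk>Y, Z\<rbrakk>, X\<rbrakk> + g \<lbrakk>\<lbrakk>Z, X\<rbrakk>, Y\<rbrakk> = 0"
      by (simp add: jacobi g.zero)
    have "\<lbrakk>X, d1 g Y Z\<rbrakk> + \<lbrakk>Y, d1 g Z X\<rbrakk> + \<lbrakk>Z, d1 g X Y\<rbrakk>
      + (d1 g \<lbrakk>X, Y\<rbrakk> Z + d1 g \<lbrakk>Y, Z\<rbrakk> X + d1 g \<lbrakk>Z, X\<rbrakk> Y)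
      = g \<lbrakk>\<lbrakk>X, Y\<rbrakk>, Z\<rbrakk> + g \<lbrakk>\<lbrakk>Y, Z\<rbrakk>, X\<rbrakk> + g \<lbrakk>\<lbrakk>Z, X\<rbrakk>, Y\<rbrakk>"
      unfolding d1_def minus_plus br_simps jacobi'[of X Y "g Z"] jacobi'[of Y Z "g X"] jacobi'[of X Z "g Y"]
        br_symmetric[of Z X] br_symmetric[of "g _" _]
      by (simp add: ac_simps)
    with * show ?thesis by simp
  qed
  with C2 show ?thesis
    by (simp add: Z2_iff)
qed

lemma B2_Z2: "B2 \<subseteq> Z2"
  unfolding B2_def C1_def using d1_Z2 by auto

lemma act_flip_Z2:
  assumes "c \<in> Z2"
  shows "act flip c \<in> Z2"
proof -
  interpret F: Vector_Spaces.linear scale scale flip by (rule extend_linear)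
  have hom: "\<lbrakk>flip X, flip Y\<rbrakk> = flip \<lbrakk>X, Y\<rbrakk>" for X Y
    using flip_automorphism by (simp add: automorphism_def)
  have C2: "c \<in> C2"
    using assms by (simp add: Z2_def)
  have act: "act flip c X Y = flip (c (flip X) (flip Y))" for X Y
    by (simp add: act_def inv_flip)
  have "act flip c \<in> C2"
    by (simp add: C2_iff act F.add F.scale F.zero C2_simps[OF C2])
  moreover have "\<lbrakk>X, act flip c Y Z\<rbrakk> + \<lbrakk>Y, act flip c Z X\<rbrakk> + \<lbrakk>Z, act flip c X Y\<rbrakk>
    + (act flip c \<lbrakk>X, Y\<rbrakk> Z + act flip c \<lbrakk>Y, Z\<rbrakk> X + act flip c \<lbrakk>Z, X\<rbrakk> Y) = 0" for X Y Z
  proof -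
    have br1: "\<lbrakk>U, flip V\<rbrakk> = flip \<lbrakk>flip U, V\<rbrakk>" for U V
      using hom[of "flip U" V] by (simp add: flip_flip)
    have br2: "flip \<lbrakk>U, V\<rbrakk> = \<lbrakk>flip U, flip V\<rbrakk>" for U V
      by (simp add: hom)
    have "flip (\<lbrakk>flip X, c (flip Y) (flip Z)\<rbrakk> + \<lbrakk>flip Y, c (flip Z) (flip X)\<rbrakk> + \<lbrakk>flip Z, c (flip X) (flip Y)\<rbrakk>
      + (c \<lbrakk>flip X, flip Y\<rbrakk> (flip Z) + c \<lbrakk>flip Y, flip Z\<rbrakk> (flip X) + c \<lbrakk>flip Z, flip X\<rbrakk> (flip Y))) = flip 0"
      using assms unfolding Z2_iff by simp
    then show ?thesis
      unfolding act br1 F.add F.zero br2[of X Y] br2[of Y Z] br2[of Z X] .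
  qed
  ultimately show ?thesis
    by (simp add: Z2_iff)
qed

section \<open>The listed cochains are cocycles\<close>

definition form_cochain :: "form \<Rightarrow> 'g \<Rightarrow> 'g \<Rightarrow> 'g" where
  "form_cochain ts = (\<Sum>(p, u, v, w)\<leftarrow>ts. val p \<odot> (b u \<otimes> b v \<^bold>\<and> b w))"

lemma form_cochain_simps:
  "form_cochain [] = 0"
  "form_cochain ((p, u, v, w) # ts) = val p \<odot> (b u \<otimes> b v \<^bold>\<and> b w) + form_cochain ts"
  "form_cochain (ts @ us) = form_cochain ts + form_cochain us"
  by (simp_all add: form_cochain_def)

lemma form_cochain_scale: "form_cochain (scale_form p ts) = val p \<odot> form_cochain ts"
  by (induction ts)
     (auto simp: form_cochain_simps scale_form_def val_mult cscale_def fun_eq_iff scale_right_distrib)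

lemma tensor_coord: "(u \<otimes> b v \<^bold>\<and> b w) X Y = (coord v X * coord w Y + coord v Y * coord w X) *\<^sub>g u"
  by (simp add: tensor_def coord_def)

lemma form_cochain_b: "form_cochain ts (b i) (b j) = combination scale val b (row_at (form_row ts i) j)"
proof (induction ts)
  case (Cons t ts)
  obtain p u v w where t: "t = (p, u, v, w)"
    by (cases t)
  show ?case
    using Cons by (cases "v = w"; cases "v = i"; cases "w = i")
      (auto simp: t form_cochain_simps cscale_def tensor_coord coord_b)
qed (simp add: form_cochain_simps)

lemma form_cochain_C2: "form_cochain ts \<in> C2"
proof (induction ts)
  case Nil
  then show ?case
    by (simp add: form_cochain_simps C2_iff)
next
  case (Cons t ts)
  have "b u \<otimes> b v \<^bold>\<and> b w \<in> C2" for u v w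
    by (auto simp: C2_iff tensor_coord coord_add coord_scale algebra_simps simp flip: scale_left_distrib)
  with Cons show ?case
    by (cases t) (simp only: form_cochain_simps cochains.subspace_add[OF C2_subspace]
        cochains.subspace_scale[OF C2_subspace])
qed

definition endo_map :: "endo \<Rightarrow> 'g \<Rightarrow> 'g" where
  "endo_map es = extend (\<lambda>i. combination scale val b (endo_at es i))"

lemma endo_map_linear: "Vector_Spaces.linear scale scale (endo_map es)"
  unfolding endo_map_def by (rule extend_linear)

lemma d1_endo_b: "d1 (endo_map es) (b i) (b j) = combination scale val b (diff_at es i j)"
  unfolding d1_def br_b combination_linear[OF endo_map_linear]
  by (simp add: endo_map_def diff_at_def ad_combination endo_combi_def combination_bind)

lemma d1_endo_Z2: "d1 (endo_map es) \<in> Z2" "d1 (endo_map es) \<in> B2"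
  using d1_Z2[OF endo_map_linear] by (auto simp: B2_def C1_def endo_map_linear)

definition square :: "'g \<Rightarrow> 'g \<Rightarrow> 'g \<Rightarrow> 'g" where
  "square U X Y = \<lbrakk>\<lbrakk>U, X\<rbrakk>, \<lbrakk>U, Y\<rbrakk>\<rbrakk>"

text \<open>For the derivation \<open>D = ad U\<close> the cochain is \<open>(X, Y) \<mapsto> [D X, D Y]\<close>. In its differential, the
  brackets \<open>[D [X, Y], D Z]\<close> and \<open>[Z, [D X, D Y]]\<close> expand, by the Leibniz rule and cyclically,
  into the same six terms, which cancel in characteristic two.\<close>

lemma square_Z2: "square U \<in> Z2"
proof -
  have "square U \<in> C2"
    by (simp add: C2_iff square_def br_simps br_self)
  moreover have "\<lbrakk>X, square U Y Z\<rbrakk> + \<lbrakk>Y, square U Z X\<rbrakk> + \<lbrakk>Z, square U X Y\<rbrakk>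
    + (square U \<lbrakk>X, Y\<rbrakk> Z + square U \<lbrakk>Y, Z\<rbrakk> X + square U \<lbrakk>Z, X\<rbrakk> Y) = 0" for X Y Z
  proof -
    have derivation: "\<lbrakk>U, \<lbrakk>V, W\<rbrakk>\<rbrakk> = \<lbrakk>\<lbrakk>U, V\<rbrakk>, W\<rbrakk> + \<lbrakk>V, \<lbrakk>U, W\<rbrakk>\<rbrakk>" for U V W
      using jacobi'[of U V W] by simp
    have left: "\<lbrakk>V, \<lbrakk>\<lbrakk>U, Y\<rbrakk>, \<lbrakk>U, Z\<rbrakk>\<rbrakk>\<rbrakk> = \<lbrakk>\<lbrakk>V, \<lbrakk>U, Y\<rbrakk>\<rbrakk>, \<lbrakk>U, Z\<rbrakk>\<rbrakk> + \<lbrakk>\<lbrakk>\<lbrakk>U, Z\<rbrakk>, V\<rbrakk>, \<lbrakk>U, Y\<rbrakk>\<rbrakk>" for V Y Z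
      unfolding derivation[of V "\<lbrakk>U, Y\<rbrakk>" "\<lbrakk>U, Z\<rbrakk>"] br_symmetric[of V "\<lbrakk>U, Z\<rbrakk>"]
        br_symmetric[of "\<lbrakk>U, Y\<rbrakk>" "\<lbrakk>\<lbrakk>U, Z\<rbrakk>, V\<rbrakk>"] ..
    have right: "\<lbrakk>\<lbrakk>U, \<lbrakk>V, W\<rbrakk>\<rbrakk>, \<lbrakk>U, Z\<rbrakk>\<rbrakk> = \<lbrakk>\<lbrakk>\<lbrakk>U, V\<rbrakk>, W\<rbrakk>, \<lbrakk>U, Z\<rbrakk>\<rbrakk> + \<lbrakk>\<lbrakk>V, \<lbrakk>U, W\<rbrakk>\<rbrakk>, \<lbrakk>U, Z\<rbrakk>\<rbrakk>" for V W Z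
      unfolding derivation[of U V W] br_simps ..
    show ?thesis
      unfolding square_def left right by (simp add: ac_simps)
  qed
  ultimately show ?thesis
    by (simp add: Z2_iff)
qed

lemma square_b: "square (b k) (b i) (b j) = combination scale val b (square_at k i j)"
  unfolding square_def square_at_def combination_bind ad_combination br_b[of k i]
    combination_linear[OF br_left] by (simp add: br_b)

lemma square_data_cocycle:
  assumes "(ts, s, k, es) \<in> set square_data"
  shows "form_cochain ts \<in> Z2"
proof -
  let ?P = "\<lambda>i j. val s *\<^sub>g form_cochain ts (b i) (b j) + (square (b k) (b i) (b j) + d1 (endo_map es) (b i) (b j)) = 0"
  note Z2 = square_Z2[of "b k"] d1_endo_Z2(1)[of es]
  note C2 = form_cochain_C2[of ts] Z2[THEN Z2_C2]
  have checked: "coef_unit s" "all_pairs (square_row ts s k es) basis_list"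
    using square_check assms by (auto simp: list_all_iff)
  have "?P i j" if "square_row ts s k es i j" for i j
    using combination_vanishes(1)[OF that[unfolded square_row_def square_cell_def], of b]
    by (simp add: combination_scale form_cochain_b square_b d1_endo_b)
  then have "all_pairs ?P basis_list"
    using checked(2) by (rule all_pairs_mono[rotated])
  then have "?P i j" for i j
  proof (rule all_pairs_symmetric)
    show "?P i i" for i
      by (simp add: C2[THEN C2_simps(5)])
    show "?P j i" if "?P i j" for i j
      using that unfolding C2[THEN C2_symmetric, of "b i" "b j"] .
  qed (simp_all add: set_basis_list)
  then have "(val s \<odot> form_cochain ts) (b i) (b j) = (square (b k) + d1 (endo_map es)) (b i) (b j)" for i j
    by (simp add: cscale_def sum_zero_iff)
  then have "val s \<odot> form_cochain ts = square (b k) + d1 (endo_map es)"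
    by (rule C2_determined[rotated 2])
       (intro cochains.subspace_add[OF C2_subspace] cochains.subspace_scale[OF C2_subspace] C2)+
  then have "val s \<odot> form_cochain ts \<in> Z2"
    using cochains.subspace_add[OF Z2_subspace Z2] by simp
  then have "inverse (val s) \<odot> val s \<odot> form_cochain ts \<in> Z2"
    by (rule cochains.subspace_scale[OF Z2_subspace])
  then show ?thesis
    using val_unit[OF checked(1)] by simp
qed

definition derivative :: "'g \<Rightarrow> 'g \<Rightarrow> 'g" where
  "derivative X Y = extend (\<lambda>i. extend (\<lambda>j. combination scale dval b (bracket i j)) Y) X"

lemma derivative_b: "derivative (b i) (b j) = combination scale dval b (bracket i j)"
  by (simp add: derivative_def)

lemma derivative_linear:
  "Vector_Spaces.linear scale scale (derivative X)" "Vector_Spaces.linear scale scale (\<lambda>X. derivative X Y)"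
proof -
  show "Vector_Spaces.linear scale scale (\<lambda>X. derivative X Y)"
    unfolding derivative_def by (rule extend_linear)
  interpret e: Vector_Spaces.linear scale scale "extend F" for F by (rule extend_linear)
  show "Vector_Spaces.linear scale scale (derivative X)"
    by (rule linearI) (simp_all add: derivative_def e.add e.scale extend_add extend_scale)
qed

lemma derivative_C2: "derivative \<in> C2"
proof -
  have "derivative X X = 0" for X
  proof (rule alternatingI[where T = derivative])
    fix i j
    have "vanishes (bracket i j @ bracket j i)" "vanishes (bracket i i)"
      using bracket_check by (simp_all add: for_all_iff)
    from this[THEN combination_vanishes(2), of b]
    show "derivative (b i) (b j) = derivative (b j) (b i)" "derivative (b i) (b i) = 0"
      by (simp_all add: derivative_b sum_zero_iff)
  qed (rule derivative_linear)+
  then show ?thesis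
    using derivative_linear by (simp add: C2_def)
qed

lemma d2_trilinear:
  assumes "c \<in> C2"
  shows "Vector_Spaces.linear scale scale (\<lambda>X. d2 c X Y Z)"
    "Vector_Spaces.linear scale scale (\<lambda>Y. d2 c X Y Z)"
    "Vector_Spaces.linear scale scale (d2 c X Y)"
  by (intro linearI; simp add: d2_def C2_simps[OF assms] br_simps algebra_simps)+

text \<open>Differentiating the Jacobi identity of the table with respect to \<open>\<alpha>\<close> gives the cocycle identity.\<close>

lemma derivative_Z2: "derivative \<in> Z2"
proof -
  note C2 = derivative_C2
  let ?P = "\<lambda>i j k. d2 derivative (b i) (b j) (b k) = 0"
  have part: "combination scale dval b (ad_combi i (bracket j k))
      = derivative \<lbrakk>b j, b k\<rbrakk> (b i) + \<lbrakk>b i, derivative (b j) (b k)\<rbrakk>" for i j k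
    unfolding ad_combi_def combination_bind_deriv br_b[of j k] C2_symmetric[OF C2, of _ "b i"]
      combination_linear[OF C2_linear(1)[OF C2]] derivative_b combination_linear[OF br_right]
    by (simp add: br_b derivative_b ac_simps)
  have "?P i j k" if "vanishes (jacobi_terms i j k)" for i j k
    using combination_vanishes(2)[OF that, of b]
    unfolding jacobi_terms_def d2_cyclic[OF C2] combination_append part by (simp add: ac_simps)
  then have "all_triples ?P basis_list"
    using jacobi_check by (rule all_triples_mono[rotated])
  then have "?P i j k" for i j k
  proof (rule all_triples_symmetric)
    show "?P i i j" for i j
      unfolding d2_cyclic[OF C2] using C2_symmetric[OF C2, of "b i" "b j"] br_symmetric[of "b i" "b j"]
        C2_symmetric[OF C2, of "\<lbrakk>b j, b i\<rbrakk>" "b i"]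
      by (simp add: C2_simps[OF C2] br_self br_simps)
    show "?P j k i" if "?P i j k" for i j k
      using that unfolding d2_cyclic[OF C2] by (simp add: ac_simps)
    show "?P j i k" if "?P i j k" for i j k
      using that unfolding d2_cyclic[OF C2] br_symmetric[of "b j" "b i"] br_symmetric[of "b i" "b k"]
        br_symmetric[of "b k" "b j"] C2_symmetric[OF C2, of "b j" "b i"] C2_symmetric[OF C2, of "b i" "b k"]
        C2_symmetric[OF C2, of "b k" "b j"]
      by (simp add: ac_simps)
  qed (simp_all add: set_basis_list)
  then have "d2 derivative X Y Z = 0" for X Y Z
    by (rule trilinear_determined[of "d2 derivative", OF d2_trilinear[OF C2]])
  with C2 show ?thesis
    by (simp add: Z2_def)
qed

lemma t_0_cocycle: "form_cochain t_0 \<in> Z2"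
proof -
  let ?P = "\<lambda>i j. val ca *\<^sub>g form_cochain t_0 (b i) (b j)
    + (val ca *\<^sub>g derivative (b i) (b j) + d1 (endo_map endo_0) (b i) (b j)) = 0"
  note Z2 = derivative_Z2 d1_endo_Z2(1)[of endo_0]
  note C2 = form_cochain_C2[of t_0] Z2[THEN Z2_C2]
  have "?P i j" if "derivative_row t_0 endo_0 i j" for i j
    using combination_vanishes(1)[OF that[unfolded derivative_row_def derivative_cell_def], of b]
    unfolding combination_append combination_scale combination_map_coef form_cochain_b derivative_b d1_endo_b .
  then have "all_pairs ?P basis_list"
    using derivative_check by (rule all_pairs_mono[rotated])
  then have "?P i j" for i j
  proof (rule all_pairs_symmetric)
    show "?P i i" for i
      by (simp add: C2[THEN C2_simps(5)])
    show "?P j i" if "?P i j" for i j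
      using that unfolding C2[THEN C2_symmetric, of "b i" "b j"] .
  qed (simp_all add: set_basis_list)
  then have "(val ca \<odot> form_cochain t_0) (b i) (b j) = (val ca \<odot> derivative + d1 (endo_map endo_0)) (b i) (b j)" for i j
    by (simp add: cscale_def sum_zero_iff)
  then have "val ca \<odot> form_cochain t_0 = val ca \<odot> derivative + d1 (endo_map endo_0)"
    by (rule C2_determined[rotated 2])
       (intro cochains.subspace_add[OF C2_subspace] cochains.subspace_scale[OF C2_subspace] C2)+
  then have "val ca \<odot> form_cochain t_0 \<in> Z2"
    using cochains.subspace_add[OF Z2_subspace cochains.subspace_scale[OF Z2_subspace Z2(1)] Z2(2)] by simp
  then have "inverse (val ca) \<odot> val ca \<odot> form_cochain t_0 \<in> Z2"
    by (rule cochains.subspace_scale[OF Z2_subspace])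
  then show ?thesis
    using \<alpha>_nonzero by simp
qed

lemma b_eqs:
  "b X1 = x 1" "b X2 = x 2" "b X3 = x 3" "b X4 = x 4" "b X5 = x 5" "b X6 = x 6" "b X7 = x 7"
  "b X8 = x 8" "b X9 = x 9" "b X10 = x 10" "b X11 = x 11" "b X12 = x 12" "b X13 = x 13"
  "b X14 = x 14" "b X15 = x 15" "b Y1 = y 1" "b Y2 = y 2" "b Y3 = y 3" "b Y4 = y 4" "b Y5 = y 5"
  "b Y6 = y 6" "b Y7 = y 7" "b Y8 = y 8" "b Y9 = y 9" "b Y10 = y 10" "b Y11 = y 11"
  "b Y12 = y 12" "b Y13 = y 13" "b Y14 = y 14" "b Y15 = y 15" "b T1 = h 1" "b T2 = h 2"
  "b T3 = h 3" "b T4 = h 4"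
  by (simp_all add: b_def x_def y_def)

lemma val_eqs: "val c1 = 1" "val ca = \<alpha>" "val cb = 1 + \<alpha>" "val ca2 = \<alpha>^2" "val ca3 = \<alpha>^3"
  "val ca2b = \<alpha>^2 * (1 + \<alpha>)" "val ca2bb = \<alpha>^2 * (1 + \<alpha>^2)" "val ca3b = \<alpha>^3 * (1 + \<alpha>)"
  by (simp_all add: algebra_simps power2_eq_square power3_eq_cube)

text \<open>The lists repeat the shape of the definitions, so only coefficients have to be evaluated.\<close>

lemma listed_forms:
  "form_cochain t_m12 = c_m12" "form_cochain t_m10 = c_m10" "form_cochain t_m8_1 = c_m8_1"
  "form_cochain t_m8_2 = c_m8_2" "form_cochain t_m6_1 = c_m6_1" "form_cochain t_m6_2 = c_m6_2"
  "form_cochain t_m4_1 = c_m4_1" "form_cochain t_m4_2 = c_m4_2" "form_cochain t_m2 = c_m2"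
  "form_cochain t_0 = c_0"
  unfolding t_m12_def t_m10_def t_m8_1_def t_m8_2_def t_m6_1_def t_m6_2_def t_m4_1_def t_m4_2_def t_m2_def t_0_def
    c_m12_def c_m10_def c_m8_1_def c_m8_2_def c_m6_1_def c_m6_2_def c_m4_1_def c_m4_2_def c_m2_def c_0_def
    form_cochain_simps form_cochain_scale b_eqs val_eqs cochains.scale_one
  by (simp_all only: add.assoc add_0_right)

lemma negative_cocycles_forms: "negative_cocycles = form_cochain ` set negative_forms"
  by (simp add: negative_cocycles_def negative_forms_def listed_forms)

lemma act_form: "act flip (form_cochain ts) = form_cochain (swap_form ts)"
proof -
  interpret F: Vector_Spaces.linear scale scale flip by (rule extend_linear)
  have coord_flip: "coord i (flip X) = coord (swap i) X" for i X
  proof -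
    have "coord i (flip X) = (\<Sum>j\<in>UNIV. coord j X * of_bool (i = swap j))"
      by (simp add: extend_def coord_sum coord_scale coord_b)
    also have "\<dots> = (\<Sum>j\<in>UNIV. if j = swap i then coord (swap i) X else 0)"
      by (intro sum.cong) auto
    finally show ?thesis by simp
  qed
  have "flip (form_cochain ts (flip X) (flip Y)) = form_cochain (swap_form ts) X Y" for X Y
    by (induction ts) (auto simp: form_cochain_simps swap_form_def cscale_def tensor_coord
      F.add F.scale F.zero coord_flip)
  then show ?thesis
    by (simp add: act_def inv_flip fun_eq_iff)
qed

abbreviation listed :: "('g \<Rightarrow> 'g \<Rightarrow> 'g) set" where
  "listed \<equiv> negative_cocycles \<union> {c_0} \<union> act \<omega> ` negative_cocycles"

lemma listed_Z2: "listed \<subseteq> Z2"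
proof -
  have "fst ` set square_data = set negative_forms"
    by (simp add: square_data_def negative_forms_def)
  then have "negative_cocycles \<subseteq> Z2"
    unfolding negative_cocycles_forms using square_data_cocycle by force
  then show ?thesis
    using t_0_cocycle act_flip_Z2 by (auto simp: listed_forms omega_eq)
qed

end

lemma move_forms:
  "\<forall>r\<in>set (concat (map fst blocks)). case fst r of Diff es \<Rightarrow> True
     | Coc ts \<Rightarrow> ts \<in> insert t_0 (set negative_forms \<union> swap_form ` set negative_forms)"
  by (simp add: blocks_def negative_blocks_def zero_block_def swap_block_def negative_forms_def)

context wk4_char2
begin

section \<open>Elimination along pivots\<close>

lemma cochain_double [simp]: "(c :: 'g \<Rightarrow> 'g \<Rightarrow> 'g) + c = 0" "(c :: 'g \<Rightarrow> 'g \<Rightarrow> 'g) + (c + d) = d"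
  by (simp_all add: fun_eq_iff)

definition value_at :: "('g \<Rightarrow> 'g \<Rightarrow> 'g) \<Rightarrow> key \<Rightarrow> 'k" where
  "value_at c = (\<lambda>(i, j, m). coord m (c (b i) (b j)))"

lemma value_at_simps:
  "value_at (c + c') k = value_at c k + value_at c' k" "value_at (a \<odot> c) k = a * value_at c k"
  "value_at 0 k = 0"
  by (simp_all add: value_at_def coord_add coord_scale cscale_def split: prod.splits)

primrec move_cochain :: "move \<Rightarrow> 'g \<Rightarrow> 'g \<Rightarrow> 'g" where
  "move_cochain (Diff es) = d1 (endo_map es)"
| "move_cochain (Coc ts) = form_cochain ts"

lemma coord_combination:
  "coord m (combination scale val b ts) = val (fold coef_add (map snd (filter (\<lambda>t. fst t = m) ts)) [])"
proof -
  have "val (fold coef_add ps q) = (\<Sum>p\<leftarrow>ps. val p) + val q" for ps q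
    by (induction ps arbitrary: q) (simp_all add: val_add ac_simps)
  moreover have "coord m (combination scale val b ts) = (\<Sum>p\<leftarrow>map snd (filter (\<lambda>t. fst t = m) ts). val p)"
    by (induction ts) (auto simp: coord_add coord_scale coord_b)
  ultimately show ?thesis
    by simp
qed

lemma value_at_move: "value_at (move_cochain mv) k = val (move_at mv k)"
  by (cases mv; cases k) (simp_all add: value_at_def d1_endo_b form_cochain_b coord_combination)

text \<open>The moves are used in order; by triangularity each leaves the earlier pivots at zero.\<close>

lemma eliminate:
  assumes "triangular rs"
  shows "\<exists>s\<in>cochains.span (move_cochain ` fst ` set rs). \<forall>r\<in>set rs. value_at (c + s) (snd r) = 0"
  using assms
proof (induction rs arbitrary: c)
  case Nil
  then show ?case
    using cochains.span_zero by auto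
next
  case (Cons r rs)
  define \<mu> where "\<mu> = move_cochain (fst r)"
  define a where "a = value_at c (snd r) / value_at \<mu> (snd r)"
  obtain s where s: "s \<in> cochains.span (move_cochain ` fst ` set rs)"
    and zero: "\<And>r'. r' \<in> set rs \<Longrightarrow> value_at ((c + a \<odot> \<mu>) + s) (snd r') = 0"
    using Cons by fastforce
  have "value_at \<mu> (snd r) \<noteq> 0"
    using Cons.prems by (simp add: \<mu>_def value_at_move val_unit)
  then have "value_at (c + a \<odot> \<mu>) (snd r) = 0"
    by (simp add: value_at_simps a_def)
  moreover have "value_at s (snd r) = 0"
    using s
  proof (induction rule: cochains.span_induct_alt)
    case base
    show ?case by (rule value_at_simps(3))
  next
    case (step x y z)
    moreover have "value_at y (snd r) = 0"
      using step.hyps(1) Cons.prems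
      by (auto simp: list_all_iff zero_at_def value_at_move coef_val_zero)
    ultimately show ?case
      unfolding value_at_simps by simp
  qed
  ultimately have "\<forall>r'\<in>set (r # rs). value_at (c + (a \<odot> \<mu> + s)) (snd r') = 0"
    using zero by (auto simp: value_at_simps add.assoc)
  moreover have "a \<odot> \<mu> + s \<in> cochains.span (move_cochain ` fst ` set (r # rs))"
  proof (intro cochains.span_add cochains.span_scale)
    show "\<mu> \<in> cochains.span (move_cochain ` fst ` set (r # rs))"
      by (rule cochains.span_base) (simp add: \<mu>_def)
    show "s \<in> cochains.span (move_cochain ` fst ` set (r # rs))"
      using s cochains.span_mono[of "move_cochain ` fst ` set rs"] by auto
  qed
  ultimately show ?case
    by blast
qed

text \<open>A coboundary among the moves costs nothing, every other move is listed.\<close>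

lemma moves_listed:
  "\<exists>s\<in>cochains.span listed. c + s \<in> B2" if "c \<in> cochains.span (move_cochain ` fst ` set (concat (map fst blocks)))"
proof -
  let ?W = "{c. \<exists>s\<in>cochains.span listed. c + s \<in> B2}"
  have zero: "0 \<in> B2"
    by (rule cochains.subspace_0[OF B2_subspace])
  have "cochains.subspace ?W"
    unfolding cochains.subspace_def
  proof (intro conjI ballI allI; clarify?)
    show "\<exists>s\<in>cochains.span listed. 0 + s \<in> B2"
      using zero cochains.span_zero by force
  next
    fix c c' s s'
    assume s: "s \<in> cochains.span listed" "c + s \<in> B2" "s' \<in> cochains.span listed" "c' + s' \<in> B2"
    have "(c + c') + (s + s') = (c + s) + (c' + s')"
      by (simp only: ac_simps)
    with s cochains.subspace_add[OF B2_subspace s(2,4)] cochains.span_add[OF s(1,3)]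
    show "\<exists>s\<in>cochains.span listed. c + c' + s \<in> B2"
      by metis
  next
    fix a c s
    assume s: "s \<in> cochains.span listed" "c + s \<in> B2"
    from s show "\<exists>s\<in>cochains.span listed. a \<odot> c + s \<in> B2"
      using cochains.subspace_scale[OF B2_subspace s(2), of a] cochains.span_scale[OF s(1), of a]
      by (metis cochains.scale_right_distrib)
  qed
  moreover have "move_cochain ` fst ` set (concat (map fst blocks)) \<subseteq> ?W"
    unfolding image_image
  proof (intro image_subsetI)
    fix r assume "r \<in> set (concat (map fst blocks))"
    with move_forms have r: "case fst r of Diff es \<Rightarrow> True
      | Coc ts \<Rightarrow> ts \<in> insert t_0 (set negative_forms \<union> swap_form ` set negative_forms)"
      by blast
    show "move_cochain (fst r) \<in> ?W"
    proof (cases "fst r")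
      case (Diff es)
      have "d1 (endo_map es) + 0 \<in> B2"
        using d1_endo_Z2(2) by simp
      then show ?thesis
        using Diff by (intro CollectI bexI[of _ 0] cochains.span_zero) simp
    next
      case (Coc ts)
      have "form_cochain ts \<in> listed"
        using r Coc by (auto simp: negative_cocycles_forms listed_forms omega_eq simp flip: act_form)
      moreover have "form_cochain ts + form_cochain ts = 0"
        by (simp add: fun_eq_iff)
      ultimately show ?thesis
        using Coc zero by (intro CollectI bexI[of _ "form_cochain ts"] cochains.span_base) simp_all
    qed
  qed
  ultimately show ?thesis
    using cochains.span_minimal[of _ ?W] that by blast
qed

section \<open>The torus acts trivially on cohomology\<close>

lemma parity_length: "length (parity i) = 4"
  by (cases i) simp_all

lemma torus_element:
  assumes "n < 4"
  obtains \<tau> where "\<And>i. \<lbrakk>\<tau>, b i\<rbrakk> = of_bool (parity i ! n) *\<^sub>g b i"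
proof -
  obtain ts s where "torus ! n = (ts, s)"
    by (cases "torus ! n")
  moreover have "(n, torus ! n) \<in> set (List.enumerate 0 torus)"
  proof -
    have "length torus = 4"
      by (simp add: torus_def)
    with assms show ?thesis
      by (simp add: in_set_enumerate_eq)
  qed
  ultimately have mem: "(n, ts, s) \<in> set (List.enumerate 0 torus)"
    by simp
  have s: "coef_unit s"
    and ts: "vanishes (ad_combi i ts @ (if parity i ! n then [(i, s)] else []))" for i
    using bspec[OF torus_check[unfolded list_all_iff] mem] unfolding for_all_iff by blast+
  let ?\<tau> = "inverse (val s) *\<^sub>g combination scale val b ts"
  have "\<lbrakk>?\<tau>, b i\<rbrakk> = of_bool (parity i ! n) *\<^sub>g b i" for i
  proof -
    have "\<lbrakk>combination scale val b ts, b i\<rbrakk> = of_bool (parity i ! n) *\<^sub>g val s *\<^sub>g b i"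
      using combination_vanishes(1)[OF ts[of i], of b] br_symmetric[of "b i"]
      by (auto simp: ad_combination sum_zero_iff split: if_splits)
    then show ?thesis
      using val_unit[OF s] by (simp add: br_simps)
  qed
  with that show ?thesis
    by blast
qed

definition odd_at :: "nat \<Rightarrow> key \<Rightarrow> bool" where
  "odd_at n = (\<lambda>(i, j, m). parity i ! n \<noteq> (parity j ! n \<noteq> parity m ! n))"

lemma off_weight_iff: "off_weight k \<longleftrightarrow> (\<exists>n\<in>{0, 1, 2, 3}. odd_at n k)"
proof -
  have "(\<exists>n<4. P n) \<longleftrightarrow> (\<exists>n\<in>{0, 1, 2, 3::nat}. P n)" for P
    by (auto simp: less_Suc_eq numeral_eq_Suc)
  then show ?thesis
    by (cases k) (simp add: odd_at_def list_ex_length parity_length)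
qed

text \<open>Cartan's formula: the coboundary of \<open>c \<tau>\<close> is the action of \<open>\<tau>\<close> on \<open>c\<close>. As \<open>\<tau>\<close> has eigenvalues
  0 and 1 on the algebra, this action is multiplication by 0 or 1 on each coordinate of \<open>c\<close>, and
  subtracting it removes the coordinates of odd \<open>n\<close>-th weight without changing the others.\<close>

lemma torus_step:
  assumes "c \<in> Z2" "n < 4"
  obtains z where "z \<in> Z2" "c + z \<in> B2"
    "\<And>k. value_at z k = (if odd_at n k then 0 else value_at c k)"
proof -
  obtain \<tau> where \<tau>: "\<And>i. \<lbrakk>\<tau>, b i\<rbrakk> = of_bool (parity i ! n) *\<^sub>g b i"
    using torus_element[OF assms(2)] by blast
  have C2: "c \<in> C2"
    using assms(1) by (rule Z2_C2)
  define w where "w = d1 (c \<tau>)"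
  have w: "w \<in> B2"
    using C2_linear(1)[OF C2] by (auto simp: w_def B2_def C1_def)
  have cartan: "w X Y = \<lbrakk>\<tau>, c X Y\<rbrakk> + c \<lbrakk>\<tau>, X\<rbrakk> Y + c \<lbrakk>\<tau>, Y\<rbrakk> X" for X Y
  proof -
    have "\<lbrakk>\<tau>, c X Y\<rbrakk> + \<lbrakk>X, c \<tau> Y\<rbrakk> + \<lbrakk>Y, c \<tau> X\<rbrakk> + c \<lbrakk>\<tau>, X\<rbrakk> Y + c \<lbrakk>\<tau>, Y\<rbrakk> X + c \<lbrakk>X, Y\<rbrakk> \<tau> = 0"
      using assms(1) by (auto simp: Z2_def d2_def)
    then have "w X Y + (\<lbrakk>\<tau>, c X Y\<rbrakk> + c \<lbrakk>\<tau>, X\<rbrakk> Y + c \<lbrakk>\<tau>, Y\<rbrakk> X) = 0"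
      unfolding w_def d1_def minus_plus C2_symmetric[OF C2, of \<tau> "\<lbrakk>X, Y\<rbrakk>"] by (simp only: ac_simps)
    then show ?thesis
      by (simp only: sum_zero_iff)
  qed
  have weight: "coord m \<lbrakk>\<tau>, V\<rbrakk> = of_bool (parity m ! n) * coord m V" for m V
  proof -
    have "\<lbrakk>\<tau>, V\<rbrakk> = \<lbrakk>\<tau>, \<Sum>i\<in>UNIV. coord i V *\<^sub>g b i\<rbrakk>"
      by (simp add: expansion)
    also have "\<dots> = (\<Sum>i\<in>UNIV. (coord i V * of_bool (parity i ! n)) *\<^sub>g b i)"
      by (simp add: br_right.sum br_right.scale \<tau>)
    finally have "coord m \<lbrakk>\<tau>, V\<rbrakk> = (\<Sum>i\<in>UNIV. coord i V * of_bool (parity i ! n) * of_bool (m = i))"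
      by (simp add: coord_sum coord_scale coord_b)
    also have "\<dots> = (\<Sum>i\<in>UNIV. if i = m then of_bool (parity m ! n) * coord m V else 0)"
      by (intro sum.cong) auto
    finally show ?thesis
      by simp
  qed
  show ?thesis
  proof
    show "c + w \<in> Z2"
      using assms(1) w B2_Z2 by (blast intro: cochains.subspace_add[OF Z2_subspace])
    have "c + (c + w) = w"
      by (simp add: fun_eq_iff)
    with w show "c + (c + w) \<in> B2"
      by simp
    show "value_at (c + w) k = (if odd_at n k then 0 else value_at c k)" for k
    proof (cases k)
      case (fields i j m)
      have "coord m (w (b i) (b j)) = (of_bool (parity m ! n) + of_bool (parity i ! n) + of_bool (parity j ! n))
          * coord m (c (b i) (b j))"
        unfolding cartan \<tau> using C2_symmetric[OF C2, of "b j" "b i"]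
        by (simp add: coord_add weight C2_simps[OF C2] coord_scale algebra_simps)
      then show ?thesis
        by (auto simp: fields value_at_def coord_add odd_at_def)
    qed
  qed
qed

lemma torus_invariant:
  assumes "c \<in> Z2" "set ns \<subseteq> {..<4}"
  shows "\<exists>z\<in>Z2. c + z \<in> B2 \<and> (\<forall>k. value_at z k = (if \<exists>n\<in>set ns. odd_at n k then 0 else value_at c k))"
  using assms(2)
proof (induction ns)
  case Nil
  have "c + c \<in> B2"
    unfolding cochain_double by (rule cochains.subspace_0[OF B2_subspace])
  moreover have "\<forall>k. value_at c k = (if \<exists>n\<in>set []. odd_at n k then 0 else value_at c k)"
    by simp
  ultimately show ?case
    using assms(1) by blast
next
  case (Cons n ns)
  then have "set ns \<subseteq> {..<4}"
    by simp
  from Cons.IH[OF this] obtain z where z: "z \<in> Z2" "c + z \<in> B2"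
    "\<And>k. value_at z k = (if \<exists>n\<in>set ns. odd_at n k then 0 else value_at c k)"
    by blast
  obtain z' where z': "z' \<in> Z2" "z + z' \<in> B2" "\<And>k. value_at z' k = (if odd_at n k then 0 else value_at z k)"
    using torus_step[OF z(1), of n] Cons.prems by auto
  have "c + z' = (c + z) + (z + z')"
    by (simp add: fun_eq_iff add.assoc)
  then have "c + z' \<in> B2"
    using cochains.subspace_add[OF B2_subspace z(2) z'(2)] by metis
  moreover have "\<forall>k. value_at z' k = (if \<exists>n\<in>set (n # ns). odd_at n k then 0 else value_at c k)"
    by (simp add: z'(3) z(3))
  ultimately show ?case
    using z'(1) by blast
qed

section \<open>Solving the cocycle equations\<close>

lemma equation_holds:
  assumes "z \<in> Z2"
  shows "combination (*) val (value_at z) (equation q) = 0"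
proof -
  have C2: "z \<in> C2"
    using assms by (rule Z2_C2)
  have part: "combination (*) val (value_at z) (equation_part i j l m)
      = coord m \<lbrakk>b i, z (b j) (b l)\<rbrakk> + coord m (z \<lbrakk>b i, b j\<rbrakk> (b l))" for i j l m
  proof -
    have coord_comb: "coord m (combination scale val B ts) = combination (*) val (\<lambda>k. coord m (B k)) ts" for B ts
      by (induction ts) (simp_all add: coord_add coord_scale)
    have "combination (*) val (value_at z) (concat (map (image_part i j l m) ks))
        = (\<Sum>k\<leftarrow>ks. coord k (z (b j) (b l)) * coord m \<lbrakk>b i, b k\<rbrakk>)" for ks
    proof (induction ks)
      case (Cons k ks)
      have "combination (*) val (value_at z) (map (map_prod (\<lambda>_. (j, l, k)) id) (filter (\<lambda>t. fst t = m) ts))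
          = coord k (z (b j) (b l)) * combination (*) val (\<lambda>k. coord m (b k)) ts" for ts
        by (induction ts) (auto simp: value_at_def coord_b algebra_simps)
      with Cons show ?case
        by (simp add: image_part_def br_b coord_comb)
    qed simp
    also have "(\<Sum>k\<leftarrow>basis_list. coord k (z (b j) (b l)) * coord m \<lbrakk>b i, b k\<rbrakk>)
        = (\<Sum>k\<in>UNIV. coord k (z (b j) (b l)) * coord m \<lbrakk>b i, b k\<rbrakk>)"
      using distinct_basis_list by (simp add: sum_list_distinct_conv_sum_set set_basis_list)
    also have "\<dots> = coord m \<lbrakk>b i, \<Sum>k\<in>UNIV. coord k (z (b j) (b l)) *\<^sub>g b k\<rbrakk>"
      by (simp add: br_right.sum br_right.scale coord_sum coord_scale)
    finally have "combination (*) val (value_at z) (concat (map (image_part i j l m) basis_list))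
        = coord m \<lbrakk>b i, z (b j) (b l)\<rbrakk>"
      by (simp only: expansion)
    moreover have "combination (*) val (value_at z) (map (map_prod (\<lambda>k. (k, l, m)) id) (bracket i j))
        = coord m (z \<lbrakk>b i, b j\<rbrakk> (b l))"
      unfolding br_b combination_linear[OF C2_linear(2)[OF C2]] coord_comb combination_map_key
      by (simp add: value_at_def)
    ultimately show ?thesis
      by (simp add: equation_part_def)
  qed
  obtain i j l m where q: "q = (i, j, l, m)"
    by (cases q)
  have "coord m (\<lbrakk>b i, z (b j) (b l)\<rbrakk> + \<lbrakk>b j, z (b l) (b i)\<rbrakk> + \<lbrakk>b l, z (b i) (b j)\<rbrakk>
    + (z \<lbrakk>b i, b j\<rbrakk> (b l) + z \<lbrakk>b j, b l\<rbrakk> (b i) + z \<lbrakk>b l, b i\<rbrakk> (b j))) = coord m 0"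
    using assms unfolding Z2_iff by simp
  then show ?thesis
    unfolding q equation_def by (simp add: part coord_add ac_simps)
qed

lemma value_at_same_key: "z \<in> C2 \<Longrightarrow> same_key k k' \<Longrightarrow> value_at z k = value_at z k'"
  by (auto simp: same_key_def value_at_def intro: arg_cong[OF C2_symmetric] split: prod.splits)

lemma value_at_known:
  assumes "z \<in> C2" "\<forall>k\<in>set ks. value_at z k = 0" "known ks k"
  shows "value_at z k = 0"
proof (cases "fst k = fst (snd k)")
  case True
  then show ?thesis
    by (cases k) (simp add: value_at_def C2_simps(5)[OF assms(1)])
next
  case False
  then obtain k' where "k' \<in> set ks" "same_key k k'"
    using assms(3) by (auto simp: known_def list_ex_iff)
  then show ?thesis
    using assms(2) value_at_same_key[OF assms(1)] by simp
qed

lemma solve_sound: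
  assumes "z \<in> Z2" "\<forall>k\<in>set ks. value_at z k = 0"
  shows "\<forall>k\<in>set (solve q ks). value_at z k = 0"
proof -
  have C2: "z \<in> C2"
    using assms(1) by (rule Z2_C2)
  have unknown: "combination (*) val (value_at z) (unknown_part ks ts) = combination (*) val (value_at z) ts" for ts
    by (induction ts) (simp_all add: value_at_known[OF C2 assms(2)])
  show ?thesis
  proof (cases "unknown_part ks (equation q)")
    case Nil
    with assms show ?thesis by (simp add: solve_def)
  next
    case (Cons t ts)
    have "value_at z (fst t) = 0"
      if same: "list_all (\<lambda>u. same_key (fst t) (fst u)) ts"
        and unit: "coef_unit (fold coef_add (map snd ts) (snd t))"
    proof -
      have "val (fold coef_add ps q) = (\<Sum>p\<leftarrow>ps. val p) + val q" for ps q
        by (induction ps arbitrary: q) (simp_all add: val_add ac_simps)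
      moreover have "combination (*) val (value_at z) ts = (\<Sum>p\<leftarrow>map snd ts. val p) * value_at z (fst t)"
        using same by (induction ts) (auto simp: value_at_same_key[OF C2] algebra_simps)
      ultimately have "val (fold coef_add (map snd ts) (snd t)) * value_at z (fst t)
          = combination (*) val (value_at z) (t # ts)"
        by (simp add: algebra_simps)
      also have "\<dots> = 0"
        using unknown[of "equation q"] equation_holds[OF assms(1)] Cons by simp
      finally show ?thesis
        using val_unit[OF unit] by simp
    qed
    with Cons assms(2) show ?thesis
      by (auto simp: solve_def)
  qed
qed

lemma solved_sound:
  assumes "z \<in> Z2" "\<forall>r\<in>set (fst bl). value_at z (snd r) = 0"
  shows "\<forall>k\<in>set (solved bl). value_at z k = 0"
proof -
  have "\<forall>k\<in>set (fold solve es ks). value_at z k = 0" if "\<forall>k\<in>set ks. value_at z k = 0" for es ks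
    using that
  proof (induction es arbitrary: ks)
    case (Cons q es)
    from Cons.IH[OF solve_sound[OF assms(1) Cons.prems]] show ?case
      by simp
  qed simp
  from this[of "map snd (fst bl)" "snd bl"] assms(2) show ?thesis
    by (simp add: solved_def case_prod_unfold)
qed

lemma generator_induct:
  assumes closed: "\<And>X Y. X \<in> N \<Longrightarrow> Y \<in> N \<Longrightarrow> \<lbrakk>X, Y\<rbrakk> \<in> N"
    and generators: "\<And>g. g \<in> {X1, X2, X3, X4, Y1, Y2, Y3, Y4} \<Longrightarrow> b g \<in> N"
  shows "b i \<in> N"
proof -
  have brackets: "b T1 = \<lbrakk>b X1, b Y1\<rbrakk>" "b T2 = \<lbrakk>b X2, b Y2\<rbrakk>" "b T3 = \<lbrakk>b X3, b Y3\<rbrakk>" "b T4 = \<lbrakk>b X4, b Y4\<rbrakk>"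
    by (simp_all add: br_b)
  have closure: "arrange (bracket_words br e) (bracket_words br f) h i \<in> N"
    if "\<And>i. e i \<in> N" "\<And>i. f i \<in> N" "\<And>i. h i \<in> N" for i
    by (cases i) (simp_all add: bracket_words_def closed that)
  have "b T1 \<in> N" "b T2 \<in> N" "b T3 \<in> N" "b T4 \<in> N"
    unfolding brackets by (intro closed generators; simp)+
  then have torus: "b k \<in> N" if "k \<in> {T1, T2, T3, T4}" for k
    using that by blast
  have "basis_gen (GenX i) \<in> {X1, X2, X3, X4, Y1, Y2, Y3, Y4}"
    "basis_gen (GenY i) \<in> {X1, X2, X3, X4, Y1, Y2, Y3, Y4}"
    "basis_gen (GenH i) \<in> {T1, T2, T3, T4}" for i
    using exhaust_4[of i] by auto
  then have "e i \<in> N" "f i \<in> N" "h i \<in> N" for i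
    using generators torus b_gen[of i] by metis+
  then show ?thesis
    unfolding b_words by (rule closure)
qed

text \<open>If \<open>z\<close> vanishes whenever one argument is \<open>X\<close> or \<open>Y\<close>, the cocycle identity reduces to
  \<open>z [X, Y] W = 0\<close>, so it suffices to know that \<open>z\<close> vanishes at the generators.\<close>

lemma normalised_cocycle_zero:
  assumes "z \<in> Z2" "\<And>k. off_weight k \<Longrightarrow> value_at z k = 0"
    and "\<forall>r\<in>set (concat (map fst blocks)). value_at z (snd r) = 0"
  shows "z = 0"
proof -
  have C2: "z \<in> C2"
    using assms(1) by (rule Z2_C2)
  have all_solved: "\<forall>k\<in>set all_solved. value_at z k = 0"
    unfolding all_solved_def using assms(3) solved_sound[OF assms(1)] by auto
  have involving: "set (involving g ks) \<subseteq> set ks" for g ks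
    by (induction ks) auto
  have generators: "z (b g) X = 0" if "g \<in> {X1, X2, X3, X4, Y1, Y2, Y3, Y4}" for g X
  proof (rule linear_determined[OF C2_linear(1)[OF C2]])
    fix j
    have "all_settled all_solved g"
      using solved_check that by (auto simp: list_all_iff)
    then have "off_weight (g, j, m) \<or> known (involving g all_solved) (g, j, m)" for m
      by (simp add: all_settled_def settled_everywhere_def settled_at_def settled_def for_all_iff)
    then have "value_at z (g, j, m) = 0" for m
      using assms(2) value_at_known[OF C2, of "involving g all_solved"] involving[of g all_solved] all_solved
      by blast
    then show "z (b g) (b j) = 0"
      by (intro coord_eqI) (simp add: value_at_def)
  qed
  have "b i \<in> {X. \<forall>Y. z X Y = 0}" for i
  proof (rule generator_induct)
    fix X Y
    assume "X \<in> {X. \<forall>Y. z X Y = 0}" "Y \<in> {X. \<forall>Y. z X Y = 0}"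
    then have left: "z X U = 0" "z Y U = 0" for U
      by blast+
    have right: "z U X = 0" "z U Y = 0" for U
      unfolding C2_symmetric[OF C2, of U X] C2_symmetric[OF C2, of U Y] by (rule left)+
    have "z \<lbrakk>X, Y\<rbrakk> W = 0" for W
    proof -
      have "d2 z X Y W = 0"
        using assms(1) by (simp add: Z2_def)
      then show ?thesis
        by (simp add: d2_def left right br_simps)
    qed
    then show "\<lbrakk>X, Y\<rbrakk> \<in> {X. \<forall>Y. z X Y = 0}"
      by simp
  qed (use generators in auto)
  then have on_b: "z (b i) Y = 0" for i Y
    by blast
  have "z X Y = 0" for X Y
    by (rule linear_determined[of "\<lambda>X. z X Y", OF C2_linear(2)[OF C2] on_b])
  then show ?thesis
    by (simp add: fun_eq_iff)
qed

text \<open>First the pivots are brought to zero. The projection to weight zero comes second; it sends each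
  coordinate to itself or to zero, so the pivots stay zero.\<close>

lemma cocycle_decomposition:
  assumes "c \<in> Z2"
  shows "\<exists>s\<in>cochains.span listed. c + s \<in> B2"
proof -
  let ?M = "move_cochain ` fst ` set (concat (map fst blocks))"
  obtain s where s: "s \<in> cochains.span ?M"
    and pivots: "\<forall>r\<in>set (concat (map fst blocks)). value_at (c + s) (snd r) = 0"
    using eliminate[OF triangular_check] by blast
  obtain t where t: "t \<in> cochains.span listed" "s + t \<in> B2"
    using moves_listed[OF s] by blast
  have "cochains.span listed \<subseteq> Z2"
    by (rule cochains.span_minimal[OF listed_Z2 Z2_subspace])
  then have "(s + t) + t \<in> Z2"
    using t B2_Z2 by (blast intro: cochains.subspace_add[OF Z2_subspace])
  then have "s \<in> Z2"
    unfolding add.assoc cochain_double by simp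
  then have "c + s \<in> Z2"
    by (rule cochains.subspace_add[OF Z2_subspace assms])
  then obtain z where z: "z \<in> Z2" "(c + s) + z \<in> B2"
    and value_z: "\<And>k. value_at z k = (if \<exists>n\<in>set [0, 1, 2, 3]. odd_at n k then 0 else value_at (c + s) k)"
    using torus_invariant[of "c + s" "[0, 1, 2, 3]"] by auto
  have "z = 0"
  proof (rule normalised_cocycle_zero[OF z(1)])
    show "value_at z k = 0" if "off_weight k" for k
      using that by (auto simp: value_z off_weight_iff)
    show "\<forall>r\<in>set (concat (map fst blocks)). value_at z (snd r) = 0"
      using pivots by (simp add: value_z)
  qed
  with z(2) have "c + s \<in> B2"
    by simp
  \<comment> \<open>Trade \<open>s\<close>, a combination of moves, for the combination \<open>t\<close> of listed cocycles.\<close>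
  moreover have "c + t = (c + s) + (s + t)"
    by (simp add: fun_eq_iff add.assoc)
  ultimately have "c + t \<in> B2"
    using cochains.subspace_add[OF B2_subspace _ t(2)] by metis
  with t(1) show ?thesis
    by blast
qed

lemma spanned: "H2_spanned_by_classes listed"
  unfolding H2_spanned_by_classes_def
proof (intro conjI)
  show "listed \<subseteq> Z2"
    by (rule listed_Z2)
  have "cochains.span listed \<subseteq> Z2"
    by (rule cochains.span_minimal[OF listed_Z2 Z2_subspace])
  moreover have "cohomology_class c \<in> cohomology_class ` cochains.span listed" if c: "c \<in> Z2" for c
  proof -
    obtain s where s: "s \<in> cochains.span listed" "c + s \<in> B2"
      using cocycle_decomposition[OF c] by blast
    have "cohomology_class c = cohomology_class s"
    proof -
      have sub: "cohomology_class u \<subseteq> cohomology_class v" if "u + v \<in> B2" for u v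
      proof
        fix w assume "w \<in> cohomology_class u"
        then obtain a where a: "a \<in> B2" "w = u + a"
          by (auto simp: cohomology_class_def)
        have "w = v + ((u + v) + a)"
          by (simp add: a(2) fun_eq_iff ac_simps)
        with a(1) that show "w \<in> cohomology_class v"
          using cochains.subspace_add[OF B2_subspace] by (auto simp: cohomology_class_def)
      qed
      from s(2) sub[of c s] sub[of s c] show ?thesis
        by (simp add: add.commute)
    qed
    with s(1) show ?thesis
      by blast
  qed
  ultimately show "H2 = cohomology_class ` cochains.span listed"
    unfolding H2_def by blast
qed

end

theorem lemma9p12:
  fixes scale :: "'k::alg_closed_field \<Rightarrow> 'g::ab_group_add \<Rightarrow> 'g"
    and br :: "'g \<Rightarrow> 'g \<Rightarrow> 'g"
    and \<alpha> :: 'k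
    and e f h :: "4 \<Rightarrow> 'g"
  assumes "CHAR('k) = 2"
    and "\<alpha> \<noteq> 0" and "\<alpha> \<noteq> 1"
    and "wk4 scale br \<alpha> e f h"
  shows "\<not> module.dependent scale (wk4.standard_basis br e f h)
    \<and> module.span scale (wk4.standard_basis br e f h) = UNIV
    \<and> card (wk4.standard_basis br e f h) = 34
    \<and> lie_algebra.H2_spanned_by_classes scale br
        (wk4.negative_cocycles scale br \<alpha> e f h
         \<union> {wk4.c_0 scale br \<alpha> e f h}
         \<union> lie_algebra.act (cartan_matrix_lie_algebra.\<omega> scale br e f h)
             ` wk4.negative_cocycles scale br \<alpha> e f h)"
proof -
  interpret wk4 scale br \<alpha> e f h
    by (rule assms(4))
  interpret wk4_char2 scale br \<alpha> e f h
    by unfold_locales (use assms in auto)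
  show ?thesis
    using independent_standard_basis span_standard_basis card_standard_basis spanned by blast
qed

end
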